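(* Let $k$ be a field, $V_9$ a $9$-dimensional $k$-vector space, $u\in\bigwedge^3V_9$ a stable element, and $\Phi\colon V_9^*\to V_9\otimes\mathcal O_{\mathbf{P}(V_9^* )}(1)$ the associated family of alternating matrices. Let $X\subset\mathbf{P}(V_9^* )$ be the locus where $\operatorname{rank}\Phi\le4$. Then $X$ is smooth of dimension $2$, and the locus in $\mathbf{P}(V_9^* )$ where $\operatorname{rank}\Phi\le2$ is empty.
   Context: $\mathbf{P}(V_9^* )$ is the space of lines in $V_9^*$, so $V_9$ is its space of linear forms. An element $u$ is stable if, for the action of $\mathbf{SL}(V_9)/\boldsymbol{\mu}_3$ over an algebraic closure of $k$, its stabilizer is finite and its orbit is closed. Given $u$, apply the comultiplication $\bigwedge^3V_9\to\bigwedge^2V_9\otimes V_9$ and the surjection $V_9\otimes\mathcal O_{\mathbf{P}(V_9^* )}\to\mathcal O_{\mathbf{P}(V_9^* )}(1)$, and interpret $\bigwedge^2V_9$ as alternating (skew-symmetric) maps $V_9^*\to V_9$; this is $\Phi$ (at a point $x$, $\Phi(x)$ is the contraction of $u$ by $x$). The scheme structure on $X$ is given by the $6\times6$ Pfaffians of $\Phi$. *)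

theory Defs
  imports
    "HOL-Analysis.Analysis"
    "HOL-Library.Poly_Mapping"
    "HOL-Algebra.Ideal"
    "HOL-Algebra.Algebraic_Closure_Type"
begin

section \<open>Multivariate polynomials\<close>

text \<open>A polynomial is a finitely supported map from monomials to coefficients; the product of
  \<^theory>\<open>HOL-Library.Poly_Mapping\<close> is the convolution product.\<close>

type_synonym ('v, 'a) mpoly = "('v \<Rightarrow>\<^sub>0 nat) \<Rightarrow>\<^sub>0 'a"

definition Const :: "'a::zero \<Rightarrow> ('v, 'a) mpoly" where
  "Const c = Poly_Mapping.single 0 c"

definition Var :: "'v \<Rightarrow> ('v, 'a::zero_neq_one) mpoly" where
  "Var v = Poly_Mapping.single (Poly_Mapping.single v 1) 1"

definition mpoly_eval :: "('v, 'a::comm_ring_1) mpoly \<Rightarrow> ('v \<Rightarrow> 'a) \<Rightarrow> 'a" where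
  "mpoly_eval f x = (\<Sum>m\<in>Poly_Mapping.keys f. Poly_Mapping.lookup f m *
     (\<Prod>v\<in>Poly_Mapping.keys m. x v ^ Poly_Mapping.lookup m v))"

definition mpoly_deriv :: "'v \<Rightarrow> ('v, 'a::comm_ring_1) mpoly \<Rightarrow> ('v, 'a) mpoly" where
  "mpoly_deriv v f = (\<Sum>m\<in>Poly_Mapping.keys f.
     Poly_Mapping.single (m - Poly_Mapping.single v 1)
       (of_nat (Poly_Mapping.lookup m v) * Poly_Mapping.lookup f m))"

abbreviation mpoly_ring :: "('v, 'a::comm_ring_1) mpoly ring" where
  "mpoly_ring \<equiv> ring_of_type_algebra"


section \<open>Linear algebra over the residue field of a prime\<close>

text \<open>Linear independence, over the residue field \<open>\<kappa>(P) = Frac(S/P)\<close> of a prime \<open>P\<close> of a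
  polynomial ring \<open>S\<close>, of the images of the vectors \<open>w j\<close> for \<open>j \<in> J\<close>. Denominators of a relation
  over \<open>\<kappa>(P)\<close> are cleared, so its coefficients can be taken in \<open>S\<close>, to be read modulo \<open>P\<close>.\<close>

definition indep_at ::
  "('v, 'a::comm_ring_1) mpoly set \<Rightarrow> 'j set \<Rightarrow> ('j \<Rightarrow> 'i \<Rightarrow> ('v, 'a) mpoly) \<Rightarrow> bool" where
  "indep_at P J w \<longleftrightarrow> (\<forall>c. (\<forall>i. (\<Sum>j\<in>J. c j * w j i) \<in> P) \<longrightarrow> (\<forall>j\<in>J. c j \<in> P))"

text \<open>Column rank over \<open>\<kappa>(P)\<close> of a matrix with entries \<open>A i j\<close> in \<open>S\<close>.\<close>

definition rank_at ::
  "('v, 'a::comm_ring_1) mpoly set \<Rightarrow> ('n::finite \<Rightarrow> 'n \<Rightarrow> ('v, 'a) mpoly) \<Rightarrow> nat" where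
  "rank_at P A = Max {card J | J. indep_at P J (\<lambda>j i. A i j)}"


section \<open>Smooth closed subschemes of affine and projective space\<close>

text \<open>For an ideal \<open>I\<close> of \<open>S = k[x\<^sub>v]\<close> and a point \<open>P\<close> of \<open>Spec (S/I)\<close> (a prime of \<open>S\<close> containing \<open>I\<close>):
  the \<open>k\<close>-scheme \<open>Spec (S/I)\<close> is smooth at \<open>P\<close> of relative dimension \<open>d\<close> if, in the local ring
  \<open>S\<^sub>P\<close>, the ideal \<open>I\<close> is generated by \<open>r = dim S - d\<close> elements whose differentials are linearly
  independent in \<open>\<Omega>\<^sub>S \<otimes> \<kappa>(P)\<close> (the definition of Bosch--Luetkebohmert--Raynaud, Neron Models, 2.2).
  As \<open>P\<close> contains \<open>I\<close>, multiplying the generators by units of \<open>S\<^sub>P\<close> preserves the independence,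
  so they are taken in \<open>I\<close>.\<close>

definition affine_smooth_at ::
  "('v::finite, 'a::field) mpoly set \<Rightarrow> nat \<Rightarrow> ('v, 'a) mpoly set \<Rightarrow> bool" where
  "affine_smooth_at I d P \<longleftrightarrow>
     (\<exists>(r::nat) g. r + d = CARD('v) \<and>
        (\<forall>j<r. g j \<in> I) \<and>
        (\<forall>f\<in>I. \<exists>h. h \<notin> P \<and> h * f \<in> Idl\<^bsub>mpoly_ring\<^esub> (g ` {..<r})) \<and>
        indep_at P {..<r} (\<lambda>j v. mpoly_deriv v (g j)))"

text \<open>The closed subscheme of the projective space with homogeneous coordinates \<open>x\<^sub>v\<close> (of dimension
  \<open>CARD('v) - 1\<close>) cut out by a set \<open>F\<close> of homogeneous polynomials is treated on its standard charts:
  \<open>D\<^sub>+(x\<^sub>i)\<close> is the affine hyperplane \<open>x\<^sub>i = 1\<close> in \<open>Spec k[x\<^sub>v]\<close>.\<close>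

definition chart_ideal :: "('v, 'a::comm_ring_1) mpoly set \<Rightarrow> 'v \<Rightarrow> ('v, 'a) mpoly set" where
  "chart_ideal F i = Idl\<^bsub>mpoly_ring\<^esub> (insert (Var i - 1) F)"

text \<open>The scheme points in the \<open>i\<close>-th chart; with \<open>F = {}\<close>, those of projective space itself.\<close>

definition chart_points :: "('v, 'a::comm_ring_1) mpoly set \<Rightarrow> 'v \<Rightarrow> ('v, 'a) mpoly set set" where
  "chart_points F i = {P. primeideal P mpoly_ring \<and> chart_ideal F i \<subseteq> P}"

text \<open>Smoothness of relative dimension \<open>d\<close> at every point would hold vacuously for the empty scheme,
  which does not have dimension \<open>d\<close>.\<close>

definition proj_smooth_of_dim :: "('v::finite, 'a::field) mpoly set \<Rightarrow> nat \<Rightarrow> bool" where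
  "proj_smooth_of_dim F d \<longleftrightarrow>
     (\<exists>i. chart_points F i \<noteq> {}) \<and>
     (\<forall>i. \<forall>P\<in>chart_points F i. affine_smooth_at (chart_ideal F i) d P)"


section \<open>Trivectors and stability\<close>

text \<open>For \<open>V\<close> with basis \<open>e\<^sub>a\<close>, the third exterior power of \<open>V\<close> is identified by iterated
  comultiplication with the alternating tensors in the third tensor power (in any characteristic):
  \<open>u\<close> is the sum of \<open>u(a,b,c) e\<^sub>a \<and> e\<^sub>b \<and> e\<^sub>c\<close> over the three-element subsets \<open>{a,b,c}\<close>.\<close>

definition trivectors :: "('n \<times> 'n \<times> 'n \<Rightarrow> 'a::comm_ring_1) set" where
  "trivectors = {u. \<forall>a b c.
     u (a, a, c) = 0 \<and> u (a, b, b) = 0 \<and> u (a, b, a) = 0 \<and>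
     u (b, a, c) = - u (a, b, c) \<and> u (a, c, b) = - u (a, b, c)}"

definition SL :: "('a::comm_ring_1 ^ 'n ^ 'n) set" where
  "SL = {g. det g = 1}"

definition act :: "'a::comm_ring_1 ^ 'n ^ 'n \<Rightarrow> ('n \<times> 'n \<times> 'n \<Rightarrow> 'a) \<Rightarrow> ('n \<times> 'n \<times> 'n \<Rightarrow> 'a)" where
  "act g u = (\<lambda>(a, b, c). \<Sum>(d, e, f)\<in>UNIV. g $ a $ d * g $ b $ e * g $ c $ f * u (d, e, f))"

definition mu3_rel :: "('a::comm_ring_1 ^ 'n ^ 'n) rel" where
  "mu3_rel = {(g, h). g \<in> SL \<and> h \<in> SL \<and> (\<exists>z. z ^ 3 = 1 \<and> h = mat z ** g)}"

text \<open>Over an algebraically closed field \<open>K\<close> the group of \<open>K\<close>-points of \<open>SL/\<mu>\<^sub>3\<close> is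
  \<open>SL(K)/\<mu>\<^sub>3(K)\<close>, and a group scheme of finite type is finite iff it has finitely many
  \<open>K\<close>-points.\<close>

definition stabilizer :: "('n \<times> 'n \<times> 'n \<Rightarrow> 'a::comm_ring_1) \<Rightarrow> ('a ^ 'n ^ 'n) set set" where
  "stabilizer u = {C \<in> SL // mu3_rel. \<forall>g\<in>C. act g u = u}"

definition zariski_closed_in :: "('v \<Rightarrow> 'a::comm_ring_1) set \<Rightarrow> ('v \<Rightarrow> 'a) set \<Rightarrow> bool" where
  "zariski_closed_in S Z \<longleftrightarrow> (\<exists>F. Z = {z \<in> S. \<forall>f\<in>F. mpoly_eval f z = 0})"

definition stable_trivector :: "('n::finite \<times> 'n \<times> 'n \<Rightarrow> 'k::field) \<Rightarrow> bool" where
  "stable_trivector u \<longleftrightarrow> (let uK = to_ac \<circ> u in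
     finite (stabilizer uK) \<and> zariski_closed_in trivectors ((\<lambda>g. act g uK) ` SL))"


section \<open>The family of alternating matrices and its degeneracy loci\<close>

text \<open>The contraction of \<open>u\<close> by the point with coordinates \<open>x\<^sub>c\<close>: a matrix of linear forms on the
  dual of \<open>V\<close>. On the chart \<open>x\<^sub>i = 1\<close> the bundle \<open>O(1)\<close> is trivialised by \<open>x\<^sub>i\<close>, and this is the
  matrix of the map of bundles there.\<close>

definition Phi :: "('n::finite \<times> 'n \<times> 'n \<Rightarrow> 'k::field) \<Rightarrow> 'n \<Rightarrow> 'n \<Rightarrow> ('n, 'k) mpoly" where
  "Phi u a b = (\<Sum>c\<in>UNIV. Const (u (a, b, c)) * Var c)"

text \<open>The Pfaffian of the principal submatrix of an alternating matrix on a list of distinct indices,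
  by expansion along the first row. Permuting the list only changes the sign.\<close>

fun pfaffian :: "('n \<Rightarrow> 'n \<Rightarrow> 'r::comm_ring_1) \<Rightarrow> 'n list \<Rightarrow> 'r" where
  "pfaffian A [] = 1"
| "pfaffian A (a # as) =
     (\<Sum>j<length as. (-1) ^ j * A a (as ! j) * pfaffian A (take j as @ drop (Suc j) as))"

text \<open>Homogeneous equations of the scheme \<open>X\<close>: the locus where \<open>Phi u\<close> has rank at most 4, with the
  scheme structure given by the 6 by 6 Pfaffians.\<close>

definition X_equations :: "('n::finite \<times> 'n \<times> 'n \<Rightarrow> 'k::field) \<Rightarrow> ('n, 'k) mpoly set" where
  "X_equations u = {pfaffian (Phi u) as | as. distinct as \<and> length as = 6}"

text \<open>The points of projective space, in the \<open>i\<close>-th chart, where the rank of \<open>Phi u\<close> is at most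
  \<open>r\<close>.\<close>

definition rank_locus :: "('n::finite \<times> 'n \<times> 'n \<Rightarrow> 'k::field) \<Rightarrow> nat \<Rightarrow> 'n \<Rightarrow> ('n, 'k) mpoly set set"
  where "rank_locus u r i = {P \<in> chart_points {} i. rank_at P (Phi u) \<le> r}"

end

theory Submission
  imports Defs
begin

text \<open>Call a choice of basis and of integer weights with sum zero destabilizing for \<open>u\<close> if all nonzero
  coefficients of \<open>u\<close> have nonnegative weight. For stable \<open>u\<close> only the zero weights are: the limit of the
  one-parameter subgroup lies in the closed orbit and has an infinite stabilizer. Conversely, the
  following configurations at a geometric point \<open>x\<close>, with \<open>N = ker \<Phi>(x)\<close>, are destabilizing.
  If \<open>rank \<Phi>(x) \<le> 2\<close>, take weights \<open>-2, 0, 1\<close> on the flag \<open>x \<in> N\<close>. If \<open>rank \<Phi>(x) = 4\<close>, the tangent space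
  of \<open>X\<close> has dimension two exactly when contraction with \<open>u\<close> is injective on the second exterior power of
  \<open>N/x\<close>; an element of its kernel of rank four gives weights \<open>-4, -1, 2\<close> on \<open>x \<in> N\<close>, one of rank two
  gives a three-dimensional space on which \<open>u\<close> vanishes to second order, with weights \<open>-2, 1\<close>.
  A scheme point with one of these defects specializes to a geometric one by the Nullstellensatz.

  Finally \<open>X\<close> is nonempty for every trivector. The trivectors with nonempty \<open>X\<close> form a closed set (elimination
  theory), and they are dense: at a suitable \<open>u0\<close> with an explicit transversal point of \<open>X\<close>, there is
  a curve of such trivectors through \<open>u0\<close> with any prescribed tangent direction.\<close>

section \<open>Evaluation and differentiation of polynomials\<close>

text \<open>The numbers come from a codimension count. Since \<open>x\<close> lies in the kernel of
  \<Phi>(x), the form descends to a space of dimension eight, where rank at most 4 imposes six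
  conditions, and 8 - 6 = 2. In the nine coordinates of a chart this reads 9 - 7, the seventh
  equation being x_i = 1. Near a point with nonzero pivot Pfaffian on indices b1, ..., b4, the six
  Pfaffians that add two of the four remaining indices generate the ideal, and up to the pivot their
  differentials are the contractions of \<open>u\<close> with the six bivectors of the kernel modulo
  \<open>x\<close>. Smoothness is thereby reduced to linear algebra at a geometric point. Smoothness
  says nothing about an empty scheme, so nonemptiness is a separate half. The obstacle there is that
  the curves through \<open>u0\<close> must consist of degenerate trivectors exactly, not only to
  first order: a first-order correction is followed by an honest change of frame. All
  characteristics are treated together: alternation is kept apart from antisymmetry, and the
  infinite stabilizer is found by counting points, without tangent spaces.\<close>

lemma mpoly_induct [case_names single add]:
  fixes f :: "'m \<Rightarrow>\<^sub>0 'a::comm_monoid_add"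
  assumes single: "\<And>m c. P (Poly_Mapping.single m c)"
    and add: "\<And>f g. P f \<Longrightarrow> P g \<Longrightarrow> P (f + g)"
  shows "P f"
proof -
  have sum: "P (\<Sum>m\<in>A. Poly_Mapping.single m (c m))" if "finite A" for A c
    using that
  proof induction
    case empty
    show ?case using single[of undefined 0] by simp
  next
    case (insert m A)
    then show ?case by (simp add: single add)
  qed
  have "f = (\<Sum>m\<in>Poly_Mapping.keys f. Poly_Mapping.single m (Poly_Mapping.lookup f m))"
    by (rule poly_mapping_eqI)
       (simp add: lookup_sum lookup_single when_def in_keys_iff)
  then show ?thesis using sum[OF finite_keys] by metis
qed

definition monom_ev :: "('v \<Rightarrow> 'a::comm_ring_1) \<Rightarrow> ('v \<Rightarrow>\<^sub>0 nat) \<Rightarrow> 'a" where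
  "monom_ev x m = (\<Prod>v\<in>Poly_Mapping.keys m. x v ^ Poly_Mapping.lookup m v)"

lemma monom_ev_superset:
  assumes "finite A" "Poly_Mapping.keys m \<subseteq> A"
  shows "monom_ev x m = (\<Prod>v\<in>A. x v ^ Poly_Mapping.lookup m v)"
  unfolding monom_ev_def
  by (rule prod.mono_neutral_left) (use assms in \<open>auto simp: in_keys_iff\<close>)

lemma monom_ev_0 [simp]: "monom_ev x 0 = 1"
  by (simp add: monom_ev_def)

lemma monom_ev_add: "monom_ev x (m + n) = monom_ev x m * monom_ev x n"
proof -
  let ?A = "Poly_Mapping.keys m \<union> Poly_Mapping.keys n"
  have "monom_ev x (m + n) = (\<Prod>v\<in>?A. x v ^ Poly_Mapping.lookup (m + n) v)"
    by (rule monom_ev_superset) (auto simp: keys_add)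
  also have "\<dots> = monom_ev x m * monom_ev x n"
    by (simp add: monom_ev_superset[of ?A] lookup_add power_add prod.distrib)
  finally show ?thesis .
qed

lemma monom_ev_single [simp]: "monom_ev x (Poly_Mapping.single v n) = x v ^ n"
  by (simp add: monom_ev_def)

lemma monom_ev_cong:
  "(\<And>v. v \<in> Poly_Mapping.keys m \<Longrightarrow> x v = y v) \<Longrightarrow> monom_ev x m = monom_ev y m"
  by (simp add: monom_ev_def)

lemma monom_ev_scale:
  "monom_ev (\<lambda>v. c * x v) m = c ^ sum (Poly_Mapping.lookup m) (Poly_Mapping.keys m) * monom_ev x m"
  by (simp add: monom_ev_def power_mult_distrib prod.distrib power_sum)

text \<open>Coefficients are pushed along \<phi> so that one set of lemmas covers
  \<open>mpoly_eval\<close>, geometric points (\<open>to_ac\<close>) and evaluation along a curve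
  with values in univariate polynomials. The resulting map is again a \<open>coeff_hom\<close>,
  which transports Pfaffians.\<close>

definition ev :: "('k::comm_ring_1 \<Rightarrow> 'l::comm_ring_1) \<Rightarrow> ('v \<Rightarrow> 'l) \<Rightarrow> ('v, 'k) mpoly \<Rightarrow> 'l" where
  "ev \<phi> x f = (\<Sum>m\<in>Poly_Mapping.keys f. \<phi> (Poly_Mapping.lookup f m) * monom_ev x m)"

lemma mpoly_eval_ev: "mpoly_eval f x = ev (\<lambda>c. c) x f"
  by (simp add: mpoly_eval_def ev_def monom_ev_def)

locale coeff_hom =
  fixes \<phi> :: "'k::comm_ring_1 \<Rightarrow> 'l::comm_ring_1"
  assumes hom_0 [simp]: "\<phi> 0 = 0"
    and hom_1 [simp]: "\<phi> 1 = 1"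
    and hom_add: "\<phi> (a + b) = \<phi> a + \<phi> b"
    and hom_mult: "\<phi> (a * b) = \<phi> a * \<phi> b"
begin

lemma hom_uminus: "\<phi> (- a) = - \<phi> a"
  using hom_add[of a "- a"] by (simp add: eq_neg_iff_add_eq_0 add.commute)

lemma hom_diff: "\<phi> (a - b) = \<phi> a - \<phi> b"
  using hom_add[of a "- b"] by (simp add: hom_uminus)

lemma hom_sum: "\<phi> (\<Sum>i\<in>A. f i) = (\<Sum>i\<in>A. \<phi> (f i))"
  by (induction A rule: infinite_finite_induct) (simp_all add: hom_add)

lemma hom_power: "\<phi> (a ^ n) = \<phi> a ^ n"
  by (induction n) (simp_all add: hom_mult)

lemma ev_superset:
  assumes "finite A" "Poly_Mapping.keys f \<subseteq> A"
  shows "ev \<phi> x f = (\<Sum>m\<in>A. \<phi> (Poly_Mapping.lookup f m) * monom_ev x m)"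
  unfolding ev_def
  by (rule sum.mono_neutral_left) (use assms in \<open>auto simp: in_keys_iff\<close>)

lemma ev_single [simp]: "ev \<phi> x (Poly_Mapping.single m c) = \<phi> c * monom_ev x m"
  by (simp add: ev_def)

lemma ev_add [simp]: "ev \<phi> x (f + g) = ev \<phi> x f + ev \<phi> x g"
proof -
  let ?A = "Poly_Mapping.keys f \<union> Poly_Mapping.keys g"
  have "ev \<phi> x (f + g) = (\<Sum>m\<in>?A. \<phi> (Poly_Mapping.lookup (f + g) m) * monom_ev x m)"
    by (rule ev_superset) (auto simp: keys_add)
  also have "\<dots> = ev \<phi> x f + ev \<phi> x g"
    by (simp add: ev_superset[of ?A] lookup_add hom_add algebra_simps sum.distrib)
  finally show ?thesis .
qed

lemma ev_mult [simp]: "ev \<phi> x (f * g) = ev \<phi> x f * ev \<phi> x g"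
proof (induction f rule: mpoly_induct)
  case (single m c)
  show ?case
    by (induction g rule: mpoly_induct)
       (simp_all add: mult_single hom_mult monom_ev_add algebra_simps)
qed (simp_all add: algebra_simps)

lemma ev_0 [simp]: "ev \<phi> x 0 = 0"
  by (simp add: ev_def)

lemma ev_1 [simp]: "ev \<phi> x 1 = 1"
  using ev_single[of x 0 1] by simp

lemma ev_Const [simp]: "ev \<phi> x (Const c) = \<phi> c"
  by (simp add: Const_def)

lemma ev_Var [simp]: "ev \<phi> x (Var v) = x v"
  by (simp add: Var_def)

lemma coeff_hom_ev: "coeff_hom (ev \<phi> x)"
  by unfold_locales simp_all

lemmas ev_uminus [simp] = coeff_hom.hom_uminus[OF coeff_hom_ev]
  and ev_diff [simp] = coeff_hom.hom_diff[OF coeff_hom_ev]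
  and ev_sum = coeff_hom.hom_sum[OF coeff_hom_ev]
  and ev_power [simp] = coeff_hom.hom_power[OF coeff_hom_ev]

lemma ev_cong:
  assumes "\<And>m v. m \<in> Poly_Mapping.keys f \<Longrightarrow> v \<in> Poly_Mapping.keys m \<Longrightarrow> x v = y v"
  shows "ev \<phi> x f = ev \<phi> y f"
  unfolding ev_def by (intro sum.cong refl arg_cong2[where f = "(*)"] monom_ev_cong assms)

end

lemma coeff_hom_id: "coeff_hom (\<lambda>c. c)"
  by unfold_locales simp_all

lemma coeff_hom_to_ac: "coeff_hom to_ac"
  by unfold_locales simp_all

section \<open>Formal partial derivatives\<close>

lemma deriv_superset:
  assumes "finite A" "Poly_Mapping.keys f \<subseteq> A"
  shows "mpoly_deriv v f = (\<Sum>m\<in>A. Poly_Mapping.single (m - Poly_Mapping.single v 1)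
       (of_nat (Poly_Mapping.lookup m v) * Poly_Mapping.lookup f m))"
  unfolding mpoly_deriv_def
  by (rule sum.mono_neutral_left) (use assms in \<open>auto simp: in_keys_iff\<close>)

lemma deriv_single:
  "mpoly_deriv v (Poly_Mapping.single m c) =
     Poly_Mapping.single (m - Poly_Mapping.single v 1) (of_nat (Poly_Mapping.lookup m v) * c)"
  by (simp add: mpoly_deriv_def)

lemma deriv_add: "mpoly_deriv v (f + g) = mpoly_deriv v f + mpoly_deriv v g"
proof -
  let ?A = "Poly_Mapping.keys f \<union> Poly_Mapping.keys g"
  have "mpoly_deriv v (f + g) = (\<Sum>m\<in>?A. Poly_Mapping.single (m - Poly_Mapping.single v 1)
       (of_nat (Poly_Mapping.lookup m v) * Poly_Mapping.lookup (f + g) m))"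
    by (rule deriv_superset) (auto simp: keys_add)
  also have "\<dots> = mpoly_deriv v f + mpoly_deriv v g"
    by (simp add: deriv_superset[of ?A] lookup_add algebra_simps single_add sum.distrib)
  finally show ?thesis .
qed

lemma deriv_mult:
  "mpoly_deriv v (f * g) = mpoly_deriv v f * g + f * mpoly_deriv v g"
proof (induction f rule: mpoly_induct)
  case (single m c)
  show ?case
  proof (induction g rule: mpoly_induct)
    case (single n d)
    let ?v = "Poly_Mapping.single v (Suc 0)"
    \<comment> \<open>Subtraction of exponents is truncated, so both identities need a positive
      exponent; for exponent zero the coefficient \<open>of_nat 0\<close> removes the term.\<close>
    have 1: "m + n - ?v = n + (m - ?v)" if "Poly_Mapping.lookup m v > 0"
      by (rule poly_mapping_eqI) (use that in \<open>auto simp: lookup_add lookup_minus lookup_single when_def\<close>)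
    have 2: "m + n - ?v = m + (n - ?v)" if "Poly_Mapping.lookup n v > 0"
      by (rule poly_mapping_eqI) (use that in \<open>auto simp: lookup_add lookup_minus lookup_single when_def\<close>)
    show ?case
      by (cases "Poly_Mapping.lookup m v > 0"; cases "Poly_Mapping.lookup n v > 0")
         (simp_all add: mult_single deriv_single 1 2[symmetric] lookup_add algebra_simps
           flip: single_add)
  qed (simp_all add: deriv_add algebra_simps)
qed (simp_all add: deriv_add algebra_simps)

lemma deriv_0 [simp]: "mpoly_deriv v 0 = 0"
  by (simp add: mpoly_deriv_def)

lemma deriv_sum: "mpoly_deriv v (\<Sum>i\<in>A. f i) = (\<Sum>i\<in>A. mpoly_deriv v (f i))"
  by (induction A rule: infinite_finite_induct) (simp_all add: deriv_add)

lemma deriv_Const [simp]: "mpoly_deriv v (Const c) = 0"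
  by (simp add: Const_def deriv_single)

lemma deriv_1 [simp]: "mpoly_deriv v 1 = 0"
  using deriv_Const[of v 1] by (simp add: Const_def)

lemma deriv_Var: "mpoly_deriv v (Var w :: ('v, 'a::comm_ring_1) mpoly) = (if v = w then 1 else 0)"
  by (simp add: Var_def deriv_single lookup_single when_def)

lemma deriv_uminus: "mpoly_deriv v (- f) = - mpoly_deriv v f"
  using deriv_add[of v f "- f"] by (simp add: eq_neg_iff_add_eq_0 add.commute)

lemma deriv_diff: "mpoly_deriv v (f - g) = mpoly_deriv v f - mpoly_deriv v g"
  using deriv_add[of v f "- g"] by (simp add: deriv_uminus)

hide_const (open) up_ring.coeff up_ring.monom Module.module.smult Polynomials.lead_coeff Polynomials.degree

section \<open>A Nullstellensatz for prime ideals\<close>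

text \<open>\<open>primeideal\<close> for a ring whose carrier is the whole type, stated without the
  ring record; \<open>primeideal_prime_id\<close> and \<open>prime_id_primeideal\<close>
  translate.\<close>

definition prime_id :: "'a::comm_ring_1 set \<Rightarrow> bool" where
  "prime_id P \<longleftrightarrow> 0 \<in> P \<and> (\<forall>a\<in>P. \<forall>b\<in>P. a + b \<in> P) \<and> (\<forall>a. \<forall>b\<in>P. a * b \<in> P) \<and> 1 \<notin> P \<and>
     (\<forall>a b. a * b \<in> P \<longrightarrow> a \<in> P \<or> b \<in> P)"

context
  fixes P :: "'a::comm_ring_1 set"
  assumes P: "prime_id P"
begin

lemma prime_id_0: "0 \<in> P"
  and prime_id_add: "a \<in> P \<Longrightarrow> b \<in> P \<Longrightarrow> a + b \<in> P"
  and prime_id_multL: "b \<in> P \<Longrightarrow> a * b \<in> P"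
  and prime_id_multR: "b \<in> P \<Longrightarrow> b * a \<in> P"
  and prime_id_1: "1 \<notin> P"
  and prime_id_mult_iff: "a * b \<in> P \<longleftrightarrow> a \<in> P \<or> b \<in> P"
  using P unfolding prime_id_def by (blast, blast, blast, metis mult.commute, blast, metis mult.commute)

lemma prime_id_uminus: "a \<in> P \<Longrightarrow> - a \<in> P"
  using prime_id_multL[of a "-1"] by simp

lemma prime_id_uminus_iff: "- a \<in> P \<longleftrightarrow> a \<in> P"
  using prime_id_uminus[of a] prime_id_uminus[of "- a"] by auto

lemma prime_id_diff: "a \<in> P \<Longrightarrow> b \<in> P \<Longrightarrow> a - b \<in> P"
  using prime_id_add[of a "- b"] prime_id_uminus[of b] by simp

lemma prime_id_sum: "(\<And>i. i \<in> A \<Longrightarrow> f i \<in> P) \<Longrightarrow> sum f A \<in> P"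
  by (induction A rule: infinite_finite_induct) (auto intro: prime_id_0 prime_id_add)

lemma prime_id_power: "a \<notin> P \<Longrightarrow> a ^ n \<notin> P"
  by (induction n) (simp_all add: prime_id_1 prime_id_mult_iff)

lemma prime_id_poly: "(\<And>n. coeff F n \<in> P) \<Longrightarrow> poly F x \<in> P"
  by (simp add: poly_altdef prime_id_sum prime_id_multR)

end

lemma primeideal_prime_id:
  assumes "primeideal P (ring_of_type_algebra :: 'a::comm_ring_1 ring)"
  shows "prime_id P"
proof -
  interpret primeideal P "ring_of_type_algebra :: 'a ring" by fact
  have "1 \<notin> P"
    using I_notcarr one_imp_carrier by (auto simp: ring_of_type_algebra_def)
  then show ?thesis
    unfolding prime_id_def
    using I_l_closed I_prime
      additive_subgroup.zero_closed[OF is_additive_subgroup] additive_subgroup.a_closed[OF is_additive_subgroup]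
    by (auto simp: ring_of_type_algebra_def)
qed

section \<open>Polynomials in a subset of the variables, and division in one further
  variable\<close>

definition polys_in :: "'v set \<Rightarrow> ('v, 'a::comm_ring_1) mpoly set" where
  "polys_in A = {f. \<forall>m\<in>Poly_Mapping.keys f. Poly_Mapping.keys m \<subseteq> A}"

lemma polys_in_UNIV [simp]: "polys_in UNIV = UNIV"
  by (simp add: polys_in_def)

lemma polys_in_single: "Poly_Mapping.keys m \<subseteq> A \<Longrightarrow> Poly_Mapping.single m c \<in> polys_in A"
  by (auto simp: polys_in_def split: if_splits)

lemma polys_in_0 [simp]: "0 \<in> polys_in A"
  by (simp add: polys_in_def)

lemma polys_in_1 [simp]: "1 \<in> polys_in A"
  by (simp add: polys_in_def)

lemma polys_in_add: "f \<in> polys_in A \<Longrightarrow> g \<in> polys_in A \<Longrightarrow> f + g \<in> polys_in A"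
  unfolding polys_in_def using keys_add[of f g] by fastforce

lemma polys_in_uminus: "f \<in> polys_in A \<Longrightarrow> - f \<in> polys_in A"
  by (auto simp: polys_in_def in_keys_iff)

lemma polys_in_diff: "f \<in> polys_in A \<Longrightarrow> g \<in> polys_in A \<Longrightarrow> f - g \<in> polys_in A"
  using polys_in_add[of f A "- g"] polys_in_uminus[of g A] by simp

lemma polys_in_mult:
  assumes "f \<in> polys_in A" "g \<in> polys_in A"
  shows "f * g \<in> polys_in A"
  unfolding polys_in_def
proof (safe)
  fix m v assume m: "m \<in> Poly_Mapping.keys (f * g)" and v: "v \<in> Poly_Mapping.keys m"
  from m obtain a b where ab: "m = a + b" "a \<in> Poly_Mapping.keys f" "b \<in> Poly_Mapping.keys g"
    using keys_mult[of f g] by blast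
  then have "v \<in> Poly_Mapping.keys a \<union> Poly_Mapping.keys b"
    using v keys_add[of a b] by blast
  then show "v \<in> A" using assms ab by (auto simp: polys_in_def)
qed

lemma polys_in_power: "f \<in> polys_in A \<Longrightarrow> f ^ n \<in> polys_in A"
  by (induction n) (auto intro: polys_in_mult)

lemma polys_in_sum: "(\<And>i. i \<in> I \<Longrightarrow> f i \<in> polys_in A) \<Longrightarrow> sum f I \<in> polys_in A"
  by (induction I rule: infinite_finite_induct) (auto intro: polys_in_add)

lemma polys_in_Var: "v \<in> A \<Longrightarrow> Var v \<in> polys_in A"
  unfolding Var_def by (rule polys_in_single) auto

lemma polys_in_mono: "A \<subseteq> B \<Longrightarrow> polys_in A \<subseteq> polys_in B"
  by (auto simp: polys_in_def)

text \<open>Models k[A][v]: the coefficients keep the type of all polynomials, so that substituting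
  \<open>Var v\<close> stays within that type.\<close>

definition coeffs_in :: "'v set \<Rightarrow> ('v, 'a::comm_ring_1) mpoly poly \<Rightarrow> bool" where
  "coeffs_in A F \<longleftrightarrow> (\<forall>n. coeff F n \<in> polys_in A)"

lemma coeffs_in_intros:
  "coeffs_in A 0"
  "coeffs_in A F \<Longrightarrow> coeffs_in A G \<Longrightarrow> coeffs_in A (F + G)"
  "coeffs_in A F \<Longrightarrow> coeffs_in A G \<Longrightarrow> coeffs_in A (F - G)"
  "coeffs_in A F \<Longrightarrow> coeffs_in A G \<Longrightarrow> coeffs_in A (F * G)"
  "c \<in> polys_in A \<Longrightarrow> coeffs_in A F \<Longrightarrow> coeffs_in A (smult c F)"
  "c \<in> polys_in A \<Longrightarrow> coeffs_in A (monom c n)"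
  by (auto simp: coeffs_in_def coeff_mult coeff_monom
      intro!: polys_in_add polys_in_diff polys_in_mult polys_in_sum)

lemma coeffs_in_poly:
  assumes "coeffs_in A F"
  shows "poly F (Var v) \<in> polys_in (insert v A)"
  unfolding poly_altdef
  by (intro polys_in_sum polys_in_mult polys_in_power polys_in_Var)
     (use assms polys_in_mono[of A "insert v A"] in \<open>auto simp: coeffs_in_def\<close>)

lemma Var_power: "Var v ^ n = Poly_Mapping.single (Poly_Mapping.single v n) (1 :: 'a::comm_ring_1)"
  by (induction n) (simp_all add: Var_def mult_single flip: single_add)

lemma ex_coeffs_in:
  fixes f :: "('v, 'a::comm_ring_1) mpoly"
  assumes "f \<in> polys_in (insert v A)"
  obtains F where "coeffs_in A F" "f = poly F (Var v)"
proof
  let ?m = "\<lambda>m. m - Poly_Mapping.single v (Poly_Mapping.lookup m v)"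
  let ?F = "\<Sum>m\<in>Poly_Mapping.keys f.
     monom (Poly_Mapping.single (?m m) (Poly_Mapping.lookup f m)) (Poly_Mapping.lookup m v)"
  have in_A: "Poly_Mapping.single (?m m) (Poly_Mapping.lookup f m) \<in> polys_in A"
    if "m \<in> Poly_Mapping.keys f" for m
  proof (rule polys_in_single)
    have "Poly_Mapping.keys m \<subseteq> insert v A" using that assms by (auto simp: polys_in_def)
    then show "Poly_Mapping.keys (?m m) \<subseteq> A"
      by (auto simp: in_keys_iff lookup_minus lookup_single when_def subset_iff split: if_splits)
  qed
  show "coeffs_in A ?F"
    unfolding coeffs_in_def coeff_sum
    by (intro allI polys_in_sum) (use in_A in \<open>auto simp: coeff_monom\<close>)
  have m: "?m m + Poly_Mapping.single v (Poly_Mapping.lookup m v) = m" for m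
    by (rule poly_mapping_eqI) (simp add: lookup_add lookup_minus lookup_single when_def)
  have "f = (\<Sum>m\<in>Poly_Mapping.keys f. Poly_Mapping.single m (Poly_Mapping.lookup f m))"
    by (rule poly_mapping_eqI)
       (simp add: lookup_sum lookup_single when_def in_keys_iff)
  also have "\<dots> = poly ?F (Var v)"
    by (simp add: poly_sum poly_monom Var_power mult_single m)
  finally show "f = poly ?F (Var v)" .
qed

text \<open>Powers of the leading coefficient replace its inverse, so the coefficients stay in k[A].
  The bound on \<open>Q\<close> lets minimality of a relation be applied to the quotient in
  \<open>Nullstellensatz_step\<close>.\<close>

lemma pseudo_division:
  assumes F: "coeffs_in A F" "degree F > 0" and G: "coeffs_in A G"
  obtains n Q R where "coeffs_in A Q" "coeffs_in A R" "degree R < degree F"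
    "degree Q \<le> degree G - degree F" "smult (lead_coeff F ^ n) G = Q * F + R"
  using G
proof (induction "degree G" arbitrary: G thesis rule: less_induct)
  case less
  show thesis
  proof (cases "degree G < degree F")
    case True
    show thesis
      by (rule less.prems(1)[of 0 G 0]) (use True less.prems in \<open>auto intro: coeffs_in_intros\<close>)
  next
    case False
    let ?c = "lead_coeff F" and ?k = "degree G - degree F"
    let ?M = "monom (lead_coeff G) ?k"
    let ?G = "smult ?c G - ?M * F"
    have c: "?c \<in> polys_in A" and g: "lead_coeff G \<in> polys_in A"
      using F less.prems by (auto simp: coeffs_in_def)
    have "coeff ?G n = 0" if "n \<ge> degree G" for n
      using that False coeff_eq_0[of F "n - ?k"] coeff_eq_0[of G n]
      by (cases "n = degree G") (auto simp: coeff_monom_mult)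
    then have deg: "degree ?G < degree G"
      using False F(2) by (intro degree_lessI) auto
    have G': "coeffs_in A ?G"
      by (intro coeffs_in_intros c g F less.prems)
    obtain n Q R where QR: "coeffs_in A Q" "coeffs_in A R" "degree R < degree F"
      "degree Q \<le> degree ?G - degree F" "smult (?c ^ n) ?G = Q * F + R"
      using less.hyps[OF deg _ G'] by blast
    show thesis
    proof (rule less.prems(1))
      show "coeffs_in A (Q + smult (?c ^ n) ?M)"
        by (intro coeffs_in_intros QR g polys_in_power c)
      show "degree (Q + smult (?c ^ n) ?M) \<le> degree G - degree F"
        using QR(4) deg
        by (intro degree_add_le order.trans[OF degree_smult_le] degree_monom_le) auto
      show "smult (?c ^ Suc n) G = (Q + smult (?c ^ n) ?M) * F + R"
        using QR(5) by (simp add: algebra_simps smult_diff_right)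
    qed (use QR in auto)
  qed
qed

lemma degree_trim:
  assumes "degree F > 0"
  shows "degree (F - monom (lead_coeff F) (degree F)) < degree F"
  by (rule degree_lessI) (use assms coeff_eq_0[of F] in \<open>auto simp: coeff_monom\<close>)

context coeff_hom begin

lemma ev_upd:
  assumes "f \<in> polys_in A" "v \<notin> A"
  shows "ev \<phi> (x(v := t)) f = ev \<phi> x f"
  by (rule ev_cong) (use assms in \<open>auto simp: polys_in_def\<close>)

lemma ev_poly:
  assumes "coeffs_in A F" "v \<notin> A"
  shows "ev \<phi> (x(v := t)) (poly F (Var v)) = poly (map_poly (ev \<phi> x) F) t"
proof -
  have "ev \<phi> (x(v := t)) (poly F (Var v)) = (\<Sum>i\<le>degree F. ev \<phi> x (coeff F i) * t ^ i)"
    using assms by (simp add: poly_altdef ev_sum coeffs_in_def ev_upd[of _ A])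
  also have "\<dots> = (\<Sum>i\<le>degree F. coeff (map_poly (ev \<phi> x) F) i * t ^ i)"
    by (simp add: coeff_map_poly)
  also have "\<dots> = poly (map_poly (ev \<phi> x) F) t"
    unfolding poly_altdef
    by (rule sum.mono_neutral_right)
       (auto simp: coeff_eq_0 intro: order.trans[OF _ map_poly_degree_leq])
  finally show ?thesis .
qed

end

text \<open>Over a finite field, the product of all \<open>X - a\<close> plus one would have
  positive degree and no root.\<close>

lemma alg_closed_infinite: "infinite (UNIV :: 'a::alg_closed_field set)"
proof
  assume fin: "finite (UNIV :: 'a set)"
  let ?q = "\<Prod>a\<in>(UNIV :: 'a set). [:- a, 1:]"
  have "degree ?q = (\<Sum>a\<in>(UNIV :: 'a set). degree [:- a, 1:])"
    by (rule degree_prod_eq_sum_degree) auto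
  then have deg: "degree ?q > 0" using fin by (simp add: card_gt_0_iff)
  then have "degree (?q + 1) > 0" by (simp add: degree_add_eq_left)
  then obtain x where "poly (?q + 1) x = 0" using alg_closed_imp_poly_has_root by blast
  moreover have "poly ?q x = 0" using fin by (simp add: poly_prod)
  ultimately show False by simp
qed

lemma poly_eq_0_cofinite:
  fixes p :: "'a::alg_closed_field poly"
  assumes "finite S" "\<And>t. t \<notin> S \<Longrightarrow> poly p t = 0"
  shows "p = 0"
proof (rule ccontr)
  assume "p \<noteq> 0"
  then have "finite ({t. poly p t = 0} \<union> S)" using poly_roots_finite assms(1) by blast
  moreover have "{t. poly p t = 0} \<union> S = UNIV" using assms(2) by blast
  ultimately show False using alg_closed_infinite[where 'a = 'a] by simp
qed

lemma alg_closed_exists_non_root: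
  fixes p :: "'a::alg_closed_field poly"
  assumes "p \<noteq> 0"
  shows "\<exists>t. poly p t \<noteq> 0"
  using assms poly_eq_0_cofinite[of "{}" p] by auto

text \<open>Either \<open>v\<close> is transcendental modulo \<open>P\<close> and almost every value extends the point, or a relation of minimal
  degree modulo \<open>P\<close> plays the role of the minimal polynomial: each of its roots extends the point, provided that
  \<open>a\<close> is a multiple of its leading coefficient, and \<open>b\<close> survives if \<open>a\<close> also lies in the ideal generated by \<open>P\<close> and \<open>b\<close>.\<close>

lemma Nullstellensatz_step:
  fixes P :: "('v, 'k::field) mpoly set" and \<phi> :: "'k \<Rightarrow> 'l::alg_closed_field"
  assumes \<phi>: "coeff_hom \<phi>" and P: "prime_id P" and v: "v \<notin> A"
    and b: "b \<in> polys_in (insert v A)" "b \<notin> P"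
  obtains a where "a \<in> polys_in A" "a \<notin> P"
    "\<And>x. (\<And>f. f \<in> P \<Longrightarrow> f \<in> polys_in A \<Longrightarrow> ev \<phi> x f = 0) \<Longrightarrow> ev \<phi> x a \<noteq> 0 \<Longrightarrow>
       \<exists>t. (\<forall>f\<in>P \<inter> polys_in (insert v A). ev \<phi> (x(v := t)) f = 0) \<and> ev \<phi> (x(v := t)) b \<noteq> 0"
proof -
  interpret coeff_hom \<phi> by fact
  let ?X = "Var v :: ('v, 'k) mpoly"
  let ?B = "polys_in (insert v A) :: ('v, 'k) mpoly set"
  have A_B: "polys_in A \<subseteq> ?B" by (rule polys_in_mono) auto
  obtain B where B: "coeffs_in A B" "b = poly B ?X"
    using ex_coeffs_in[OF b(1)] by blast
  \<comment> \<open>Algebraic relations of \<open>v\<close> over k[A] modulo \<open>P\<close> that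
    are not trivial modulo \<open>P\<close>; if there are none, \<open>v\<close> is
    transcendental.\<close>
  define rel where "rel = {F. coeffs_in A F \<and> poly F ?X \<in> P \<and> (\<exists>n. coeff F n \<notin> P)}"
  have kill: "poly (map_poly (ev \<phi> x) F) t = 0"
    if F: "coeffs_in A F" "\<And>n. coeff F n \<in> P"
      and x: "\<And>f. f \<in> P \<Longrightarrow> f \<in> polys_in A \<Longrightarrow> ev \<phi> x f = 0" for F x t
  proof -
    have "map_poly (ev \<phi> x) F = 0"
      by (rule poly_eqI) (use F x in \<open>simp add: coeff_map_poly coeffs_in_def\<close>)
    then show ?thesis by simp
  qed
  show thesis
  proof (cases "rel = {}")
    case True
    from b(2) obtain n where n: "coeff B n \<notin> P"
      using prime_id_poly[OF P, of B ?X] B(2) by blast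
    show thesis
    proof (rule that[of "coeff B n"])
      show "coeff B n \<in> polys_in A" using B(1) by (simp add: coeffs_in_def)
      fix x assume x: "\<And>f. f \<in> P \<Longrightarrow> f \<in> polys_in A \<Longrightarrow> ev \<phi> x f = 0"
        and ne: "ev \<phi> x (coeff B n) \<noteq> 0"
      have "coeff (map_poly (ev \<phi> x) B) n \<noteq> 0" using ne by (simp add: coeff_map_poly)
      then have "map_poly (ev \<phi> x) B \<noteq> 0" by auto
      then obtain t where "poly (map_poly (ev \<phi> x) B) t \<noteq> 0"
        using alg_closed_exists_non_root by blast
      then have "ev \<phi> (x(v := t)) b \<noteq> 0" using B v by (simp add: ev_poly[of A])
      moreover have "ev \<phi> (x(v := t)) f = 0" if f: "f \<in> P" "f \<in> ?B" for f
      proof -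
        obtain F where F: "coeffs_in A F" "f = poly F ?X" using ex_coeffs_in[OF f(2)] by blast
        then have "coeff F n \<in> P" for n using True f(1) by (auto simp: rel_def)
        then show ?thesis using F v kill[OF F(1) _ x] by (simp add: ev_poly[of A])
      qed
      ultimately show "\<exists>t. (\<forall>f\<in>P \<inter> ?B. ev \<phi> (x(v := t)) f = 0) \<and> ev \<phi> (x(v := t)) b \<noteq> 0"
        by blast
    qed (fact n)
  next
    case False
    then obtain F where F: "F \<in> rel" and F_min: "\<And>G. G \<in> rel \<Longrightarrow> degree F \<le> degree G"
      using ex_has_least_nat[of "\<lambda>F. F \<in> rel" _ degree] by auto
    have F_in: "coeffs_in A F" "poly F ?X \<in> P" using F by (auto simp: rel_def)
    define c where "c = lead_coeff F"
    have c_A: "c \<in> polys_in A" using F_in by (simp add: c_def coeffs_in_def)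
    have low: "coeff G n \<in> P" if "coeffs_in A G" "poly G ?X \<in> P" "degree G < degree F" for G n
      using F_min[of G] that by (force simp: rel_def)
    have c_P: "c \<notin> P"
    proof
      assume cP: "c \<in> P"
      show False
      proof (cases "degree F = 0")
        case True
        then have "coeff F n \<in> P" for n
          using cP coeff_eq_0[of F n] prime_id_0[OF P] by (cases n) (auto simp: c_def)
        then show False using F by (simp add: rel_def)
      next
        case False
        let ?G = "F - monom c (degree F)"
        have "coeffs_in A ?G" by (intro coeffs_in_intros F_in c_A)
        moreover have "poly ?G ?X \<in> P"
          using F_in cP by (simp add: poly_monom prime_id_diff[OF P] prime_id_multR[OF P])
        moreover have "degree ?G < degree F"
          using degree_trim[of F] False by (simp add: c_def)
        ultimately have G: "coeff ?G n \<in> P" for n by (rule low)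
        have "coeff F n \<in> P" for n
          using prime_id_add[OF P G[of n], of "coeff (monom c (degree F)) n"] cP prime_id_0[OF P]
          by (auto simp: coeff_monom split: if_splits)
        then show False using F by (simp add: rel_def)
      qed
    qed
    have deg_F: "degree F > 0"
    proof (rule ccontr)
      assume "\<not> degree F > 0"
      then obtain a where "F = [:a:]" using degree_eq_zeroE by blast
      then show False using F_in c_P by (simp add: c_def)
    qed
    \<comment> \<open>Polynomials outside \<open>P\<close> lying in the ideal generated by
      \<open>P\<close> and \<open>b\<close>. A member of minimal degree turns out to be a constant
      \<open>g\<close>: this is the inversion of \<open>b\<close> modulo the minimal relation,
      without denominators.\<close>
    define T where "T = {G. coeffs_in A G \<and> poly G ?X \<notin> P \<and> (\<exists>q\<in>?B. poly G ?X - q * b \<in> P)}"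
    have "B \<in> T" unfolding T_def using B b prime_id_0[OF P] by (auto intro!: bexI[of _ 1])
    then obtain G where G: "G \<in> T" and G_min: "\<And>H. H \<in> T \<Longrightarrow> degree G \<le> degree H"
      using ex_has_least_nat[of "\<lambda>G. G \<in> T" _ degree] by blast
    obtain q where q: "q \<in> ?B" "poly G ?X - q * b \<in> P" and G_in: "coeffs_in A G" "poly G ?X \<notin> P"
      using G by (auto simp: T_def)
    define g where "g = lead_coeff G"
    have g_A: "g \<in> polys_in A" using G_in by (simp add: g_def coeffs_in_def)
    have g_P: "g \<notin> P"
    proof
      assume gP: "g \<in> P"
      show False
      proof (cases "degree G = 0")
        case True
        then obtain a where "G = [:a:]" using degree_eq_zeroE by blast
        then show False using G_in gP by (simp add: g_def)
      next
        case False
        let ?G = "G - monom g (degree G)"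
        have mP: "g * ?X ^ degree G \<in> P" by (simp add: gP prime_id_multR[OF P])
        have "coeffs_in A ?G" by (intro coeffs_in_intros G_in g_A)
        moreover have "poly ?G ?X \<notin> P"
        proof
          assume "poly ?G ?X \<in> P"
          from prime_id_add[OF P this mP] show False using G_in by (simp add: poly_monom)
        qed
        moreover have "poly ?G ?X - q * b \<in> P"
          using prime_id_diff[OF P q(2) mP] by (simp add: poly_monom algebra_simps)
        ultimately have "?G \<in> T" using q by (auto simp: T_def)
        from G_min[OF this] show False using degree_trim[of G] False by (simp add: g_def)
      qed
    qed
    have deg_G: "degree G = 0"
    proof (rule ccontr)
      assume "degree G \<noteq> 0"
      then have G_pos: "degree G > 0" by simp
      obtain n Q R where QR: "coeffs_in A Q" "coeffs_in A R" "degree R < degree F"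
          "smult (c ^ n) G = Q * F + R"
        using pseudo_division[OF F_in(1) deg_F G_in(1)] unfolding c_def by metis
      have eq: "poly R ?X = c ^ n * poly G ?X - poly Q ?X * poly F ?X"
        using arg_cong[OF QR(4), of "\<lambda>p. poly p ?X"] by simp
      have "R \<in> T"
      proof -
        have "poly R ?X \<notin> P"
        proof
          assume "poly R ?X \<in> P"
          from prime_id_add[OF P this prime_id_multL[OF P F_in(2), of "poly Q ?X"]]
          have "c ^ n * poly G ?X \<in> P" by (simp add: eq)
          then show False using prime_id_power[OF P c_P] G_in prime_id_mult_iff[OF P] by blast
        qed
        moreover have "poly R ?X - (c ^ n * q) * b \<in> P"
          using prime_id_diff[OF P prime_id_multL[OF P q(2), of "c ^ n"] prime_id_multL[OF P F_in(2), of "poly Q ?X"]]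
          by (simp add: eq algebra_simps)
        moreover have "c ^ n * q \<in> ?B"
          using polys_in_mult[OF _ q(1)] polys_in_power[OF c_A] A_B by blast
        ultimately show ?thesis using QR by (auto simp: T_def)
      qed
      then have deg_lt: "degree G < degree F" using G_min QR(3) by fastforce
      \<comment> \<open>Dividing \<open>F\<close> by \<open>G\<close>, the remainder lies in
        \<open>P\<close> by minimality of \<open>G\<close>, hence so does \<open>Q\<close>. Both
        have degree below that of \<open>F\<close>, so their coefficients are in \<open>P\<close>,
        and with them the leading coefficient of a multiple of \<open>F\<close> by a power of
        \<open>g\<close>: a contradiction.\<close>
      obtain n Q R where QR: "coeffs_in A Q" "coeffs_in A R" "degree R < degree G"
          "degree Q \<le> degree F - degree G" "smult (g ^ n) F = Q * G + R"
        using pseudo_division[OF G_in(1) G_pos F_in(1)] unfolding g_def by metis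
      have eq: "poly R ?X = g ^ n * poly F ?X - poly Q ?X * poly G ?X"
        using arg_cong[OF QR(5), of "\<lambda>p. poly p ?X"] by simp
      have R_P: "poly R ?X \<in> P"
      proof (rule ccontr)
        assume "poly R ?X \<notin> P"
        moreover have "poly R ?X - (- poly Q ?X * q) * b \<in> P"
          using prime_id_diff[OF P prime_id_multL[OF P F_in(2), of "g ^ n"] prime_id_multL[OF P q(2), of "poly Q ?X"]]
          by (simp add: eq algebra_simps)
        moreover have "- poly Q ?X * q \<in> ?B"
          by (intro polys_in_mult polys_in_uminus coeffs_in_poly QR q)
        ultimately have "R \<in> T" unfolding T_def mem_Collect_eq using QR by blast
        from G_min[OF this] QR(3) show False by simp
      qed
      have "g ^ n * poly F ?X - poly R ?X = poly Q ?X * poly G ?X" by (simp add: eq)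
      with prime_id_diff[OF P prime_id_multL[OF P F_in(2), of "g ^ n"] R_P]
      have "poly Q ?X \<in> P" using G_in(2) by (simp add: prime_id_mult_iff[OF P])
      then have Q_P: "coeff Q i \<in> P" for i
        using QR(4) G_pos deg_lt by (intro low QR) auto
      have R_P': "coeff R i \<in> P" for i
        using QR(3) deg_lt by (intro low QR R_P) auto
      have "coeff (smult (g ^ n) F) (degree F) \<in> P"
        unfolding QR(5) coeff_add coeff_mult
        by (intro prime_id_add[OF P] prime_id_sum[OF P] prime_id_multR[OF P] Q_P R_P')
      then show False
        using g_P c_P prime_id_power[OF P g_P, of n] by (simp add: c_def prime_id_mult_iff[OF P])
    qed
    then have G_const: "poly G ?X = g" by (metis degree_eq_zeroE g_def lead_coeff_pCons(2) poly_const_conv)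
    show thesis
    proof (rule that[of "c * g"])
      show "c * g \<in> polys_in A" by (intro polys_in_mult c_A g_A)
      show "c * g \<notin> P" using c_P g_P by (simp add: prime_id_mult_iff[OF P])
      fix x assume x: "\<And>f. f \<in> P \<Longrightarrow> f \<in> polys_in A \<Longrightarrow> ev \<phi> x f = 0"
        and "ev \<phi> x (c * g) \<noteq> 0"
      then have c_ne: "ev \<phi> x c \<noteq> 0" and g_ne: "ev \<phi> x g \<noteq> 0" by auto
      have "degree (map_poly (ev \<phi> x) F) > 0"
        using c_ne deg_F le_degree[of "map_poly (ev \<phi> x) F" "degree F"]
        by (simp add: coeff_map_poly c_def)
      then obtain t where t: "poly (map_poly (ev \<phi> x) F) t = 0"
        using alg_closed_imp_poly_has_root by blast
      have P_0: "ev \<phi> (x(v := t)) f = 0" if f: "f \<in> P" "f \<in> ?B" for f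
      proof -
        obtain H where H: "coeffs_in A H" "f = poly H ?X" using ex_coeffs_in[OF f(2)] by blast
        obtain n Q R where QR: "coeffs_in A Q" "coeffs_in A R" "degree R < degree F"
            "smult (c ^ n) H = Q * F + R"
          using pseudo_division[OF F_in(1) deg_F H(1)] unfolding c_def by metis
        have eq: "c ^ n * f = poly Q ?X * poly F ?X + poly R ?X"
          using arg_cong[OF QR(4), of "\<lambda>p. poly p ?X"] H by simp
        have "poly R ?X \<in> P"
          using prime_id_diff[OF P prime_id_multL[OF P f(1), of "c ^ n"]
              prime_id_multL[OF P F_in(2), of "poly Q ?X"]] by (simp add: eq)
        then have R_P: "coeff R i \<in> P" for i using QR by (intro low) auto
        have "ev \<phi> (x(v := t)) (c ^ n * f) = 0"
          unfolding eq using F_in QR v t kill[OF QR(2) R_P x] by (simp add: ev_poly[of A])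
        then show ?thesis using c_ne c_A v by (simp add: ev_upd[of _ A])
      qed
      \<comment> \<open>\<open>G\<close> is the constant \<open>g\<close>, so
        \<open>g - q * b\<close> is in \<open>P\<close> and vanishes at the extended point; there
        \<open>b\<close> is a factor of the nonzero value of \<open>g\<close>.\<close>
      have "poly G ?X - q * b \<in> ?B"
        using g_A A_B by (intro polys_in_diff polys_in_mult q b) (auto simp: G_const)
      from P_0[OF q(2) this] have "ev \<phi> (x(v := t)) b \<noteq> 0"
        using g_ne g_A v by (auto simp: G_const ev_upd[of _ A])
      then show "\<exists>t. (\<forall>f\<in>P \<inter> ?B. ev \<phi> (x(v := t)) f = 0) \<and> ev \<phi> (x(v := t)) b \<noteq> 0"
        using P_0 by blast
    qed
  qed
qed

text \<open>Removing a variable replaces the element \<open>b\<close> that has to stay nonzero by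
  the \<open>a\<close> of \<open>Nullstellensatz_step\<close>, which has one variable fewer.
  \<open>P\<close> is only prime and \<open>b\<close> is prescribed because a pivot and a
  coefficient of a relation must survive the specialization to a geometric point.\<close>

theorem Nullstellensatz:
  fixes P :: "('v::finite, 'k::field) mpoly set" and \<phi> :: "'k \<Rightarrow> 'l::alg_closed_field"
  assumes \<phi>: "coeff_hom \<phi>" and P: "prime_id P" and "b \<notin> P"
  obtains x where "\<And>f. f \<in> P \<Longrightarrow> ev \<phi> x f = 0" "ev \<phi> x b \<noteq> 0"
proof -
  interpret coeff_hom \<phi> by fact
  have "\<exists>x. (\<forall>f\<in>P \<inter> polys_in A. ev \<phi> x f = 0) \<and> ev \<phi> x b \<noteq> 0"
    if "finite A" "b \<in> polys_in A" "b \<notin> P" for A b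
    using that
  proof (induction A arbitrary: b)
    case empty
    have const: "\<exists>c. f = Const c" if "f \<in> polys_in {}" for f :: "('v, 'k) mpoly"
    proof
      show "f = Const (Poly_Mapping.lookup f 0)"
        by (rule poly_mapping_eqI)
           (use that in \<open>auto simp: Const_def polys_in_def lookup_single when_def in_keys_iff\<close>)
    qed
    have "c = 0" if "Const c \<in> P" for c
    proof (rule ccontr)
      assume "c \<noteq> 0"
      then have "Const (inverse c) * Const c = (1 :: ('v, 'k) mpoly)"
        by (simp add: Const_def mult_single)
      then show False using prime_id_multL[OF P that] prime_id_1[OF P] by metis
    qed
    then have zero: "f = 0" if "f \<in> P" "f \<in> polys_in {}" for f
      using const[OF that(2)] that(1) unfolding Const_def by force
    obtain c where c: "b = Const c" using const empty.prems by blast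
    then have "c \<noteq> 0" using empty.prems prime_id_0[OF P] by (auto simp: Const_def)
    then have "\<phi> (inverse c) * \<phi> c = 1" by (simp flip: hom_mult)
    then have "ev \<phi> (\<lambda>_. 0) b \<noteq> 0" using c by auto
    then show ?case using zero by fastforce
  next
    case (insert v A)
    obtain a where a: "a \<in> polys_in A" "a \<notin> P"
      "\<And>x. (\<And>f. f \<in> P \<Longrightarrow> f \<in> polys_in A \<Longrightarrow> ev \<phi> x f = 0) \<Longrightarrow> ev \<phi> x a \<noteq> 0 \<Longrightarrow>
         \<exists>t. (\<forall>f\<in>P \<inter> polys_in (insert v A). ev \<phi> (x(v := t)) f = 0) \<and> ev \<phi> (x(v := t)) b \<noteq> 0"
      using Nullstellensatz_step[OF \<phi> P insert.hyps(2) insert.prems] by blast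
    from insert.IH[OF a(1,2)] a(3) show ?case by blast
  qed
  from this[of UNIV b] \<open>b \<notin> P\<close> show thesis using that by auto
qed

unbundle no fps_syntax

section \<open>One-parameter subgroups and stability\<close>

text \<open>\<open>u\<close> as a trilinear form on the dual space. By \<open>act_tri\<close>,
  acting on \<open>u\<close> by a matrix means evaluating this form on its rows, so a change of
  basis is a choice of rows.\<close>

definition tri :: "('n::finite \<times> 'n \<times> 'n \<Rightarrow> 'a::comm_ring_1) \<Rightarrow> ('n \<Rightarrow> 'a) \<Rightarrow> ('n \<Rightarrow> 'a) \<Rightarrow> ('n \<Rightarrow> 'a) \<Rightarrow> 'a"
  where "tri u x y z = (\<Sum>d\<in>UNIV. \<Sum>e\<in>UNIV. \<Sum>f\<in>UNIV. x d * y e * z f * u (d, e, f))"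

lemma tri_add:
  "tri u (\<lambda>d. x d + x' d) y z = tri u x y z + tri u x' y z"
  "tri u x (\<lambda>d. y d + y' d) z = tri u x y z + tri u x y' z"
  "tri u x y (\<lambda>d. z d + z' d) = tri u x y z + tri u x y z'"
  by (simp_all add: tri_def algebra_simps sum.distrib)

lemma tri_scale:
  "tri u (\<lambda>d. c * x d) y z = c * tri u x y z"
  "tri u x (\<lambda>d. c * y d) z = c * tri u x y z"
  "tri u x y (\<lambda>d. c * z d) = c * tri u x y z"
  by (simp_all add: tri_def sum_distrib_left mult_ac)

lemma tri_0: "tri u (\<lambda>_. 0) y z = 0" "tri u x (\<lambda>_. 0) z = 0" "tri u x y (\<lambda>_. 0) = 0"
  by (simp_all add: tri_def)

lemma tri_sum:
  "tri u (\<lambda>d. \<Sum>i\<in>I. c i * Y i d) y z = (\<Sum>i\<in>I. c i * tri u (Y i) y z)"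
  "tri u x (\<lambda>d. \<Sum>i\<in>I. c i * Y i d) z = (\<Sum>i\<in>I. c i * tri u x (Y i) z)"
  "tri u x y (\<lambda>d. \<Sum>i\<in>I. c i * Y i d) = (\<Sum>i\<in>I. c i * tri u x y (Y i))"
  by (induction I rule: infinite_finite_induct; simp add: tri_add tri_scale tri_0)+

lemma tri_fun_scale: "tri (\<lambda>t. c * u t) x y z = c * tri u x y z"
  by (simp add: tri_def sum_distrib_left mult_ac)

lemma tri_fun_add: "tri (\<lambda>t. u t + v t) x y z = tri u x y z + tri v x y z"
  by (simp add: tri_def algebra_simps sum.distrib)

definition unit :: "'n \<Rightarrow> 'n \<Rightarrow> 'a::zero_neq_one" where
  "unit a = (\<lambda>b. if b = a then 1 else 0)"

lemma unit_self [simp]: "unit a a = 1" and unit_other: "b \<noteq> a \<Longrightarrow> unit a b = 0"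
  by (simp_all add: unit_def)

lemma sum_unit: "(\<Sum>d\<in>UNIV. unit a d * g d) = (g (a :: 'n::finite) :: 'a::comm_ring_1)"
proof -
  have "(\<Sum>d\<in>UNIV. unit a d * g d) = (\<Sum>d\<in>UNIV. if d = a then g d else 0)"
    by (rule sum.cong) (auto simp: unit_def)
  then show ?thesis by simp
qed

lemma tri_units: "tri u (unit a) (unit b) (unit c) = u (a, b, c)"
proof -
  have "tri u (unit a) (unit b) (unit c) =
      (\<Sum>d\<in>UNIV. unit a d * (\<Sum>e\<in>UNIV. unit b e * (\<Sum>f\<in>UNIV. unit c f * u (d, e, f))))"
    by (simp add: tri_def sum_distrib_left mult_ac)
  then show ?thesis by (simp add: sum_unit)
qed

text \<open>Terms off the diagonal cancel in pairs and the diagonal vanishes by assumption; nothing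
  is divided by two.\<close>

lemma alternating_sum_eq_0:
  fixes M :: "'n \<Rightarrow> 'n \<Rightarrow> 'a::comm_ring_1"
  assumes "\<And>d. M d d = 0" "\<And>d e. M e d = - M d e" "finite A"
  shows "(\<Sum>d\<in>A. \<Sum>e\<in>A. x d * x e * M d e) = 0"
  using assms(3)
proof induction
  case (insert a A)
  have "(\<Sum>d\<in>insert a A. \<Sum>e\<in>insert a A. x d * x e * M d e) =
     (\<Sum>e\<in>A. x a * x e * M a e) + ((\<Sum>d\<in>A. x d * x a * M d a) + (\<Sum>d\<in>A. \<Sum>e\<in>A. x d * x e * M d e))"
    using insert assms(1) by (simp add: sum.distrib)
  also have "\<dots> = (\<Sum>e\<in>A. x a * x e * M a e + x e * x a * M e a)"
    using insert by (simp add: sum.distrib)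
  also have "\<dots> = 0"
    by (rule sum.neutral) (simp add: assms(2)[of _ a] algebra_simps)
  finally show ?case .
qed simp

lemma trivectorsD:
  assumes "u \<in> trivectors"
  shows "u (a, a, c) = 0" "u (a, b, b) = 0" "u (a, b, a) = 0"
    "u (b, a, c) = - u (a, b, c)" "u (a, c, b) = - u (a, b, c)"
  using assms unfolding trivectors_def mem_Collect_eq by blast+

lemma trivectorsI:
  assumes "\<And>a c. u (a, a, c) = 0" "\<And>a b. u (a, b, b) = 0" "\<And>a b. u (a, b, a) = 0"
    "\<And>a b c. u (b, a, c) = - u (a, b, c)" "\<And>a b c. u (a, c, b) = - u (a, b, c)"
  shows "u \<in> trivectors"
  unfolding trivectors_def mem_Collect_eq using assms by blast

lemma tri_swap:
  assumes "u \<in> trivectors"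
  shows "tri u y x z = - tri u x y z" "tri u x z y = - tri u x y z"
proof -
  have "tri u y x z = (\<Sum>d\<in>UNIV. \<Sum>e\<in>UNIV. \<Sum>f\<in>UNIV. - (x e * y d * z f * u (e, d, f)))"
    unfolding tri_def by (intro sum.cong refl, subst trivectorsD(4)[OF assms]) simp
  also have "\<dots> = - tri u x y z"
    unfolding tri_def sum_negf by (subst sum.swap) simp
  finally show "tri u y x z = - tri u x y z" .
  have "tri u x z y = (\<Sum>d\<in>UNIV. \<Sum>e\<in>UNIV. \<Sum>f\<in>UNIV. - (x d * y f * z e * u (d, f, e)))"
    unfolding tri_def by (intro sum.cong refl, subst trivectorsD(5)[OF assms]) simp
  also have "\<dots> = (\<Sum>d\<in>UNIV. \<Sum>f\<in>UNIV. \<Sum>e\<in>UNIV. - (x d * y f * z e * u (d, f, e)))"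
    by (intro sum.cong refl sum.swap)
  also have "\<dots> = - tri u x y z"
    unfolding tri_def sum_negf by simp
  finally show "tri u x z y = - tri u x y z" .
qed

lemma tri_alt:
  assumes "u \<in> trivectors"
  shows "tri u x x z = 0" "tri u x z z = 0" "tri u x z x = 0"
proof -
  have 1: "tri u x x z = 0" for x z
  proof -
    have "tri u x x z = (\<Sum>d\<in>UNIV. \<Sum>e\<in>UNIV. x d * x e * (\<Sum>f\<in>UNIV. z f * u (d, e, f)))"
      by (simp add: tri_def sum_distrib_left mult_ac)
    also have "\<dots> = 0"
    proof (rule alternating_sum_eq_0)
      show "(\<Sum>f\<in>UNIV. z f * u (d, d, f)) = 0" for d
        by (simp add: trivectorsD(1)[OF assms])
      show "(\<Sum>f\<in>UNIV. z f * u (e, d, f)) = - (\<Sum>f\<in>UNIV. z f * u (d, e, f))" for d e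
        unfolding sum_negf[symmetric]
        by (intro sum.cong refl, subst trivectorsD(4)[OF assms]) simp
    qed simp
    finally show ?thesis .
  qed
  then show "tri u x x z = 0" .
  show 2: "tri u x z x = 0" for x z using tri_swap(2)[OF assms, of x x z] 1 by simp
  show "tri u x z z = 0" using tri_swap(1)[OF assms, of z x z] 2 by simp
qed

lemma act_tri: "act g u (a, b, c) = tri u (\<lambda>d. g $ a $ d) (\<lambda>d. g $ b $ d) (\<lambda>d. g $ c $ d)"
  by (simp add: act_def tri_def sum.cartesian_product)

lemma act_act: "act g (act h u) = act (g ** h) u"
proof -
  have row: "($) ((g ** h) $ a) = (\<lambda>d. \<Sum>k\<in>UNIV. g $ a $ k * h $ k $ d)" for a
    by (auto simp: matrix_matrix_mult_def)
  have "act g (act h u) (a, b, c) = act (g ** h) u (a, b, c)" for a b c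
    unfolding act_tri row tri_sum(1) unfolding tri_sum(2) unfolding tri_sum(3)
    by (simp add: tri_def[of "act h u"] act_tri sum_distrib_left mult_ac)
  then show ?thesis by auto
qed

lemma act_mat:
  fixes u :: "'n::finite \<times> 'n \<times> 'n \<Rightarrow> 'a::comm_ring_1"
  shows "act (mat z) u = (\<lambda>t. z ^ 3 * u t)"
proof -
  have "(\<lambda>d. mat z $ a $ d) = (\<lambda>d. z * unit a d)" for a :: 'n
    by (auto simp: mat_def unit_def)
  then have "act (mat z) u (a, b, c) = z ^ 3 * u (a, b, c)" for a b c
    by (simp add: act_tri tri_scale tri_units power3_eq_cube)
  then show ?thesis by auto
qed

lemma act_trivectors:
  assumes "u \<in> trivectors"
  shows "act g u \<in> trivectors"
  by (rule trivectorsI) (unfold act_tri, (rule tri_alt[OF assms] tri_swap[OF assms])+)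

lemma monom_ev_hom:
  assumes "coeff_hom \<psi>"
  shows "\<psi> (monom_ev x m) = monom_ev (\<lambda>v. \<psi> (x v)) m"
proof -
  interpret coeff_hom \<psi> by fact
  have "\<psi> (\<Prod>v\<in>A. f v) = (\<Prod>v\<in>A. \<psi> (f v))" for A :: "'c set" and f
    by (induction A rule: infinite_finite_induct) (simp_all add: hom_mult)
  then show ?thesis by (simp add: monom_ev_def hom_power)
qed

lemma ev_hom:
  assumes "coeff_hom \<psi>"
  shows "\<psi> (ev \<phi> x f) = ev (\<lambda>c. \<psi> (\<phi> c)) (\<lambda>v. \<psi> (x v)) f"
proof -
  interpret coeff_hom \<psi> by fact
  show ?thesis by (simp add: ev_def hom_sum hom_mult monom_ev_hom[OF assms])
qed

lemma coeff_hom_poly_at: "coeff_hom (\<lambda>p. poly p t)"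
  by unfold_locales simp_all

lemma prod_power_int:
  "(t :: 'a::field) \<noteq> 0 \<Longrightarrow> (\<Prod>i\<in>A. t powi w i) = t powi (\<Sum>i\<in>A. w i)"
  by (induction A rule: infinite_finite_induct) (simp_all add: power_int_add)

lemma act_1: "act (mat 1) u = u"
  by (simp add: act_mat)

lemma finite_roots_of: "finite {t :: 'a::field. t ^ n = c}" if "n > 0"
proof -
  let ?p = "monom 1 n - [:c:]"
  have "coeff ?p n = 1" using that by (cases n) auto
  then have "?p \<noteq> 0" by (metis coeff_0 zero_neq_one)
  then have "finite {t. poly ?p t = 0}" by (rule poly_roots_finite)
  then show ?thesis by (simp add: poly_monom)
qed

lemma scalar_mat_commute: "mat z ** A = A ** (mat z :: 'a::comm_ring_1^'n::finite^'n)"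
  by (simp add: matrix_matrix_mult_def mat_def vec_eq_iff if_distrib if_distribR mult.commute
      sum.delta sum.delta' cong: if_cong)

lemma mat_mult_nth: "(mat z ** A) $ a $ b = z * (A $ a $ b :: 'a::comm_ring_1)"
  by (simp add: matrix_matrix_mult_def mat_def if_distrib if_distribR cong: if_cong)

text \<open>If no weight were negative, the limit of the one-parameter subgroup would lie in the closed
  orbit, and its stabilizer would contain the whole one-parameter subgroup.\<close>

theorem Hilbert_Mumford_weights:
  fixes u :: "'n::finite \<times> 'n \<times> 'n \<Rightarrow> 'a::alg_closed_field" and g :: "'n \<Rightarrow> 'n \<Rightarrow> 'a" and w :: "'n \<Rightarrow> int"
  assumes u: "u \<in> trivectors" and fin: "finite (stabilizer u)"
    and closed: "zariski_closed_in trivectors ((\<lambda>g. act g u) ` SL)"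
    and indep: "\<And>y. (\<And>b. (\<Sum>a\<in>UNIV. y a * g a b) = 0) \<Longrightarrow> (\<And>a. y a = 0)"
    and w: "sum w UNIV = 0" "w a0 \<noteq> 0"
  obtains a b c where "tri u (g a) (g b) (g c) \<noteq> 0" "w a + w b + w c < 0"
proof (rule ccontr)
  assume "\<not> thesis"
  then have nonneg: "w a + w b + w c \<ge> 0" if "tri u (g a) (g b) (g c) \<noteq> 0" for a b c
    using that \<open>\<And>c b a. \<lbrakk>tri u (g a) (g b) (g c) \<noteq> 0; w a + w b + w c < 0\<rbrakk> \<Longrightarrow> thesis\<close> by force
  define G :: "'a^'n^'n" where "G = (\<chi> a b. g a b)"
  have "det G \<noteq> 0"
  proof -
    have "\<exists>B. B ** transpose G = mat 1"
    proof (subst matrix_left_invertible_ker, safe)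
      fix y :: "'a^'n" assume "transpose G *v y = 0"
      then have "(\<Sum>a\<in>UNIV. y $ a * g a b) = 0" for b
        by (simp add: vec_eq_iff matrix_vector_mult_def transpose_def G_def mult.commute)
      then show "y = 0" using indep[of "($) y"] by (simp add: vec_eq_iff)
    qed
    then obtain B where "B ** transpose G = mat 1" ..
    then have "det B * det G = 1" by (metis det_I det_mul det_transpose)
    then show ?thesis by auto
  qed
  \<comment> \<open>Rescaling one row puts the frame into \<open>SL\<close> and does not affect
    which values of \<open>u\<close> on the frame vanish.\<close>
  define s where "s a = (if a = a0 then inverse (det G) else 1)" for a :: 'n
  define G' :: "'a^'n^'n" where "G' = (\<chi> a. s a *s (G $ a))"
  have "det G' = 1"
  proof -
    have "prod s UNIV = inverse (det G)" by (simp add: s_def)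
    moreover have "det G' = prod s UNIV * det (\<chi> a. G $ a)" unfolding G'_def by (rule det_rows_mul)
    ultimately show ?thesis using \<open>det G \<noteq> 0\<close> by simp
  qed
  define v where "v = act G' u"
  have v_tri: "v \<in> trivectors" unfolding v_def by (rule act_trivectors[OF u])
  have v_nonneg: "w a + w b + w c \<ge> 0" if "v (a, b, c) \<noteq> 0" for a b c
    using that nonneg[of a b c] by (simp add: v_def act_tri G'_def G_def tri_scale)
  define D where "D t = ((\<chi> a b. t powi w a * unit a b) :: 'a^'n^'n)" for t
  have det_D: "det (D t) = 1" if "t \<noteq> 0" for t
    using that w by (subst det_diagonal) (simp_all add: D_def unit_other prod_power_int)
  have act_D: "act (D t) y (a, b, c) = t powi (w a + w b + w c) * y (a, b, c)" if "t \<noteq> 0" for t y a b c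
    using that by (simp add: act_tri D_def tri_scale tri_units power_int_add)
  define v0 where "v0 = (\<lambda>(a, b, c). if w a + w b + w c = 0 then v (a, b, c) else 0)"
  obtain F where F: "(\<lambda>g. act g u) ` SL = {z \<in> trivectors. \<forall>f\<in>F. mpoly_eval f z = 0}"
    using closed by (auto simp: zariski_closed_in_def)
  have orbit: "mpoly_eval f (act h u) = 0" if "f \<in> F" "det h = 1" for f h
    using F that unfolding SL_def by blast
  have v0_tri: "v0 \<in> trivectors"
    by (rule trivectorsI) (auto simp: v0_def trivectorsD(1-3)[OF v_tri] add_ac
        intro: trivectorsD(4-5)[OF v_tri])
  have "mpoly_eval f v0 = 0" if f: "f \<in> F" for f
  proof -
    \<comment> \<open>The curve \<open>D t\<close> applied to \<open>v\<close>, written with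
      polynomials in \<open>t\<close>: the exponents are nonnegative wherever \<open>v\<close> is
      nonzero. Equations of the orbit vanish on it for all nonzero \<open>t\<close>, hence also at
      \<open>t = 0\<close>, which is the limit \<open>v0\<close>.\<close>
    define Y where "Y = (\<lambda>(a, b, c). monom (v (a, b, c)) (nat (w a + w b + w c)))"
    define p where "p = ev (\<lambda>c. [:c:]) Y f"
    have poly_p: "poly p t = mpoly_eval f (\<lambda>i. poly (Y i) t)" for t
      unfolding p_def mpoly_eval_ev ev_hom[OF coeff_hom_poly_at] by simp
    have "poly p t = 0" if "t \<notin> {0}" for t
    proof -
      have "poly (Y (a, b, c)) t = act (D t ** G') u (a, b, c)" for a b c
      proof (cases "v (a, b, c) = 0")
        case False
        then have "t powi (w a + w b + w c) = t ^ nat (w a + w b + w c)"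
          using v_nonneg by (simp add: power_int_def)
        then show ?thesis
          using that by (simp add: Y_def poly_monom act_act[symmetric] v_def[symmetric] act_D)
      qed (use that in \<open>simp add: Y_def poly_monom act_act[symmetric] v_def[symmetric] act_D\<close>)
      then have "(\<lambda>i. poly (Y i) t) = act (D t ** G') u" by auto
      then show ?thesis
        using orbit[OF f, of "D t ** G'"] that det_D \<open>det G' = 1\<close> by (simp add: poly_p det_mul)
    qed
    then have "p = 0" using poly_eq_0_cofinite[of "{0}" p] by simp
    moreover have "(\<lambda>i. poly (Y i) 0) = v0"
      using v_nonneg by (force simp: Y_def v0_def poly_monom power_0_left split: if_splits)
    ultimately show ?thesis using poly_p[of 0] by simp
  qed
  then obtain h where h: "det h = 1" "v0 = act h u"
    using F v0_tri unfolding SL_def by blast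
  then obtain h' where h': "h' ** h = mat 1" "h ** h' = mat 1"
    using invertible_det_nz[of h] by (auto simp: invertible_def)
  then have "det h' = 1" using h(1) by (metis det_I det_mul mult.right_neutral)
  \<comment> \<open>\<open>D t\<close> fixes \<open>v0\<close>, which lies in the orbit as
    \<open>act h u\<close>; conjugation by \<open>h\<close> moves the one-parameter subgroup into
    the stabilizer of \<open>u\<close>.\<close>
  define S where "S t = h' ** D t ** h" for t
  have S_SL: "S t \<in> SL" if "t \<noteq> 0" for t
    using that det_D h(1) \<open>det h' = 1\<close> by (simp add: S_def SL_def det_mul)
  have act_S: "act (S t) u = u" if "t \<noteq> 0" for t
  proof -
    have "act (D t) v0 = v0" using that by (auto simp: act_D v0_def)
    then have "act (S t) u = act h' v0" by (simp add: S_def act_act[symmetric] h(2)[symmetric])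
    also have "\<dots> = u" by (simp add: h(2) act_act h' act_1)
    finally show ?thesis .
  qed
  define C where "C t = mu3_rel `` {S t}" for t
  have "C t \<in> stabilizer u" if "t \<noteq> 0" for t
    unfolding stabilizer_def
  proof (intro CollectI conjI ballI)
    show "C t \<in> SL // mu3_rel" unfolding C_def by (rule quotientI) (rule S_SL[OF that])
    fix k assume "k \<in> C t"
    then show "act k u = u"
      using act_S[OF that] by (auto simp: C_def mu3_rel_def act_act[symmetric] act_mat)
  qed
  then have "C ` (UNIV - {0}) \<subseteq> stabilizer u" by auto
  then have "finite (C ` (UNIV - {0}))" using fin by (rule finite_subset)
  moreover have "infinite (UNIV - {0 :: 'a})" using alg_closed_infinite[where 'a = 'a] by simp
  ultimately obtain t0 where t0: "t0 \<noteq> 0" and inf: "infinite {t \<in> UNIV - {0}. C t = C t0}"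
    using pigeonhole_infinite[of "UNIV - {0}" C] by auto
  \<comment> \<open>Two parameters with the same class modulo cube roots of unity have equal cubes
    of the entry \<open>t powi w a0\<close>. The exponent \<open>3 * w a0\<close> is nonzero, which
    leaves finitely many parameters per class.\<close>
  define n where "n = nat (3 * \<bar>w a0\<bar>)"
  have "t ^ n = t0 ^ n" if t: "t \<noteq> 0" "C t = C t0" for t
  proof -
    have "S t \<in> C t" unfolding C_def mu3_rel_def using S_SL[OF t(1)] by (auto intro!: exI[of _ 1])
    then obtain z where z: "z ^ 3 = 1" "S t = mat z ** S t0"
      unfolding t(2) by (auto simp: C_def mu3_rel_def)
    have "D t = h ** S t ** h'"
      by (metis S_def h'(2) matrix_mul_assoc matrix_mul_lid matrix_mul_rid)
    also have "\<dots> = mat z ** (h ** S t0 ** h')"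
      unfolding z(2) by (metis matrix_mul_assoc scalar_mat_commute)
    also have "h ** S t0 ** h' = D t0"
      by (metis S_def h'(2) matrix_mul_assoc matrix_mul_lid matrix_mul_rid)
    finally have "D t $ a0 $ a0 = z * D t0 $ a0 $ a0" by (simp add: mat_mult_nth)
    then have "t powi w a0 = z * t0 powi w a0" by (simp add: D_def)
    then have "(t powi w a0) ^ 3 = (t0 powi w a0) ^ 3" using z(1) by (simp add: power_mult_distrib)
    then have "t powi (3 * w a0) = t0 powi (3 * w a0)"
      by (simp add: power_int_mult mult.commute[of 3] power_int_numeral)
    then show ?thesis
      by (cases "w a0 \<ge> 0") (simp_all add: power_int_def n_def power_inverse split: if_splits)
  qed
  then have "{t \<in> UNIV - {0}. C t = C t0} \<subseteq> {t. t ^ n = t0 ^ n}" by blast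
  moreover have "n > 0" using w(2) by (simp add: n_def)
  ultimately show False using inf finite_subset[OF _ finite_roots_of] by metis
qed

section \<open>Pfaffians of size four and six\<close>

definition alt_mat :: "('n \<Rightarrow> 'n \<Rightarrow> 'r::comm_ring_1) \<Rightarrow> bool" where
  "alt_mat A \<longleftrightarrow> (\<forall>a. A a a = 0) \<and> (\<forall>a b. A b a = - A a b)"

text \<open>Only entries whose row index comes earlier in the list occur. Identities that respect
  the order of the indices therefore hold for any matrix, alternating or not.\<close>

definition pf4 :: "('n \<Rightarrow> 'n \<Rightarrow> 'r::comm_ring_1) \<Rightarrow> 'n \<Rightarrow> 'n \<Rightarrow> 'n \<Rightarrow> 'n \<Rightarrow> 'r" where
  "pf4 A a b c d = A a b * A c d - A a c * A b d + A a d * A b c"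

definition pf6 :: "('n \<Rightarrow> 'n \<Rightarrow> 'r::comm_ring_1) \<Rightarrow> 'n \<Rightarrow> 'n \<Rightarrow> 'n \<Rightarrow> 'n \<Rightarrow> 'n \<Rightarrow> 'n \<Rightarrow> 'r" where
  "pf6 A a b c d e f = A a b * pf4 A c d e f - A a c * pf4 A b d e f + A a d * pf4 A b c e f
     - A a e * pf4 A b c d f + A a f * pf4 A b c d e"

lemma pfaffian_6: "pfaffian A [a, b, c, d, e, f] = pf6 A a b c d e f"
  by (simp add: pf6_def pf4_def numeral_eq_Suc lessThan_Suc algebra_simps)

lemma pf6_last:
  "pf6 A a b c d e f = A a f * pf4 A b c d e - A b f * pf4 A a c d e + A c f * pf4 A a b d e
     - A d f * pf4 A a b c e + A e f * pf4 A a b c d"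
  by (simp add: pf6_def pf4_def algebra_simps)

text \<open>A Pluecker-type relation. Both sides are the signed sum over i and j of
  \<open>pf4\<close> on the other i's, times \<open>A i j\<close>, times \<open>pf4\<close> on the
  other j's: on the left each \<open>pf6\<close> is expanded along its first index, on the right
  along its last.\<close>

lemma pf6_exchange:
  "pf4 A i2 i3 i4 i5 * pf6 A i1 j1 j2 j3 j4 j5 - pf4 A i1 i3 i4 i5 * pf6 A i2 j1 j2 j3 j4 j5
   + pf4 A i1 i2 i4 i5 * pf6 A i3 j1 j2 j3 j4 j5 - pf4 A i1 i2 i3 i5 * pf6 A i4 j1 j2 j3 j4 j5
   + pf4 A i1 i2 i3 i4 * pf6 A i5 j1 j2 j3 j4 j5 =
   pf6 A i1 i2 i3 i4 i5 j1 * pf4 A j2 j3 j4 j5 - pf6 A i1 i2 i3 i4 i5 j2 * pf4 A j1 j3 j4 j5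
   + pf6 A i1 i2 i3 i4 i5 j3 * pf4 A j1 j2 j4 j5 - pf6 A i1 i2 i3 i4 i5 j4 * pf4 A j1 j2 j3 j5
   + pf6 A i1 i2 i3 i4 i5 j5 * pf4 A j1 j2 j3 j4"
  unfolding pf6_last[of A i1 i2 i3 i4 i5] unfolding pf6_def by (simp add: algebra_simps)

context
  fixes A :: "'n \<Rightarrow> 'n \<Rightarrow> 'r::comm_ring_1"
  assumes A: "alt_mat A"
begin

lemma alt_mat_self [simp]: "A a a = 0" and alt_mat_swap: "A b a = - A a b"
  using A unfolding alt_mat_def by blast+

text \<open>A cyclic rotation of six indices is an odd permutation.\<close>

lemma pf6_rotate: "pf6 A b c d e f a = - pf6 A a b c d e f"
  unfolding pf6_last[of A b] pf6_def[of A a] by (simp add: alt_mat_swap[of _ a] algebra_simps)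

lemma pf6_repeat:
  "pf6 A a a c d e f = 0" "pf6 A a b a d e f = 0" "pf6 A a b c a e f = 0"
  "pf6 A a b c d a f = 0" "pf6 A a b c d e a = 0"
  by (simp_all add: pf6_def pf4_def alt_mat_swap[of b a] alt_mat_swap[of c a] alt_mat_swap[of d a]
      alt_mat_swap[of e a] algebra_simps)

lemma pf6_last_repeat:
  "pf6 A a b c d a f = 0" "pf6 A a b c d b f = 0" "pf6 A a b c d c f = 0" "pf6 A a b c d d f = 0"
  "pf6 A a b c d e a = 0" "pf6 A a b c d e b = 0" "pf6 A a b c d e c = 0" "pf6 A a b c d e d = 0"
  "pf6 A a b c d e e = 0"
  by (simp_all add: pf6_def pf4_def alt_mat_swap[of b a] alt_mat_swap[of c a] alt_mat_swap[of d a]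
      alt_mat_swap[of e a] alt_mat_swap[of c b] alt_mat_swap[of d b] alt_mat_swap[of e b]
      alt_mat_swap[of d c] alt_mat_swap[of e c] alt_mat_swap[of e d] algebra_simps)

lemma pf6_last_swap: "pf6 A a b c d f e = - pf6 A a b c d e f"
  by (simp add: pf6_def pf4_def alt_mat_swap[of f e] algebra_simps)

end

lemma (in coeff_hom) hom_pf4: "\<phi> (pf4 A a b c d) = pf4 (\<lambda>p q. \<phi> (A p q)) a b c d"
  by (simp add: pf4_def hom_add hom_mult hom_diff)

lemma (in coeff_hom) hom_pf6: "\<phi> (pf6 A a b c d e f) = pf6 (\<lambda>p q. \<phi> (A p q)) a b c d e f"
  by (simp add: pf6_def hom_pf4 hom_add hom_mult hom_diff)

text \<open>By Cramer's rule for Pfaffians, the solutions of the rows \<open>b\<^sub>1, \<dots>, b\<^sub>4\<close> of \<open>A\<close>: once the Pfaffians of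
  size six vanish, they span the kernel of \<open>A\<close>.\<close>

definition nvec :: "('n \<Rightarrow> 'n \<Rightarrow> 'r::comm_ring_1) \<Rightarrow> 'n \<Rightarrow> 'n \<Rightarrow> 'n \<Rightarrow> 'n \<Rightarrow> 'n \<Rightarrow> 'n \<Rightarrow> 'r" where
  "nvec A b1 b2 b3 b4 j = (\<lambda>q. unit j q * pf4 A b1 b2 b3 b4 + unit b1 q * pf4 A b2 b3 b4 j
     - unit b2 q * pf4 A b1 b3 b4 j + unit b3 q * pf4 A b1 b2 b4 j - unit b4 q * pf4 A b1 b2 b3 j)"

lemma sum_nvec:
  fixes A :: "'n::finite \<Rightarrow> 'n \<Rightarrow> 'r::comm_ring_1"
  shows "(\<Sum>q\<in>UNIV. nvec A b1 b2 b3 b4 j q * y q) = pf4 A b1 b2 b3 b4 * y j + pf4 A b2 b3 b4 j * y b1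
     - pf4 A b1 b3 b4 j * y b2 + pf4 A b1 b2 b4 j * y b3 - pf4 A b1 b2 b3 j * y b4"
proof -
  have "nvec A b1 b2 b3 b4 j q * y q = unit j q * (pf4 A b1 b2 b3 b4 * y q)
     + unit b1 q * (pf4 A b2 b3 b4 j * y q) - unit b2 q * (pf4 A b1 b3 b4 j * y q)
     + unit b3 q * (pf4 A b1 b2 b4 j * y q) - unit b4 q * (pf4 A b1 b2 b3 j * y q)" for q
    by (simp add: nvec_def algebra_simps)
  then show ?thesis by (simp add: sum.distrib sum_subtractf sum_unit)
qed

text \<open>The pairing with row \<open>p\<close> is, up to reordering, the expansion of a Pfaffian
  of size six along \<open>p\<close>; for \<open>p\<close> in the pivot set an index repeats and it
  vanishes.\<close>

lemma mult_nvec: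
  fixes A :: "'n::finite \<Rightarrow> 'n \<Rightarrow> 'r::comm_ring_1"
  assumes "alt_mat A"
  shows "(\<Sum>q\<in>UNIV. nvec A b1 b2 b3 b4 j q * A p q) = pf6 A b1 b2 b3 b4 p j"
  unfolding sum_nvec pf6_last_swap[OF assms, of b1 b2 b3 b4 p j]
  unfolding pf6_last[of A b1 b2 b3 b4 j p] by (simp add: alt_mat_swap[OF assms, of p] algebra_simps)

text \<open>Up to powers of the pivot, these Pfaffians are the entries of the Schur complement of
  the pivot block. Written as values of the form on two kernel candidates, they can be
  differentiated easily.\<close>

lemma nvec_mult_nvec:
  fixes A :: "'n::finite \<Rightarrow> 'n \<Rightarrow> 'r::comm_ring_1"
  assumes "alt_mat A"
  shows "(\<Sum>p\<in>UNIV. nvec A b1 b2 b3 b4 j p * (\<Sum>q\<in>UNIV. nvec A b1 b2 b3 b4 l q * A p q)) =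
     pf4 A b1 b2 b3 b4 * pf6 A b1 b2 b3 b4 j l"
  unfolding mult_nvec[OF assms] sum_nvec by (simp add: pf6_last_repeat[OF assms])

text \<open>Expanding along \<open>e\<close> produces rows of \<open>A\<close> paired with
  \<open>x\<close>. With \<open>x\<close> the coordinate vector, this trades an index
  \<open>i\<close> with x_i nonzero for other indices; \<open>sum_pf6_kernel\<close> serves the same
  purpose.\<close>

lemma sum_pf4_kernel:
  fixes A :: "'n::finite \<Rightarrow> 'n \<Rightarrow> 'r::comm_ring_1"
  assumes "\<And>p. (\<Sum>q\<in>UNIV. A q p * x q) = 0"
  shows "(\<Sum>e\<in>UNIV. x e * pf4 A e b c d) = 0"
proof -
  have "x e * pf4 A e b c d = A c d * (A e b * x e) - A b d * (A e c * x e) + A b c * (A e d * x e)" for e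
    by (simp add: pf4_def algebra_simps)
  then show ?thesis
    by (simp add: sum.distrib sum_subtractf assms flip: sum_distrib_left)
qed

lemma sum_pf6_kernel:
  fixes A :: "'n::finite \<Rightarrow> 'n \<Rightarrow> 'r::comm_ring_1"
  assumes "\<And>p. (\<Sum>q\<in>UNIV. A p q * x q) = 0"
  shows "(\<Sum>q\<in>UNIV. x q * pf6 A b1 b2 b3 b4 p q) = 0"
proof -
  have "x q * pf6 A b1 b2 b3 b4 p q = pf4 A b2 b3 b4 p * (A b1 q * x q) - pf4 A b1 b3 b4 p * (A b2 q * x q)
     + pf4 A b1 b2 b4 p * (A b3 q * x q) - pf4 A b1 b2 b3 p * (A b4 q * x q) + pf4 A b1 b2 b3 b4 * (A p q * x q)" for q
    by (simp add: pf6_last algebra_simps)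
  then show ?thesis
    by (simp add: sum.distrib sum_subtractf assms flip: sum_distrib_left)
qed

section \<open>Destabilizing flags\<close>

text \<open>Stability enters the geometry below only through this property of frames with weights;
  the vectors of the frame are the functions \<open>g a\<close>.\<close>

definition no_destab :: "('n::finite \<times> 'n \<times> 'n \<Rightarrow> 'a::field) \<Rightarrow> bool" where
  "no_destab u \<longleftrightarrow> (\<forall>(g :: 'n \<Rightarrow> 'n \<Rightarrow> 'a) w a0. (\<forall>y. (\<forall>b. (\<Sum>a\<in>UNIV. y a * g a b) = 0) \<longrightarrow> (\<forall>a. y a = 0)) \<longrightarrow>
     sum w UNIV = 0 \<longrightarrow> w a0 \<noteq> (0 :: int) \<longrightarrow>
     (\<exists>a b c. tri u (g a) (g b) (g c) \<noteq> 0 \<and> w a + w b + w c < 0))"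

lemma comp_trivectors:
  assumes "coeff_hom \<phi>" "u \<in> trivectors"
  shows "(\<lambda>t. \<phi> (u t)) \<in> trivectors"
proof -
  interpret coeff_hom \<phi> by fact
  show ?thesis
  proof (rule trivectorsI)
    show "\<phi> (u (b, a, c)) = - \<phi> (u (a, b, c))" "\<phi> (u (a, c, b)) = - \<phi> (u (a, b, c))" for a b c
      by (simp_all add: trivectorsD(4)[OF assms(2), of b a] trivectorsD(5)[OF assms(2), of a c b] hom_uminus)
  qed (simp_all add: trivectorsD(1-3)[OF assms(2)])
qed

lemma stable_no_destab:
  fixes u :: "'n::finite \<times> 'n \<times> 'n \<Rightarrow> 'k::field"
  assumes "u \<in> trivectors" "stable_trivector u"
  shows "no_destab (\<lambda>t. to_ac (u t))"
  unfolding no_destab_def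
proof (intro allI impI)
  fix g :: "'n \<Rightarrow> 'n \<Rightarrow> 'k alg_closure" and w :: "'n \<Rightarrow> int" and a0
  assume *: "\<forall>y. (\<forall>b. (\<Sum>a\<in>UNIV. y a * g a b) = 0) \<longrightarrow> (\<forall>a. y a = 0)"
    "sum w UNIV = 0" "w a0 \<noteq> (0 :: int)"
  show "\<exists>a b c. tri (\<lambda>t. to_ac (u t)) (g a) (g b) (g c) \<noteq> 0 \<and> w a + w b + w c < 0"
    by (rule Hilbert_Mumford_weights[of "\<lambda>t. to_ac (u t)" g w a0])
       (use assms * comp_trivectors[OF coeff_hom_to_ac] in \<open>auto simp: stable_trivector_def Let_def comp_def\<close>)
qed

text \<open>Ordering the indices by \<open>r\<close> makes the matrix triangular with nonzero
  diagonal; indices of equal \<open>r\<close> do not interact. The destabilizing frames below are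
  all of this shape.\<close>

lemma triangular_indep:
  fixes g :: "'n::finite \<Rightarrow> 'n \<Rightarrow> 'a::field" and r :: "'n \<Rightarrow> nat"
  assumes diag: "\<And>a. g a a \<noteq> 0"
    and triang: "\<And>a b. a \<noteq> b \<Longrightarrow> g a b \<noteq> 0 \<Longrightarrow> r a < r b"
    and y: "\<And>b. (\<Sum>a\<in>UNIV. y a * g a b) = 0"
  shows "y p = 0"
proof (induction "r p" arbitrary: p rule: less_induct)
  case less
  have "(\<Sum>a\<in>UNIV. y a * g a p) = y p * g p p + (\<Sum>a\<in>UNIV - {p}. y a * g a p)"
    by (rule sum.remove) auto
  also have "(\<Sum>a\<in>UNIV - {p}. y a * g a p) = 0"
  proof (rule sum.neutral, rule ballI)
    fix a assume "a \<in> UNIV - {p}"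
    then show "y a * g a p = 0"
      using triang[of a p] less[of a] by (cases "g a p = 0") auto
  qed
  finally show ?case using y[of p] diag[of p] by simp
qed

lemma no_destabD:
  assumes "no_destab u" "\<And>a. g a a \<noteq> 0" "\<And>a b. a \<noteq> b \<Longrightarrow> g a b \<noteq> 0 \<Longrightarrow> r a < (r b :: nat)"
    "sum w UNIV = 0" "w a0 \<noteq> (0 :: int)"
  obtains a b c where "tri u (g a) (g b) (g c) \<noteq> 0" "w a + w b + w c < 0"
proof -
  have indep: "y a = 0" if "\<And>b. (\<Sum>a\<in>UNIV. y a * g a b) = 0" for y a
    by (rule triangular_indep[of g r, OF assms(2,3) that])
  have "\<exists>a b c. tri u (g a) (g b) (g c) \<noteq> 0 \<and> w a + w b + w c < 0"
    by (rule assms(1)[unfolded no_destab_def, rule_format, of g w a0])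
      (rule indep, simp, fact assms(4), fact assms(5))
  then show thesis using that by blast
qed

lemma tri_perms_0:
  assumes "u \<in> trivectors" "tri u x y z = 0"
  shows "tri u x z y = 0" "tri u y x z = 0" "tri u y z x = 0" "tri u z x y = 0" "tri u z y x = 0"
proof -
  have swap: "tri u x z y = 0" "tri u y x z = 0" if "tri u x y z = 0" for x y z
    using that tri_swap[OF assms(1), where x = x and y = y and z = z] by simp_all
  note s1 = swap(1)[OF assms(2)] and s2 = swap(2)[OF assms(2)]
  show "tri u x z y = 0" "tri u y x z = 0" "tri u y z x = 0" "tri u z x y = 0" "tri u z y x = 0"
    by (rule s1 s2 swap(1)[OF s2] swap(2)[OF s1] swap(1)[OF swap(2)[OF s1]])+
qed

section \<open>The contraction at a point and its kernel\<close>

definition contract :: "('n::finite \<times> 'n \<times> 'n \<Rightarrow> 'a::comm_ring_1) \<Rightarrow> ('n \<Rightarrow> 'a) \<Rightarrow> 'n \<Rightarrow> 'n \<Rightarrow> 'a" where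
  "contract u x a b = (\<Sum>c\<in>UNIV. u (a, b, c) * x c)"

lemma tri_contract: "tri u y z x = (\<Sum>p\<in>UNIV. y p * (\<Sum>q\<in>UNIV. z q * contract u x p q))"
  by (simp add: tri_def contract_def sum_distrib_left mult_ac)

lemma alt_contract:
  assumes "u \<in> trivectors"
  shows "alt_mat (contract u x)"
  unfolding alt_mat_def
proof (intro conjI allI)
  show "contract u x a a = 0" for a by (simp add: contract_def trivectorsD(1)[OF assms])
  show "contract u x b a = - contract u x a b" for a b
    unfolding contract_def sum_negf[symmetric]
    by (intro sum.cong refl, subst trivectorsD(4)[OF assms]) simp
qed

lemma contract_kernel: 
  assumes "u \<in> trivectors"
  shows "(\<Sum>q\<in>UNIV. contract u x p q * x q) = 0"
proof -
  have "(\<Sum>q\<in>UNIV. contract u x p q * x q) = tri u (unit p) x x"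
    unfolding tri_contract sum_unit by (intro sum.cong refl mult.commute)
  then show ?thesis by (simp add: tri_alt(2)[OF assms])
qed

text \<open>If the contraction had rank at most two, its kernel would have dimension at least seven, and the weights
  \<open>-2, 0, 1\<close> on the flag of \<open>x\<close> and the kernel would be destabilizing.\<close>

lemma exists_pf4_ne_0:
  fixes u :: "'n::finite \<times> 'n \<times> 'n \<Rightarrow> 'a::field"
  assumes u: "u \<in> trivectors" and st: "no_destab u" and card: "CARD('n) \<ge> 3" and x: "x c1 \<noteq> 0"
  obtains a b c d where "pf4 (contract u x) a b c d \<noteq> 0"
proof (rule ccontr)
  let ?A = "contract u x"
  assume "\<not> thesis"
  then have zero: "pf4 ?A a b c d = 0" for a b c d using that by blast
  have alt: "alt_mat ?A" by (rule alt_contract[OF u])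
  obtain a b c0 g where distinct: "a \<noteq> b" "c0 \<noteq> a" "c0 \<noteq> b" and x0: "x c0 \<noteq> 0"
    and g_ker: "\<And>c y. c \<noteq> a \<Longrightarrow> c \<noteq> b \<Longrightarrow> c \<noteq> c0 \<Longrightarrow> tri u y (g c) x = 0"
    and g_diag: "\<And>c. c \<noteq> a \<Longrightarrow> c \<noteq> b \<Longrightarrow> c \<noteq> c0 \<Longrightarrow> g c c \<noteq> 0"
    and g_off: "\<And>c q. c \<noteq> a \<Longrightarrow> c \<noteq> b \<Longrightarrow> c \<noteq> c0 \<Longrightarrow> q \<noteq> c \<Longrightarrow> q \<noteq> a \<Longrightarrow> q \<noteq> b \<Longrightarrow> g c q = 0"
  proof (cases "\<exists>a b. ?A a b \<noteq> 0")
    case True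
    then obtain a b where ab: "?A a b \<noteq> 0" by blast
    then have "a \<noteq> b" using alt_mat_self[OF alt] by metis
    \<comment> \<open>\<open>x\<close> lies in the kernel of the contraction. If it were supported
      on \<open>a\<close> and \<open>b\<close>, rows \<open>a\<close> and \<open>b\<close> with the
      nonzero entry \<open>?A a b\<close> would force it to be zero.\<close>
    have "\<exists>c0. c0 \<noteq> a \<and> c0 \<noteq> b \<and> x c0 \<noteq> 0"
    proof (rule ccontr)
      assume *: "\<not> ?thesis"
      have ker: "(\<Sum>q\<in>UNIV. ?A p q * x q) = ?A p a * x a + ?A p b * x b" for p
      proof -
        have "(\<Sum>q\<in>UNIV. ?A p q * x q) = (\<Sum>q\<in>{a, b}. ?A p q * x q)"
          by (rule sum.mono_neutral_right) (use * in auto)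
        then show ?thesis using \<open>a \<noteq> b\<close> by simp
      qed
      have "?A a b * x b = 0" "?A a b * x a = 0"
        using ker[of a] ker[of b] by (simp_all add: contract_kernel[OF u] alt_mat_self[OF alt] alt_mat_swap[OF alt, of b a])
      then show False using ab x * by (metis mult_eq_0_iff)
    qed
    then obtain c0 where c0: "c0 \<noteq> a" "c0 \<noteq> b" "x c0 \<noteq> 0" by blast
    \<comment> \<open>The analogue of \<open>nvec\<close> for a pivot of size two: its pairing with
      row \<open>p\<close> is a Pfaffian of size four.\<close>
    let ?g = "\<lambda>c q. unit c q * ?A a b + unit a q * ?A b c - unit b q * ?A a c"
    show thesis
    proof (rule that[of a b c0 ?g])
      fix c y
      have "(\<Sum>q\<in>UNIV. ?g c q * ?A p q) = 0" for p
      proof -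
        have "(\<Sum>q\<in>UNIV. ?g c q * ?A p q) = (\<Sum>q\<in>UNIV. unit c q * (?A a b * ?A p q)
            + unit a q * (?A b c * ?A p q) - unit b q * (?A a c * ?A p q))"
          by (simp add: algebra_simps)
        also have "\<dots> = pf4 ?A a b p c"
          by (simp add: sum.distrib sum_subtractf sum_unit pf4_def alt_mat_swap[OF alt, of p] algebra_simps)
        finally show ?thesis using zero by simp
      qed
      then show "tri u y (?g c) x = 0" by (simp add: tri_contract)
    qed (use c0 ab \<open>a \<noteq> b\<close> in \<open>auto simp: unit_other\<close>)
  next
    case False
    have "card (UNIV - {c1}) \<ge> 2" using card by simp
    then obtain a b where ab: "a \<noteq> b" "a \<noteq> c1" "b \<noteq> c1"
      by (metis (no_types, lifting) One_nat_def Suc_1 card_le_Suc0_iff_eq finite_Diff finite not_less_eq_eq DiffD2 singletonI)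
    show thesis
      by (rule that[of a b c1 unit]) (use ab x False in \<open>auto simp: unit_other tri_contract\<close>)
  qed
  define f where "f p = (if p = c0 then x else if p = a \<or> p = b then unit p else g p)" for p
  \<comment> \<open>Dimensions 1, 6 and 2 carry the weights -2, 0 and 1. Adding up indicators makes
    the vanishing of the total a computation.\<close>
  define w where "w p = (if p = a then 1 else 0) + (if p = b then 1 else 0) + (if p = c0 then -2 else (0::int))" for p
  define r :: "'n \<Rightarrow> nat" where "r p = (if p = c0 then 0 else if p = a \<or> p = b then 2 else 1)" for p
  have sum_w: "sum w UNIV = 0" unfolding w_def sum.distrib by simp
  have f_x: "tri u (f p) (f q) x = 0" if "\<not> ((p = a \<or> p = b) \<and> (q = a \<or> q = b))" for p q
  proof (cases "q = a \<or> q = b")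
    case False
    then show ?thesis
      by (cases "q = c0") (use g_ker tri_alt[OF u] in \<open>auto simp: f_def\<close>)
  next
    case True
    then have "\<not> (p = a \<or> p = b)" using that by blast
    then have "tri u (f q) (f p) x = 0"
      by (cases "p = c0") (use g_ker tri_alt[OF u] in \<open>auto simp: f_def\<close>)
    then show ?thesis using tri_perms_0[OF u] by blast
  qed
  obtain p q s where pqs: "tri u (f p) (f q) (f s) \<noteq> 0" "w p + w q + w s < 0"
  proof (rule no_destabD[OF st, of f r w a])
    show "f p p \<noteq> 0" for p using g_diag x0 by (simp add: f_def)
    show "r p < r q" if "p \<noteq> q" "f p q \<noteq> 0" for p q
      using that g_off[of p q] distinct by (auto simp: f_def r_def unit_def split: if_splits)
    show "w a \<noteq> 0" using distinct by (simp add: w_def)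
    show "sum w UNIV = 0" by (fact sum_w)
  qed blast
  have w_c0: "w c0 = -2" using distinct by (simp add: w_def)
  have w_1: "w p = 1" if "p = a \<or> p = b" for p using distinct that by (auto simp: w_def)
  have w_0: "w p \<ge> 0" if "p \<noteq> c0" for p using that by (simp add: w_def)
  have f_c0: "f c0 = x" by (simp add: f_def)
  have zero: "tri u (f p) (f q) x = 0" if "w p + w q + w c0 < 0" for p q
  proof (rule f_x, rule notI)
    assume "(p = a \<or> p = b) \<and> (q = a \<or> q = b)"
    then show False using that w_1[of p] w_1[of q] w_c0 by simp
  qed
  have "p = c0 \<or> q = c0 \<or> s = c0"
    using pqs(2) w_0[of p] w_0[of q] w_0[of s] by linarith
  moreover have "tri u (f p) (f q) (f s) = 0" if "s = c0"
    using zero[of p q] pqs(2) f_c0 that by simp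
  moreover have "tri u (f p) (f s) (f q) = 0" if "q = c0"
    using zero[of p s] pqs(2) f_c0 that by (simp add: algebra_simps)
  moreover have "tri u (f q) (f s) (f p) = 0" if "p = c0"
    using zero[of q s] pqs(2) f_c0 that by (simp add: algebra_simps)
  ultimately show False
    using pqs(1) tri_perms_0[OF u, of "f p" "f s" "f q"] tri_perms_0[OF u, of "f q" "f s" "f p"] by blast
qed

text \<open>A point of rank exactly four in the chart \<open>i\<close>. The pivot avoids
  \<open>i\<close> so that \<open>x\<close>, the vectors \<open>n j\<close> for the four remaining
  indices \<open>j\<close>, and the unit vectors at the pivot indices form a triangular frame; the
  first five of these span the kernel.\<close>

locale degeneracy_point =
  fixes u :: "9 \<times> 9 \<times> 9 \<Rightarrow> 'a::field" and x :: "9 \<Rightarrow> 'a" and i b1 b2 b3 b4 :: 9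
  assumes u: "u \<in> trivectors" and st: "no_destab u" and x_i: "x i \<noteq> 0"
    and b_ne: "b1 \<noteq> i" "b2 \<noteq> i" "b3 \<noteq> i" "b4 \<noteq> i"
    and pf4_ne: "pf4 (contract u x) b1 b2 b3 b4 \<noteq> 0"
    and pf6_0: "\<And>p q. pf6 (contract u x) b1 b2 b3 b4 p q = 0"
begin

abbreviation n where "n \<equiv> nvec (contract u x) b1 b2 b3 b4"

abbreviation B where "B \<equiv> {b1, b2, b3, b4}"

lemma tri_n_x: "tri u y (n j) x = 0"
  unfolding tri_contract mult_nvec[OF alt_contract[OF u]] by (simp add: pf6_0)

lemma tri_x_n: "tri u x (n j) y = 0" "tri u (n j) x y = 0"
  using tri_perms_0[OF u tri_n_x[of y j]] by auto

lemma n_off: "q \<noteq> j \<Longrightarrow> q \<notin> B \<Longrightarrow> n j q = 0"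
  by (simp add: nvec_def unit_other)

lemma n_diag: "j \<notin> B \<Longrightarrow> n j j \<noteq> 0"
  using pf4_ne by (simp add: nvec_def unit_other)

text \<open>The coefficients describe a bivector on the kernel modulo \<open>x\<close>, in the basis
  of the products of \<open>n j1\<close>, ..., \<open>n j4\<close>, whose contraction with
  \<open>u\<close> vanishes.\<close>

definition relation where
  "relation j1 j2 j3 j4 l12 l13 l14 l23 l24 l34 \<longleftrightarrow>
     distinct [i, j1, j2, j3, j4] \<and> {j1, j2, j3, j4} \<inter> B = {} \<and>
     (\<forall>v. l12 * tri u (n j1) (n j2) v + l13 * tri u (n j1) (n j3) v + l14 * tri u (n j1) (n j4) v
       + l23 * tri u (n j2) (n j3) v + l24 * tri u (n j2) (n j4) v + l34 * tri u (n j3) (n j4) v = 0)"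

text \<open>A relation of rank four annihilates the third exterior power of the kernel modulo \<open>x\<close>, which makes
  the weights \<open>-4, -1, 2\<close> on the flag of \<open>x\<close> and the kernel destabilizing.\<close>

lemma relation_pf_eq_0:
  assumes rel: "relation j1 j2 j3 j4 l12 l13 l14 l23 l24 l34"
  shows "l12 * l34 - l13 * l24 + l14 * l23 = 0"
proof (rule ccontr)
  let ?pf = "l12 * l34 - l13 * l24 + l14 * l23"
  assume pf: "?pf \<noteq> 0"
  have dist: "distinct [i, j1, j2, j3, j4]" and disj: "{j1, j2, j3, j4} \<inter> B = {}"
    using rel by (auto simp: relation_def)
  have eq: "l12 * tri u (n j1) (n j2) v + l13 * tri u (n j1) (n j3) v + l14 * tri u (n j1) (n j4) v
       + l23 * tri u (n j2) (n j3) v + l24 * tri u (n j2) (n j4) v + l34 * tri u (n j3) (n j4) v = 0" for v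
    using rel by (auto simp: relation_def)
  define t1 t2 t3 t4 where t: "t1 = tri u (n j2) (n j3) (n j4)" "t2 = tri u (n j1) (n j3) (n j4)"
    "t3 = tri u (n j1) (n j2) (n j4)" "t4 = tri u (n j1) (n j2) (n j3)"
  note alt = tri_alt[OF u] and sw = tri_swap[OF u]
  have cyc: "tri u y z v = tri u v y z" for y z v
    using sw(2)[of y z v] sw(1)[of y v z] by simp
  have e1: "l23 * t4 + l24 * t3 + l34 * t2 = 0"
    using eq[of "n j1"] cyc[of "n j2" "n j3" "n j1"] cyc[of "n j2" "n j4" "n j1"] cyc[of "n j3" "n j4" "n j1"]
    by (simp add: alt t)
  have e2: "- l13 * t4 - l14 * t3 + l34 * t1 = 0"
    using eq[of "n j2"] sw(2)[of "n j1" "n j3" "n j2"] sw(2)[of "n j1" "n j4" "n j2"] cyc[of "n j3" "n j4" "n j2"]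
    by (simp add: alt t)
  have e3: "l12 * t4 - l14 * t2 - l24 * t1 = 0"
    using eq[of "n j3"] sw(2)[of "n j1" "n j4" "n j3"] sw(2)[of "n j2" "n j4" "n j3"]
    by (simp add: alt t)
  have e4: "l12 * t3 + l13 * t2 + l23 * t1 = 0"
    using eq[of "n j4"] by (simp add: alt t)
  \<comment> \<open>Up to signs of rows, \<open>e1\<close> to \<open>e4\<close> say that an
    alternating 4 by 4 matrix with Pfaffian \<open>?pf\<close> kills the vector of the four values.
    This and the next three combinations are the rows of its Pfaffian adjoint.\<close>
  have "?pf * t4 = l14 * (l23 * t4 + l24 * t3 + l34 * t2) + l24 * (- l13 * t4 - l14 * t3 + l34 * t1)
      + l34 * (l12 * t4 - l14 * t2 - l24 * t1)"
    by (simp add: algebra_simps)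
  then have 4: "t4 = 0" using pf unfolding e1 e2 e3 by simp
  have "?pf * t3 = - l13 * (l23 * t4 + l24 * t3 + l34 * t2) - l23 * (- l13 * t4 - l14 * t3 + l34 * t1)
      + l34 * (l12 * t3 + l13 * t2 + l23 * t1)"
    by (simp add: algebra_simps)
  then have 3: "t3 = 0" using pf unfolding e1 e2 e4 by simp
  have "?pf * t2 = l12 * (l23 * t4 + l24 * t3 + l34 * t2) - l23 * (l12 * t4 - l14 * t2 - l24 * t1)
      - l24 * (l12 * t3 + l13 * t2 + l23 * t1)"
    by (simp add: algebra_simps)
  then have 2: "t2 = 0" using pf unfolding e1 e3 e4 by simp
  have "?pf * t1 = l12 * (- l13 * t4 - l14 * t3 + l34 * t1) + l13 * (l12 * t4 - l14 * t2 - l24 * t1)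
      + l14 * (l12 * t3 + l13 * t2 + l23 * t1)"
    by (simp add: algebra_simps)
  then have 1: "t1 = 0" using pf unfolding e2 e3 e4 by simp
  have nnn: "tri u (n p) (n q) (n s) = 0" if "p \<in> {j1, j2, j3, j4}" "q \<in> {j1, j2, j3, j4}" "s \<in> {j1, j2, j3, j4}" for p q s
    using that 1 2 3 4 tri_perms_0[OF u 1[unfolded t]] tri_perms_0[OF u 2[unfolded t]]
      tri_perms_0[OF u 3[unfolded t]] tri_perms_0[OF u 4[unfolded t]]
    unfolding t by (elim insertE emptyE) (simp_all add: alt)
  define f where "f p = (if p = i then x else if p \<in> {j1, j2, j3, j4} then n p else unit p)" for p
  define r :: "9 \<Rightarrow> nat" where "r p = (if p = i then 0 else if p \<in> {j1, j2, j3, j4} then 1 else 2)" for p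
  \<comment> \<open>Dimensions 1, 4 and 4 carry -4, -1 and 2. A negative sum means that
    \<open>x\<close> meets a kernel vector, or that all three vectors are among the
    \<open>n j\<close>; the form vanishes in both cases.\<close>
  define w :: "9 \<Rightarrow> int" where "w p = 2 + (if p = i then -6 else 0) + (if p = j1 then -3 else 0)
    + (if p = j2 then -3 else 0) + (if p = j3 then -3 else 0) + (if p = j4 then -3 else 0)" for p
  have w_i: "w i = -4" using dist by (simp add: w_def)
  have w_j: "w p = -1" if "p \<in> {j1, j2, j3, j4}" for p using dist that by (auto simp: w_def)
  have w_b: "w p = 2" if "p \<noteq> i" "p \<notin> {j1, j2, j3, j4}" for p using that by (auto simp: w_def)
  have f_i: "f i = x" by (simp add: f_def)
  have f_j: "f p = n p" if "p \<in> {j1, j2, j3, j4}" for p using dist that by (auto simp: f_def)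
  obtain p q s where pqs: "tri u (f p) (f q) (f s) \<noteq> 0" "w p + w q + w s < 0"
  proof (rule no_destabD[OF st, of f r w i])
    show "f p p \<noteq> 0" for p using x_i n_diag[of p] disj by (auto simp: f_def)
    show "r p < r q" if "p \<noteq> q" "f p q \<noteq> 0" for p q
    proof -
      have "q \<in> B" if "p \<in> {j1, j2, j3, j4}" "n p q \<noteq> 0" using that n_off[of q p] \<open>p \<noteq> q\<close> by blast
      moreover have "r q = 2" if "q \<in> B" using that b_ne disj by (auto simp: r_def)
      ultimately show ?thesis using that by (auto simp: f_def r_def unit_def split: if_splits)
    qed
    show "sum w UNIV = 0" unfolding w_def sum.distrib by simp
    show "w i \<noteq> 0" by (simp add: w_i)
  qed blast
  have nx: "tri u (f p) (f q) x = 0" if "q = i \<or> q \<in> {j1, j2, j3, j4}" for p q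
  proof (cases "q = i")
    case False
    then show ?thesis using that f_j[of q] tri_n_x by simp
  qed (simp add: f_i alt)
  have bad: False if ne: "tri u (f p) (f q) (f i) \<noteq> 0" and neg: "w p + w q + w i < 0" for p q
  proof -
    have "\<not> (q = i \<or> q \<in> {j1, j2, j3, j4})" using ne nx[of q p] f_i by auto
    moreover have "\<not> (p = i \<or> p \<in> {j1, j2, j3, j4})"
      using ne tri_perms_0(2)[OF u nx[of p q]] f_i by auto
    ultimately show False using neg w_b[of p] w_b[of q] w_i by simp
  qed
  have "s \<noteq> i" using bad[of p q] pqs by blast
  moreover have "q \<noteq> i"
  proof
    assume q: "q = i"
    then have "tri u (f p) (f s) (f i) = 0" using bad[of p s] pqs(2) by (auto simp: add_ac)
    from tri_perms_0(1)[OF u this] show False using pqs(1) q by simp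
  qed
  moreover have "p \<noteq> i"
  proof
    assume p: "p = i"
    then have "tri u (f q) (f s) (f i) = 0" using bad[of q s] pqs(2) by (auto simp: add_ac)
    from tri_perms_0(4)[OF u this] show False using pqs(1) p by simp
  qed
  moreover have w_ge: "w a \<ge> -1" if "a \<noteq> i" for a
    using w_b[of a] w_j[of a] that by (cases "a \<in> {j1, j2, j3, j4}") auto
  ultimately have J: "p \<in> {j1, j2, j3, j4}" "q \<in> {j1, j2, j3, j4}" "s \<in> {j1, j2, j3, j4}"
    using pqs(2) w_b[of p] w_b[of q] w_b[of s] w_ge[of p] w_ge[of q] w_ge[of s] by (smt (verit))+
  then show False using pqs(1) nnn[OF J] f_j by simp
qed

text \<open>A relation of rank two gives a three-dimensional subspace on which \<open>u\<close> vanishes twice, and the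
  weights \<open>-2, 1\<close> are destabilizing.\<close>

lemma relation_first_eq_0:
  assumes rel: "relation j1 j2 j3 j4 l12 l13 l14 l23 l24 l34"
  shows "l12 = 0"
proof (rule ccontr)
  assume l12: "l12 \<noteq> 0"
  have dist: "distinct [i, j1, j2, j3, j4]" and disj: "{j1, j2, j3, j4} \<inter> B = {}"
    using rel by (auto simp: relation_def)
  have eq: "l12 * tri u (n j1) (n j2) v + l13 * tri u (n j1) (n j3) v + l14 * tri u (n j1) (n j4) v
       + l23 * tri u (n j2) (n j3) v + l24 * tri u (n j2) (n j4) v + l34 * tri u (n j3) (n j4) v = 0" for v
    using rel by (auto simp: relation_def)
  note alt = tri_alt[OF u] and sw = tri_swap[OF u]
  \<comment> \<open>The contractions of the bivector with the first two coordinates. As its Pfaffian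
    is zero, it is decomposable, and the product of \<open>r1\<close> and \<open>r2\<close> is
    \<open>l12\<close> times it.\<close>
  define r1 where "r1 = (\<lambda>q. l12 * n j2 q + l13 * n j3 q + l14 * n j4 q)"
  define r2 where "r2 = (\<lambda>q. - l12 * n j1 q + l23 * n j3 q + l24 * n j4 q)"
  have pf: "l13 * l24 = l12 * l34 + l14 * l23"
    using relation_pf_eq_0[OF rel] by (simp add: algebra_simps)
  have r12: "tri u r1 r2 v = 0" for v
  proof -
    have "tri u r1 r2 v = l12 * (l12 * tri u (n j1) (n j2) v + l13 * tri u (n j1) (n j3) v
       + l14 * tri u (n j1) (n j4) v + l23 * tri u (n j2) (n j3) v + l24 * tri u (n j2) (n j4) v)
       + (l13 * l24 - l14 * l23) * tri u (n j3) (n j4) v"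
      unfolding r1_def r2_def tri_add tri_scale
      by (simp add: alt sw(1)[of "n j2" "n j1"] sw(1)[of "n j3" "n j1"] sw(1)[of "n j4" "n j1"]
          sw(1)[of "n j4" "n j3"] algebra_simps)
    then have "tri u r1 r2 v = l12 * (l12 * tri u (n j1) (n j2) v + l13 * tri u (n j1) (n j3) v
       + l14 * tri u (n j1) (n j4) v + l23 * tri u (n j2) (n j3) v + l24 * tri u (n j2) (n j4) v
       + l34 * tri u (n j3) (n j4) v)"
      by (simp add: pf distrib_left mult.assoc)
    then show ?thesis by (simp add: eq)
  qed
  have x_r: "tri u x r1 v = 0" "tri u x r2 v = 0" for v
    unfolding r1_def r2_def tri_add tri_scale tri_x_n by simp_all
  \<comment> \<open>The slots are crossed because the coordinate of \<open>r1\<close> that is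
    visibly nonzero is \<open>j2\<close>, and that of \<open>r2\<close> is
    \<open>j1\<close>.\<close>
  define f where "f p = (if p = i then x else if p = j1 then r2 else if p = j2 then r1
    else if p = j3 \<or> p = j4 then n p else unit p)" for p
  define r :: "9 \<Rightarrow> nat" where "r p = (if p = i then 0 else if p = j1 \<or> p = j2 then 1
    else if p = j3 \<or> p = j4 then 2 else 3)" for p
  \<comment> \<open>Dimensions 3 and 6 carry -2 and 1, so a negative sum needs two vectors in the
    span of \<open>x\<close>, \<open>r1\<close>, \<open>r2\<close>.\<close>
  define w :: "9 \<Rightarrow> int" where "w p = 1 + (if p = i then -3 else 0) + (if p = j1 then -3 else 0)
    + (if p = j2 then -3 else 0)" for p
  have w_M: "w p = -2" if "p \<in> {i, j1, j2}" for p using dist that by (auto simp: w_def)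
  have w_not: "w p = 1" if "p \<notin> {i, j1, j2}" for p using that by (auto simp: w_def)
  have f_M: "f i = x" "f j1 = r2" "f j2 = r1" using dist by (auto simp: f_def)
  have MM: "tri u (f p) (f q) v = 0" if "p \<in> {i, j1, j2}" "q \<in> {i, j1, j2}" for p q v
    using that
    by (elim insertE emptyE) (simp_all add: f_M alt x_r r12 tri_perms_0(2)[OF u x_r(1)]
        tri_perms_0(2)[OF u x_r(2)] tri_perms_0(2)[OF u r12])
  obtain p q s where pqs: "tri u (f p) (f q) (f s) \<noteq> 0" "w p + w q + w s < 0"
  proof (rule no_destabD[OF st, of f r w i])
    have r_at: "r1 j2 = l12 * n j2 j2" "r2 j1 = - l12 * n j1 j1"
      using dist disj by (auto simp: r1_def r2_def n_off)
    show "f p p \<noteq> 0" for p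
    proof -
      have "n j1 j1 \<noteq> 0" "n j2 j2 \<noteq> 0" "n j3 j3 \<noteq> 0" "n j4 j4 \<noteq> 0" using disj by (auto intro!: n_diag)
      then show ?thesis
        using x_i l12 r_at f_M by (cases "p \<in> {i, j1, j2}") (elim insertE emptyE, simp_all, simp add: f_def)
    qed
    show "r p < r q" if "p \<noteq> q" "f p q \<noteq> 0" for p q
    proof -
      have nz: "q \<in> B \<or> q = j" if "n j q \<noteq> 0" for j using n_off[of q j] that by argo
      have rB: "r q = 3" if "q \<in> B" using that b_ne disj by (auto simp: r_def)
      consider "p = i" | "p = j1" | "p = j2" | "p = j3 \<or> p = j4" | "p \<notin> {i, j1, j2, j3, j4}" by blast
      then show ?thesis
      proof cases
        case 2
        then have "r2 q \<noteq> 0" using that f_M by simp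
        then have "n j3 q \<noteq> 0 \<or> n j4 q \<noteq> 0 \<or> n j1 q \<noteq> 0" by (auto simp: r2_def)
        then have "q \<in> B \<or> q = j3 \<or> q = j4" using nz[of j3] nz[of j4] nz[of j1] \<open>p \<noteq> q\<close> 2 by argo
        then show ?thesis using rB 2 dist by (auto simp: r_def)
      next
        case 3
        then have "r1 q \<noteq> 0" using that f_M by simp
        then have "n j3 q \<noteq> 0 \<or> n j4 q \<noteq> 0 \<or> n j2 q \<noteq> 0" by (auto simp: r1_def)
        then have "q \<in> B \<or> q = j3 \<or> q = j4" using nz[of j3] nz[of j4] nz[of j2] \<open>p \<noteq> q\<close> 3 by argo
        then show ?thesis using rB 3 dist by (auto simp: r_def)
      next
        case 4
        then have "n p q \<noteq> 0" using that dist by (auto simp: f_def)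
        then have "q \<in> B" using nz[of p] \<open>p \<noteq> q\<close> by argo
        then show ?thesis using rB 4 dist by (auto simp: r_def)
      next
        case 5
        then show ?thesis using that by (auto simp: f_def unit_def split: if_splits)
      qed (use that in \<open>auto simp: r_def\<close>)
    qed
    show "sum w UNIV = 0" unfolding w_def sum.distrib by simp
    show "w i \<noteq> 0" by (simp add: w_M)
  qed blast
  have ps: "tri u (f p) (f s) v = 0" if "p \<in> {i, j1, j2}" "s \<in> {i, j1, j2}" for v p s
    using MM[OF that] .
  have "p \<in> {i, j1, j2} \<and> q \<in> {i, j1, j2} \<or> p \<in> {i, j1, j2} \<and> s \<in> {i, j1, j2} \<or> q \<in> {i, j1, j2} \<and> s \<in> {i, j1, j2}"
    using pqs(2) w_M[of p] w_M[of q] w_M[of s] w_not[of p] w_not[of q] w_not[of s] by linarith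
  then show False
    using pqs(1) MM[of p q "f s"] tri_perms_0(1)[OF u MM[of p s "f q"]] tri_perms_0(4)[OF u MM[of q s "f p"]] by blast
qed

text \<open>Relabelling the four indices brings each coefficient to the first place; the signs come
  from bivectors whose factors get reversed.\<close>

lemma relation_eq_0:
  assumes rel: "relation j1 j2 j3 j4 l12 l13 l14 l23 l24 l34"
  shows "l12 = 0" "l13 = 0" "l14 = 0" "l23 = 0" "l24 = 0" "l34 = 0"
proof -
  note sw = tri_swap(1)[OF u]
  show 1: "l12 = 0" by (rule relation_first_eq_0[OF rel])
  have "relation j1 j3 j2 j4 l13 l12 l14 (- l23) l34 l24"
    using rel unfolding relation_def by (auto simp: sw[of "n j2" "n j3"] algebra_simps)
  then show "l13 = 0" by (rule relation_first_eq_0)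
  have "relation j1 j4 j3 j2 l14 l13 l12 (- l34) (- l24) (- l23)"
    using rel unfolding relation_def
    by (auto simp: sw[of "n j2" "n j3"] sw[of "n j2" "n j4"] sw[of "n j3" "n j4"] algebra_simps)
  then show "l14 = 0" by (rule relation_first_eq_0)
  have "relation j2 j3 j1 j4 l23 (- l12) l24 (- l13) l34 l14"
    using rel unfolding relation_def
    by (auto simp: sw[of "n j1" "n j2"] sw[of "n j1" "n j3"] algebra_simps)
  then show "l23 = 0" by (rule relation_first_eq_0)
  have "relation j2 j4 j1 j3 l24 (- l12) l23 (- l14) (- l34) l13"
    using rel unfolding relation_def
    by (auto simp: sw[of "n j1" "n j2"] sw[of "n j1" "n j4"] sw[of "n j3" "n j4"] algebra_simps)
  then show "l24 = 0" by (rule relation_first_eq_0)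
  have "relation j3 j4 j1 j2 l34 (- l13) (- l23) (- l14) (- l24) l12"
    using rel unfolding relation_def
    by (auto simp: sw[of "n j1" "n j3"] sw[of "n j2" "n j3"] sw[of "n j1" "n j4"] sw[of "n j2" "n j4"] algebra_simps)
  then show "l34 = 0" by (rule relation_first_eq_0)
qed

end

section \<open>The degeneracy locus of rank two\<close>

lemma Const_add: "Const (a + b) = Const a + Const b"
  and Const_mult: "Const (a * b :: 'a::comm_ring_1) = Const a * (Const b :: ('v, 'a) mpoly)"
  and Const_0 [simp]: "Const 0 = 0"
  and Const_1 [simp]: "Const 1 = 1"
  by (simp_all add: Const_def single_add mult_single)

lemma coeff_hom_Const: "coeff_hom Const"
  by unfold_locales (simp_all add: Const_add Const_mult)

text \<open>\<open>Phi u\<close> is the contraction at the generic point \<open>Var\<close>, with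
  coefficients in the polynomial ring, so the facts about \<open>contract\<close> apply
  verbatim.\<close>

lemma Phi_tri:
  assumes "u \<in> trivectors"
  shows "alt_mat (Phi u)" "(\<Sum>q\<in>UNIV. Phi u p q * Var q) = 0"
proof -
  have C: "(\<lambda>t. Const (u t)) \<in> trivectors"
    by (rule comp_trivectors[OF coeff_hom_Const assms])
  have Phi: "Phi u = contract (\<lambda>t. Const (u t)) Var"
    by (intro ext) (simp add: Phi_def contract_def)
  show "alt_mat (Phi u)" unfolding Phi by (rule alt_contract[OF C])
  show "(\<Sum>q\<in>UNIV. Phi u p q * Var q) = 0" unfolding Phi by (rule contract_kernel[OF C])
qed

lemma ev_Phi:
  assumes "coeff_hom \<phi>"
  shows "ev \<phi> x (Phi u p q) = contract (\<lambda>t. \<phi> (u t)) x p q"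
proof -
  interpret coeff_hom \<phi> by fact
  show ?thesis by (simp add: Phi_def contract_def ev_sum)
qed

lemma deriv_Phi: "mpoly_deriv v (Phi u p q) = Const (u (p, q, v))"
proof -
  have "mpoly_deriv v (Phi u p q) = (\<Sum>c\<in>UNIV. unit v c * Const (u (p, q, c)))"
    unfolding Phi_def deriv_sum
    by (rule sum.cong) (auto simp: deriv_mult deriv_Var unit_def)
  then show ?thesis by (simp add: sum_unit)
qed

lemma pf4_swaps:
  assumes "alt_mat A"
  shows "pf4 A b a c d = - pf4 A a b c d" "pf4 A c a b d = pf4 A a b c d" "pf4 A d a b c = - pf4 A a b c d"
  by (simp_all add: pf4_def alt_mat_swap[OF assms, of b a] alt_mat_swap[OF assms, of c a] alt_mat_swap[OF assms, of d a]
      alt_mat_swap[OF assms, of c b] alt_mat_swap[OF assms, of d b] alt_mat_swap[OF assms, of d c] algebra_simps)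

lemma pf4_repeat:
  assumes "alt_mat A" "\<not> distinct [a, b, c, d]"
  shows "pf4 A a b c d = 0"
  using assms(2)
  by (auto simp: pf4_def alt_mat_self[OF assms(1)] alt_mat_swap[OF assms(1), of b a] alt_mat_swap[OF assms(1), of c b]
      alt_mat_swap[OF assms(1), of c a] alt_mat_swap[OF assms(1), of d b] alt_mat_swap[OF assms(1), of d c])

lemma chart_points_prime_id:
  assumes "P \<in> chart_points F i"
  shows "prime_id P" "Var i - 1 \<in> P" "F \<subseteq> P" "chart_ideal F i \<subseteq> P" "Var i \<notin> P"
proof -
  interpret cring "mpoly_ring :: ('a, 'b) mpoly ring" by (rule cring_from_type_algebra)
  show P: "prime_id P" and "chart_ideal F i \<subseteq> P"
    using assms primeideal_prime_id by (auto simp: chart_points_def)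
  moreover have "insert (Var i - 1) F \<subseteq> chart_ideal F i"
    unfolding chart_ideal_def by (rule genideal_self) (simp add: ring_of_type_algebra_def)
  ultimately show 1: "Var i - 1 \<in> P" and "F \<subseteq> P" by auto
  show "Var i \<notin> P" using prime_id_diff[OF P _ 1, of "Var i"] prime_id_1[OF P] by auto
qed

lemma exists_pf4_notin:
  fixes u :: "'n::finite \<times> 'n \<times> 'n \<Rightarrow> 'k::field"
  assumes u: "u \<in> trivectors" and st: "no_destab (\<lambda>t. to_ac (u t))" and card: "CARD('n) \<ge> 3"
    and P: "prime_id P" "Var i - 1 \<in> P"
  obtains a b c d where "pf4 (Phi u) a b c d \<notin> P"
proof (rule ccontr)
  assume "\<not> thesis"
  then have in_P: "pf4 (Phi u) a b c d \<in> P" for a b c d using that by blast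
  interpret coeff_hom "to_ac :: 'k \<Rightarrow> 'k alg_closure" by (rule coeff_hom_to_ac)
  obtain x where x: "\<And>f. f \<in> P \<Longrightarrow> ev to_ac x f = 0"
    using Nullstellensatz[OF coeff_hom_to_ac P(1) prime_id_1[OF P(1)]] by blast
  have "x i \<noteq> 0" using x[OF P(2)] by auto
  then obtain a b c d where "pf4 (contract (\<lambda>t. to_ac (u t)) x) a b c d \<noteq> 0"
    using exists_pf4_ne_0[OF comp_trivectors[OF coeff_hom_to_ac u] st card] by blast
  moreover have "ev to_ac x (pf4 (Phi u) a b c d) = pf4 (contract (\<lambda>t. to_ac (u t)) x) a b c d"
    unfolding coeff_hom.hom_pf4[OF coeff_hom_ev] ev_Phi[OF coeff_hom_to_ac] by simp
  ultimately show False using x[OF in_P] by simp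
qed

text \<open>A row of the Pfaffian adjoint of the 4 by 4 block isolates one coefficient of a
  relation, multiplied by the Pfaffian, which is invertible at \<open>P\<close>. The other
  coefficients follow by permuting the indices.\<close>

lemma indep_pf4:
  assumes A: "alt_mat A" and P: "prime_id P" and pf: "pf4 A a b c d \<notin> P"
  shows "indep_at P {a, b, c, d} (\<lambda>j i. A i j)"
  unfolding indep_at_def
proof (intro allI impI)
  fix y assume y: "\<forall>i. (\<Sum>j\<in>{a, b, c, d}. y j * A i j) \<in> P"
  have first: "y a \<in> P" if pf: "pf4 A a b c d \<notin> P" and J: "{a, b, c, d} = J"
    and y: "\<And>i. (\<Sum>j\<in>J. y j * A i j) \<in> P" for a b c d J
  proof -
    have dist: "distinct [a, b, c, d]" using pf pf4_repeat[OF A] prime_id_0[OF P] by metis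
    have "(\<Sum>j\<in>{a, b, c, d}. y j * A i j) = y a * A i a + y b * A i b + y c * A i c + y d * A i d" for i
      using dist by (simp add: algebra_simps)
    then have y': "y a * A i a + y b * A i b + y c * A i c + y d * A i d \<in> P" for i
      using y[of i] J by simp
    have "y a * pf4 A a b c d = - (A c d * (y a * A b a + y b * A b b + y c * A b c + y d * A b d)
        - A b d * (y a * A c a + y b * A c b + y c * A c c + y d * A c d)
        + A b c * (y a * A d a + y b * A d b + y c * A d c + y d * A d d))"
      by (simp add: pf4_def alt_mat_self[OF A] alt_mat_swap[OF A, of b a] alt_mat_swap[OF A, of c a]
          alt_mat_swap[OF A, of d a] alt_mat_swap[OF A, of c b] alt_mat_swap[OF A, of d b]
          alt_mat_swap[OF A, of d c] algebra_simps)
    also have "\<dots> \<in> P"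
      by (intro prime_id_uminus[OF P] prime_id_add[OF P] prime_id_diff[OF P] prime_id_multL[OF P] y')
    finally show ?thesis using pf by (simp add: prime_id_mult_iff[OF P])
  qed
  have y_J: "(\<Sum>j\<in>{a, b, c, d}. y j * A i j) \<in> P" for i using y by blast
  have "pf4 A b a c d \<notin> P" "pf4 A c a b d \<notin> P" "pf4 A d a b c \<notin> P"
    unfolding pf4_swaps(1)[OF A, of b a c d] pf4_swaps(2)[OF A, of c a b d] pf4_swaps(3)[OF A, of d a b c]
    using pf by (simp_all add: prime_id_uminus_iff[OF P])
  then have "y a \<in> P" "y b \<in> P" "y c \<in> P" "y d \<in> P"
    using pf by (auto intro!: first[OF _ _ y_J])
  then show "\<forall>j\<in>{a, b, c, d}. y j \<in> P" by blast
qed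

lemma card_le_rank_at:
  fixes A :: "'n::finite \<Rightarrow> 'n \<Rightarrow> ('v, 'a::comm_ring_1) mpoly"
  assumes "indep_at P J (\<lambda>j i. A i j)"
  shows "card J \<le> rank_at P A"
  unfolding rank_at_def
proof (rule Max_ge)
  have "{card J |J. indep_at P J (\<lambda>j i. A i j)} \<subseteq> range (card :: 'n set \<Rightarrow> nat)" by auto
  then show "finite {card J |J. indep_at P J (\<lambda>j i. A i j)}" by (rule finite_subset) simp
qed (use assms in blast)

lemma rank_locus_2_empty:
  fixes u :: "'n::finite \<times> 'n \<times> 'n \<Rightarrow> 'k::field"
  assumes u: "u \<in> trivectors" and st: "no_destab (\<lambda>t. to_ac (u t))" and card: "CARD('n) \<ge> 3"
  shows "rank_locus u 2 i = {}"
proof (rule ccontr)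
  assume "\<not> ?thesis"
  then obtain P where P: "P \<in> chart_points {} i" "rank_at P (Phi u) \<le> 2" by (auto simp: rank_locus_def)
  note prime = chart_points_prime_id[OF P(1)]
  obtain a b c d where pf: "pf4 (Phi u) a b c d \<notin> P"
    using exists_pf4_notin[OF u st card prime(1,2)] by blast
  have "distinct [a, b, c, d]"
    using pf pf4_repeat[OF Phi_tri(1)[OF u]] prime_id_0[OF prime(1)] by metis
  then have "card {a, b, c, d} = 4" by simp
  then show False
    using card_le_rank_at[OF indep_pf4[OF Phi_tri(1)[OF u] prime(1) pf]] P(2) by simp
qed

section \<open>Smoothness of the degeneracy locus of rank four\<close>

definition is_id :: "'a::comm_ring_1 set \<Rightarrow> bool" where
  "is_id J \<longleftrightarrow> 0 \<in> J \<and> (\<forall>a\<in>J. \<forall>b\<in>J. a + b \<in> J) \<and> (\<forall>a. \<forall>b\<in>J. a * b \<in> J)"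

lemma is_idD:
  assumes "is_id J"
  shows "0 \<in> J" "a \<in> J \<Longrightarrow> b \<in> J \<Longrightarrow> a + b \<in> J" "b \<in> J \<Longrightarrow> a * b \<in> J" "b \<in> J \<Longrightarrow> b * a \<in> J"
    "b \<in> J \<Longrightarrow> - b \<in> J" "a \<in> J \<Longrightarrow> b \<in> J \<Longrightarrow> a - b \<in> J"
proof -
  show "0 \<in> J" and add: "a \<in> J \<Longrightarrow> b \<in> J \<Longrightarrow> a + b \<in> J" and mult: "b \<in> J \<Longrightarrow> a * b \<in> J" for a b
    using assms by (auto simp: is_id_def)
  show "b \<in> J \<Longrightarrow> b * a \<in> J" using mult[of b a] by (simp add: mult.commute)
  show neg: "b \<in> J \<Longrightarrow> - b \<in> J" for b using mult[of b "-1"] by simp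
  show "a \<in> J \<Longrightarrow> b \<in> J \<Longrightarrow> a - b \<in> J" using add[of a "- b"] neg[of b] by simp
qed

lemma is_id_sum: "is_id J \<Longrightarrow> (\<And>i. i \<in> S \<Longrightarrow> f i \<in> J) \<Longrightarrow> sum f S \<in> J"
  by (induction S rule: infinite_finite_induct) (auto intro: is_idD)

lemma ideal_is_id:
  assumes "ideal J (ring_of_type_algebra :: 'a::comm_ring_1 ring)"
  shows "is_id J"
proof -
  interpret ideal J "ring_of_type_algebra :: 'a ring" by fact
  show ?thesis
    unfolding is_id_def
    using I_l_closed additive_subgroup.zero_closed[OF is_additive_subgroup]
      additive_subgroup.a_closed[OF is_additive_subgroup]
    by (auto simp: ring_of_type_algebra_def)
qed

lemma is_id_ideal:
  assumes "is_id J"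
  shows "ideal J (ring_of_type_algebra :: 'a::comm_ring_1 ring)"
proof (rule idealI)
  let ?R = "ring_of_type_algebra :: 'a ring"
  show "ring ?R" by (rule ring_from_type_algebra)
  interpret cring ?R by (rule cring_from_type_algebra)
  have inv: "\<ominus>\<^bsub>?R\<^esub> a = - a" for a
  proof -
    have "a \<oplus>\<^bsub>?R\<^esub> (- a) = \<zero>\<^bsub>?R\<^esub>" by (simp add: ring_of_type_algebra_def)
    then show ?thesis
      by (metis UNIV_I add.inv_equality add.m_comm partial_object.select_convs(1) ring_of_type_algebra_def)
  qed
  show "subgroup J (add_monoid ?R)"
  proof (rule group.subgroupI[OF add.group_axioms])
    show "inv\<^bsub>add_monoid ?R\<^esub> a \<in> J" if "a \<in> J" for a
      using is_idD(5)[OF assms that] inv[of a] by (simp add: a_inv_def)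
  qed (use is_idD(1,2)[OF assms] in \<open>auto simp: ring_of_type_algebra_def\<close>)
qed (auto simp: ring_of_type_algebra_def is_idD(3,4)[OF assms])

lemma prime_id_is_id: "prime_id P \<Longrightarrow> is_id P"
  unfolding prime_id_def is_id_def by blast

lemma prime_id_primeideal:
  assumes "prime_id P"
  shows "primeideal P (ring_of_type_algebra :: 'a::comm_ring_1 ring)"
proof (rule primeidealI)
  show "ideal P ring_of_type_algebra" by (rule is_id_ideal[OF prime_id_is_id[OF assms]])
  show "cring (ring_of_type_algebra :: 'a ring)" by (rule cring_from_type_algebra)
  show "carrier ring_of_type_algebra \<noteq> P" using prime_id_1[OF assms] by (auto simp: ring_of_type_algebra_def)
qed (auto simp: ring_of_type_algebra_def prime_id_mult_iff[OF assms])

lemma Idl_is_id: "is_id (Idl\<^bsub>ring_of_type_algebra\<^esub> S)"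
  and Idl_superset: "S \<subseteq> Idl\<^bsub>ring_of_type_algebra\<^esub> S"
  and Idl_least: "is_id J \<Longrightarrow> S \<subseteq> J \<Longrightarrow> Idl\<^bsub>ring_of_type_algebra\<^esub> S \<subseteq> J" for S :: "'a::comm_ring_1 set"
proof -
  interpret cring "ring_of_type_algebra :: 'a ring" by (rule cring_from_type_algebra)
  have "S \<subseteq> carrier ring_of_type_algebra" by (simp add: ring_of_type_algebra_def)
  then show "is_id (Idl\<^bsub>ring_of_type_algebra\<^esub> S)" "S \<subseteq> Idl\<^bsub>ring_of_type_algebra\<^esub> S"
    by (simp_all add: ideal_is_id genideal_ideal genideal_self)
  show "is_id J \<Longrightarrow> S \<subseteq> J \<Longrightarrow> Idl\<^bsub>ring_of_type_algebra\<^esub> S \<subseteq> J"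
    by (intro genideal_minimal is_id_ideal)
qed

text \<open>Rotation moves a repeated index to the first slot, where \<open>pf6_repeat\<close>
  applies.\<close>

lemma pf6_not_distinct:
  assumes A: "alt_mat A" and "\<not> distinct [a, b, c, d, e, f]"
  shows "pf6 A a b c d e f = 0"
proof -
  have first: "pf6 A a b c d e f = 0" if "a \<in> {b, c, d, e, f}" for a b c d e f
    using that by (elim insertE emptyE) (simp_all add: pf6_repeat[OF A])
  note rot = pf6_rotate[OF A]
  have "a \<in> {b, c, d, e, f} \<or> b \<in> {c, d, e, f, a} \<or> c \<in> {d, e, f, a, b} \<or> d \<in> {e, f, a, b, c} \<or> e \<in> {f, a, b, c, d}"
    using assms(2) by auto
  then show ?thesis
    using first[of a b c d e f] first[of b c d e f a] first[of c d e f a b] first[of d e f a b c] first[of e f a b c d]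
      rot[of b c d e f a] rot[of c d e f a b] rot[of d e f a b c] rot[of e f a b c d]
    by (elim disjE) simp_all
qed

text \<open>Exchanging indices one at a time reduces any Pfaffian, up to powers of the pivot, to one
  whose six indices all lie in the four-element pivot set.\<close>

lemma pf6_generated:
  assumes A: "alt_mat A" and T: "is_id T"
    and cancel: "\<And>f. pf4 A b1 b2 b3 b4 * f \<in> T \<Longrightarrow> f \<in> T"
    and base: "\<And>p q. pf6 A b1 b2 b3 b4 p q \<in> T"
  shows "pf6 A c1 c2 c3 c4 c5 c6 \<in> T"
proof -
  let ?B = "{b1, b2, b3, b4}"
  have step: "pf6 A c d1 d2 d3 d4 d5 \<in> T" if d: "\<And>b. b \<in> ?B \<Longrightarrow> pf6 A b d1 d2 d3 d4 d5 \<in> T" for c d1 d2 d3 d4 d5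
  proof (rule cancel)
    \<comment> \<open>The exchange relation for b1, ..., b4, c against d1, ..., d5: every other term
      contains a Pfaffian from \<open>base\<close> or one with \<open>c\<close> replaced by a pivot
      index.\<close>
    have "pf4 A b1 b2 b3 b4 * pf6 A c d1 d2 d3 d4 d5 =
      (pf6 A b1 b2 b3 b4 c d1 * pf4 A d2 d3 d4 d5 - pf6 A b1 b2 b3 b4 c d2 * pf4 A d1 d3 d4 d5
       + pf6 A b1 b2 b3 b4 c d3 * pf4 A d1 d2 d4 d5 - pf6 A b1 b2 b3 b4 c d4 * pf4 A d1 d2 d3 d5
       + pf6 A b1 b2 b3 b4 c d5 * pf4 A d1 d2 d3 d4)
      - (pf4 A b2 b3 b4 c * pf6 A b1 d1 d2 d3 d4 d5 - pf4 A b1 b3 b4 c * pf6 A b2 d1 d2 d3 d4 d5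
       + pf4 A b1 b2 b4 c * pf6 A b3 d1 d2 d3 d4 d5 - pf4 A b1 b2 b3 c * pf6 A b4 d1 d2 d3 d4 d5)"
      unfolding pf6_exchange[of A b2 b3 b4 c b1, symmetric] by simp
    also have "\<dots> \<in> T"
      by (intro is_idD(2,6)[OF T] is_idD(4)[OF T base] is_idD(3)[OF T d]) auto
    finally show "pf4 A b1 b2 b3 b4 * pf6 A c d1 d2 d3 d4 d5 \<in> T" .
  qed
  have rot: "pf6 A b c d e f a \<in> T" if "pf6 A a b c d e f \<in> T" for a b c d e f
    using is_idD(5)[OF T that] by (simp add: pf6_rotate[OF A, of b c d e f a])
  have 0: "pf6 A p1 p2 p3 p4 p5 p6 \<in> T" if "set [p1, p2, p3, p4, p5, p6] \<subseteq> ?B" for p1 p2 p3 p4 p5 p6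
  proof -
    have "card (set [p1, p2, p3, p4, p5, p6]) \<le> card ?B" using that by (intro card_mono) auto
    also have "\<dots> \<le> 4" by (simp add: card_insert_if)
    finally have "\<not> distinct [p1, p2, p3, p4, p5, p6]" using distinct_card by fastforce
    then show ?thesis using pf6_not_distinct[OF A] is_idD(1)[OF T] by metis
  qed
  have 1: "pf6 A p2 p3 p4 p5 p6 c1 \<in> T" if "set [p2, p3, p4, p5, p6] \<subseteq> ?B" for p2 p3 p4 p5 p6 c1
    by (rule rot, rule step, rule 0) (use that in simp)
  have 2: "pf6 A p3 p4 p5 p6 c1 c2 \<in> T" if "set [p3, p4, p5, p6] \<subseteq> ?B" for p3 p4 p5 p6 c1 c2
    by (rule rot, rule step, rule 1) (use that in simp)
  have 3: "pf6 A p4 p5 p6 c1 c2 c3 \<in> T" if "set [p4, p5, p6] \<subseteq> ?B" for p4 p5 p6 c1 c2 c3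
    by (rule rot, rule step, rule 2) (use that in simp)
  have 4: "pf6 A p5 p6 c1 c2 c3 c4 \<in> T" if "set [p5, p6] \<subseteq> ?B" for p5 p6 c1 c2 c3 c4
    by (rule rot, rule step, rule 3) (use that in simp)
  have 5: "pf6 A p6 c1 c2 c3 c4 c5 \<in> T" if "p6 \<in> ?B" for p6 c1 c2 c3 c4 c5
    by (rule rot, rule step, rule 4) (use that in simp)
  show ?thesis
    by (rule rot, rule step, rule 5)
qed

lemma sum_lessThan_7: "(\<Sum>j<7. f j) = f 0 + f 1 + f 2 + f 3 + f 4 + f 5 + f (6 :: nat)"
  by (simp add: eval_nat_numeral)

text \<open>In the product rule for \<open>nvec_mult_nvec\<close>, the terms differentiating one of
  the two vectors vanish because the other lies in the kernel at \<open>x\<close>; only the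
  derivative of \<open>Phi u\<close> is left, and that is \<open>u\<close>. On the other side the
  derivative of the pivot is multiplied by zero.\<close>

lemma deriv_pf6:
  fixes u :: "'n::finite \<times> 'n \<times> 'n \<Rightarrow> 'k::field"
  assumes \<phi>: "coeff_hom \<phi>" and u: "u \<in> trivectors"
    and zero: "\<And>p q. ev \<phi> x (pf6 (Phi u) b1 b2 b3 b4 p q) = 0"
  defines "n \<equiv> nvec (contract (\<lambda>t. \<phi> (u t)) x) b1 b2 b3 b4"
  shows "ev \<phi> x (pf4 (Phi u) b1 b2 b3 b4) * ev \<phi> x (mpoly_deriv v (pf6 (Phi u) b1 b2 b3 b4 j l)) =
     tri (\<lambda>t. \<phi> (u t)) (n j) (n l) (unit v)"
proof -
  interpret coeff_hom \<phi> by fact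
  let ?A = "Phi u" and ?e = "ev \<phi> x" and ?D = "mpoly_deriv v"
  let ?n = "nvec ?A b1 b2 b3 b4"
  note alt = Phi_tri(1)[OF u]
  have ev_n: "?e (?n j q) = n j q" for j q
    by (simp add: n_def nvec_def coeff_hom.hom_pf4[OF coeff_hom_ev] ev_Phi[OF \<phi>] unit_def)
  have ker: "(\<Sum>q\<in>UNIV. n j q * ?e (?A p q)) = 0" for j p
    using zero[of p j] unfolding mult_nvec[OF alt, of b1 b2 b3 b4 j p, symmetric]
    by (simp add: ev_sum ev_n)
  have ker': "(\<Sum>p\<in>UNIV. n j p * ?e (?A p q)) = 0" for j q
    using ker[of j q] by (simp add: alt_mat_swap[OF alt, of q] sum_negf)
  have "?e (?D (\<Sum>p\<in>UNIV. ?n j p * (\<Sum>q\<in>UNIV. ?n l q * ?A p q))) =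
      (\<Sum>p\<in>UNIV. ?e (?D (?n j p)) * (\<Sum>q\<in>UNIV. n l q * ?e (?A p q)))
      + (\<Sum>p\<in>UNIV. n j p * (\<Sum>q\<in>UNIV. ?e (?D (?n l q)) * ?e (?A p q)))
      + (\<Sum>p\<in>UNIV. n j p * (\<Sum>q\<in>UNIV. n l q * \<phi> (u (p, q, v))))"
    by (simp add: deriv_sum deriv_mult ev_sum ev_n deriv_Phi sum.distrib algebra_simps)
  also have "(\<Sum>p\<in>UNIV. n j p * (\<Sum>q\<in>UNIV. ?e (?D (?n l q)) * ?e (?A p q))) =
      (\<Sum>q\<in>UNIV. ?e (?D (?n l q)) * (\<Sum>p\<in>UNIV. n j p * ?e (?A p q)))"
    unfolding sum_distrib_left by (subst sum.swap) (simp add: mult_ac)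
  also have "(\<Sum>p\<in>UNIV. n j p * (\<Sum>q\<in>UNIV. n l q * \<phi> (u (p, q, v)))) =
      tri (\<lambda>t. \<phi> (u t)) (n j) (n l) (unit v)"
    by (simp add: tri_contract contract_def sum_unit mult.commute[of _ "unit v _"])
  finally show ?thesis
    unfolding nvec_mult_nvec[OF alt] by (simp add: ker ker' deriv_mult zero)
qed

text \<open>By \<open>sum_pf4_kernel\<close>, \<open>Var i\<close> times a Pfaffian with first index
  \<open>i\<close> is a combination of Pfaffians whose first index is different, and
  \<open>Var i\<close> is outside \<open>P\<close>.\<close>

lemma exists_pivot_avoiding:
  fixes u :: "'n::finite \<times> 'n \<times> 'n \<Rightarrow> 'k::field"
  assumes u: "u \<in> trivectors" and P: "prime_id P" "Var i \<notin> P" and pf: "pf4 (Phi u) a b c d \<notin> P"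
  obtains b1 b2 b3 b4 where "distinct [i, b1, b2, b3, b4]" "pf4 (Phi u) b1 b2 b3 b4 \<notin> P"
proof -
  note alt = Phi_tri(1)[OF u] and result = that
  have dist: "distinct [a, b, c, d]" if "pf4 (Phi u) a b c d \<notin> P" for a b c d
    using that pf4_repeat[OF alt] prime_id_0[OF P(1)] by metis
  have first: thesis if pf: "pf4 (Phi u) i b c d \<notin> P" for b c d
  proof -
    have "\<exists>e. e \<noteq> i \<and> pf4 (Phi u) e b c d \<notin> P"
    proof (rule ccontr)
      assume "\<not> ?thesis"
      then have rest: "(\<Sum>e\<in>UNIV - {i}. Var e * pf4 (Phi u) e b c d) \<in> P"
        by (intro prime_id_sum[OF P(1)] prime_id_multL[OF P(1)]) auto
      have "(\<Sum>e\<in>UNIV. Phi u e p * Var e) = 0" for p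
        using Phi_tri(2)[OF u, of p] by (simp add: alt_mat_swap[OF alt, of _ p] sum_negf)
      then have "(\<Sum>e\<in>UNIV. Var e * pf4 (Phi u) e b c d) = 0" by (rule sum_pf4_kernel)
      then have "Var i * pf4 (Phi u) i b c d = - (\<Sum>e\<in>UNIV - {i}. Var e * pf4 (Phi u) e b c d)"
        by (simp add: sum.remove[of UNIV i] eq_neg_iff_add_eq_0)
      then have "Var i * pf4 (Phi u) i b c d \<in> P" using prime_id_uminus[OF P(1) rest] by simp
      then show False using P(2) pf by (simp add: prime_id_mult_iff[OF P(1)])
    qed
    then obtain e where e: "e \<noteq> i" "pf4 (Phi u) e b c d \<notin> P" by blast
    show thesis by (rule result[OF _ e(2)]) (use dist[OF pf] dist[OF e(2)] e(1) in auto)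
  qed
  have swapped: "pf4 (Phi u) b a c d \<notin> P" "pf4 (Phi u) c a b d \<notin> P" "pf4 (Phi u) d a b c \<notin> P"
    unfolding pf4_swaps(1)[OF alt, of b a c d] pf4_swaps(2)[OF alt, of c a b d] pf4_swaps(3)[OF alt, of d a b c]
    using pf by (simp_all add: prime_id_uminus_iff[OF P(1)])
  consider "i = a" | "i = b" | "i = c" | "i = d" | "i \<notin> {a, b, c, d}" by blast
  then show thesis
  proof cases
    case 5
    then show thesis using that[of a b c d] dist[OF pf] pf by auto
  qed (use first pf swapped in blast)+
qed

lemma X_smooth_at:
  fixes u :: "9 \<times> 9 \<times> 9 \<Rightarrow> 'k::field"
  assumes u: "u \<in> trivectors" and st: "no_destab (\<lambda>t. to_ac (u t))"
    and P: "P \<in> chart_points (X_equations u) i"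
  shows "affine_smooth_at (chart_ideal (X_equations u) i) 2 P"
proof -
  let ?A = "Phi u"
  note prime = chart_points_prime_id[OF P] and alt = Phi_tri(1)[OF u]
  note pr = prime(1)
  interpret coeff_hom "to_ac :: 'k \<Rightarrow> 'k alg_closure" by (rule coeff_hom_to_ac)
  obtain b1 b2 b3 b4 where dist_b: "distinct [i, b1, b2, b3, b4]" and \<beta>: "pf4 ?A b1 b2 b3 b4 \<notin> P"
  proof -
    have "CARD(9) \<ge> 3" by simp
    then show ?thesis
      using exists_pf4_notin[OF u st _ pr prime(2)] exists_pivot_avoiding[OF u pr prime(5)] that by metis
  qed
  define \<beta> where "\<beta> = pf4 ?A b1 b2 b3 b4"
  let ?p = "pf6 ?A b1 b2 b3 b4"
  have "card (UNIV - {i, b1, b2, b3, b4}) = 4" using dist_b by (subst card_Diff_subset) auto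
  then obtain js where js: "set js = UNIV - {i, b1, b2, b3, b4}" "distinct js" "length js = 4"
    by (metis distinct_card finite finite_distinct_list)
  then obtain j1 j2 j3 j4 where j: "js = [j1, j2, j3, j4]"
    by (auto simp: eval_nat_numeral length_Suc_conv)
  have dist_j: "distinct [j1, j2, j3, j4]" and set_j: "{j1, j2, j3, j4} = UNIV - {i, b1, b2, b3, b4}"
    using js j by auto
  \<comment> \<open>The seven local equations: six pairs from the four indices outside
    \<open>i\<close> and the pivot, and the equation of the chart.\<close>
  define gs where "gs = [Var i - 1, ?p j1 j2, ?p j1 j3, ?p j1 j4, ?p j2 j3, ?p j2 j4, ?p j3 j4]"
  define J where "J = Idl\<^bsub>mpoly_ring\<^esub> ((!) gs ` {..<7})"
  have gs_image: "(!) gs ` {..<7} = set gs"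
    using nth_image[of 7 gs] by (simp add: gs_def lessThan_atLeast0)
  have J: "is_id J" and gs_J: "set gs \<subseteq> J"
    unfolding J_def gs_image by (rule Idl_is_id, rule Idl_superset)
  let ?I = "chart_ideal (X_equations u) i"
  have I: "is_id ?I" and gen_I: "insert (Var i - 1) (X_equations u) \<subseteq> ?I"
    unfolding chart_ideal_def by (rule Idl_is_id, rule Idl_superset)
  have p_X: "?p p q \<in> X_equations u \<or> ?p p q = 0" for p q
  proof (cases "distinct [b1, b2, b3, b4, p, q]")
    case True
    then show ?thesis
      unfolding X_equations_def mem_Collect_eq pfaffian_6[symmetric]
      by (intro disjI1 exI[of _ "[b1, b2, b3, b4, p, q]"] conjI refl) simp_all
  next
    case False
    then show ?thesis using pf6_not_distinct[OF alt] by simp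
  qed
  have p_I: "?p p q \<in> ?I" for p q using p_X[of p q] gen_I is_idD(1)[OF I] by auto
  \<comment> \<open>The polynomials that belong to the ideal of the seven equations after
    localization at \<open>P\<close>.\<close>
  define T where "T = {f. \<exists>h. h \<notin> P \<and> h * f \<in> J}"
  have T: "is_id T"
    unfolding is_id_def
  proof (intro conjI ballI allI)
    show "0 \<in> T" using prime_id_1[OF pr] is_idD(1)[OF J] by (auto simp: T_def intro!: exI[of _ 1])
    fix f g assume "g \<in> T"
    then obtain k where k: "k \<notin> P" "k * g \<in> J" by (auto simp: T_def)
    show "f * g \<in> T"
      using k is_idD(3)[OF J k(2), of f] by (auto simp: T_def mult_ac intro!: exI[of _ k])
    assume "f \<in> T"
    then obtain h where h: "h \<notin> P" "h * f \<in> J" by (auto simp: T_def)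
    have "(h * k) * (f + g) = k * (h * f) + h * (k * g)" by (simp add: algebra_simps)
    also have "\<dots> \<in> J" by (intro is_idD(2,3)[OF J] h k)
    finally show "f + g \<in> T" using h k prime_id_mult_iff[OF pr] by (auto simp: T_def)
  qed
  have J_T: "J \<subseteq> T" using prime_id_1[OF pr] by (auto simp: T_def intro!: exI[of _ 1])
  have cancel: "f \<in> T" if "h \<notin> P" "h * f \<in> T" for h f
  proof -
    obtain k where "k \<notin> P" "k * (h * f) \<in> J" using \<open>h * f \<in> T\<close> by (auto simp: T_def)
    then show ?thesis using that prime_id_mult_iff[OF pr, of k h] by (auto simp: T_def mult.assoc)
  qed
  have B_0: "?p p q = 0" if "p \<in> {b1, b2, b3, b4} \<or> q \<in> {b1, b2, b3, b4} \<or> p = q" for p q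
    using that by (intro pf6_not_distinct[OF alt]) auto
  have jj: "?p p q \<in> T" if "p \<in> {j1, j2, j3, j4}" "q \<in> {j1, j2, j3, j4}" for p q
  proof -
    have gs_T: "set gs \<subseteq> T" using gs_J J_T by blast
    then have 1: "?p j1 j2 \<in> T" "?p j1 j3 \<in> T" "?p j1 j4 \<in> T" "?p j2 j3 \<in> T" "?p j2 j4 \<in> T" "?p j3 j4 \<in> T"
      by (simp_all add: gs_def)
    have swap: "?p q p \<in> T" if "?p p q \<in> T" for p q
      using is_idD(5)[OF T that] by (simp add: pf6_last_swap[OF alt, of b1 b2 b3 b4 q p])
    have diag: "?p p p \<in> T" for p using B_0[of p p] is_idD(1)[OF T] by simp
    show ?thesis
      using that by (elim insertE emptyE) (simp_all only: 1 1[THEN swap] diag)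
  qed
  have cover: "p = i \<or> p \<in> {b1, b2, b3, b4} \<or> p \<in> {j1, j2, j3, j4}" for p
    unfolding set_j by blast
  \<comment> \<open>The index \<open>i\<close> is missing from the seven equations; it is recovered
    because the coordinate vector is in the kernel of \<open>Phi u\<close> and \<open>Var i\<close>
    is invertible at \<open>P\<close>.\<close>
  have ji: "?p p i \<in> T" if p: "p \<in> {j1, j2, j3, j4}" for p
  proof (rule cancel[OF prime(5)])
    have "(\<Sum>q\<in>UNIV. Var q * ?p p q) = 0" by (rule sum_pf6_kernel) (rule Phi_tri(2)[OF u])
    then have "Var i * ?p p i = - (\<Sum>q\<in>UNIV - {i}. Var q * ?p p q)"
      by (simp add: sum.remove[of UNIV i] eq_neg_iff_add_eq_0)
    also have "\<dots> \<in> T"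
    proof (intro is_idD(5)[OF T] is_id_sum[OF T] is_idD(3)[OF T])
      fix q assume "q \<in> UNIV - {i}"
      then consider "q \<in> {b1, b2, b3, b4}" | "q \<in> {j1, j2, j3, j4}" using cover[of q] by blast
      then show "?p p q \<in> T"
      proof cases
        case 1
        then have "?p p q = 0" by (intro B_0) blast
        then show ?thesis using is_idD(1)[OF T] by simp
      qed (rule jj[OF p])
    qed
    finally show "Var i * ?p p i \<in> T" .
  qed
  have base: "?p p q \<in> T" for p q
  proof -
    have "?p i q \<in> T" if "q \<in> {j1, j2, j3, j4}" for q
      using is_idD(5)[OF T ji[OF that]] by (simp add: pf6_last_swap[OF alt, of b1 b2 b3 b4 i q])
    moreover have "?p p q \<in> T" if "p \<in> {b1, b2, b3, b4} \<or> q \<in> {b1, b2, b3, b4} \<or> p = q"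
      using B_0[OF that] is_idD(1)[OF T] by simp
    ultimately show ?thesis using cover[of p] cover[of q] jj[of p q] ji[of p] by metis
  qed
  have "X_equations u \<subseteq> T"
  proof
    fix f assume "f \<in> X_equations u"
    then obtain as where "f = pfaffian ?A as" "length as = 6" by (auto simp: X_equations_def)
    then obtain c1 c2 c3 c4 c5 c6 where "f = pfaffian ?A [c1, c2, c3, c4, c5, c6]"
      by (auto simp: eval_nat_numeral length_Suc_conv)
    then show "f \<in> T" using pf6_generated[OF alt T cancel[OF \<beta>] base] unfolding pfaffian_6 by simp
  qed
  moreover have "Var i - 1 \<in> T" using gs_J J_T by (auto simp: gs_def)
  ultimately have I_T: "?I \<subseteq> T" unfolding chart_ideal_def by (intro Idl_least T) auto
  have gs_I: "gs ! k \<in> ?I" if "k < 7" for k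
  proof -
    have "gs ! k \<in> set gs" using gs_image that by blast
    then show ?thesis using gen_I p_I by (auto simp: gs_def)
  qed
  have "indep_at P {..<7} (\<lambda>k v. mpoly_deriv v (gs ! k))"
    unfolding indep_at_def
  proof (intro allI impI ballI, rule ccontr)
    fix c k0
    assume c: "\<forall>v. (\<Sum>k<7. c k * mpoly_deriv v (gs ! k)) \<in> P" and k0: "k0 \<in> {..<7}" "c k0 \<notin> P"
    then have "c k0 * \<beta> \<notin> P" using \<beta> by (simp add: prime_id_mult_iff[OF pr] \<beta>_def)
    \<comment> \<open>Keeping this product nonzero preserves both the nontriviality of the relation
      and the pivot at the geometric point.\<close>
    then obtain x where x: "\<And>f. f \<in> P \<Longrightarrow> ev to_ac x f = 0" "ev to_ac x (c k0 * \<beta>) \<noteq> 0"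
      using Nullstellensatz[OF coeff_hom_to_ac pr] by metis
    let ?e = "ev (to_ac :: 'k \<Rightarrow> 'k alg_closure) x"
    let ?uK = "\<lambda>t. to_ac (u t) :: 'k alg_closure"
    have \<beta>_ne: "?e \<beta> \<noteq> 0" and c_ne: "?e (c k0) \<noteq> 0" using x(2) by auto
    have p_0: "?e (?p p q) = 0" for p q using x(1) p_I[of p q] prime(4) by blast
    have x_i: "x i = 1" using x(1)[OF prime(2)] by simp
    interpret D: degeneracy_point ?uK x i b1 b2 b3 b4
    proof
      show "?uK \<in> trivectors" by (rule comp_trivectors[OF coeff_hom_to_ac u])
      show "pf4 (contract ?uK x) b1 b2 b3 b4 \<noteq> 0"
        using \<beta>_ne by (simp add: \<beta>_def coeff_hom.hom_pf4[OF coeff_hom_ev] ev_Phi[OF coeff_hom_to_ac])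
      show "pf6 (contract ?uK x) b1 b2 b3 b4 p q = 0" for p q
        using p_0[of p q] by (simp add: coeff_hom.hom_pf6[OF coeff_hom_ev] ev_Phi[OF coeff_hom_to_ac])
    qed (use st x_i dist_b in auto)
    have dp: "?e \<beta> * ?e (mpoly_deriv v (?p j l)) = tri ?uK (D.n j) (D.n l) (unit v)" for v j l
      unfolding \<beta>_def by (rule deriv_pf6[OF coeff_hom_to_ac u p_0])
    define R where "R y = ?e (c 1) * tri ?uK (D.n j1) (D.n j2) y + ?e (c 2) * tri ?uK (D.n j1) (D.n j3) y
      + ?e (c 3) * tri ?uK (D.n j1) (D.n j4) y + ?e (c 4) * tri ?uK (D.n j2) (D.n j3) y
      + ?e (c 5) * tri ?uK (D.n j2) (D.n j4) y + ?e (c 6) * tri ?uK (D.n j3) (D.n j4) y" for y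
    have R_unit: "?e (c 0) * ?e \<beta> * unit i v + R (unit v) = 0" for v
    proof -
      have "?e (\<Sum>k<7. c k * mpoly_deriv v (gs ! k)) = 0" using c x(1) by blast
      then have "?e \<beta> * (\<Sum>k<7. ?e (c k) * ?e (mpoly_deriv v (gs ! k))) = 0" by (simp add: ev_sum)
      then have "?e (c 0) * ?e \<beta> * ?e (mpoly_deriv v (gs ! 0)) + ?e (c 1) * (?e \<beta> * ?e (mpoly_deriv v (gs ! 1)))
        + ?e (c 2) * (?e \<beta> * ?e (mpoly_deriv v (gs ! 2))) + ?e (c 3) * (?e \<beta> * ?e (mpoly_deriv v (gs ! 3)))
        + ?e (c 4) * (?e \<beta> * ?e (mpoly_deriv v (gs ! 4))) + ?e (c 5) * (?e \<beta> * ?e (mpoly_deriv v (gs ! 5)))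
        + ?e (c 6) * (?e \<beta> * ?e (mpoly_deriv v (gs ! 6))) = 0"
        unfolding sum_lessThan_7 by (simp only: distrib_left mult_ac)
      then show ?thesis
        by (simp add: gs_def dp R_def deriv_diff deriv_Var unit_def add.assoc split: if_splits)
    qed
    have expand: "y = (\<lambda>d. \<Sum>v\<in>UNIV. y v * unit v d)" for y :: "9 \<Rightarrow> 'k alg_closure"
    proof
      fix d show "y d = (\<Sum>v\<in>UNIV. y v * unit v d)"
        using sum_unit[of d y] by (simp add: unit_def mult.commute eq_commute[of d])
    qed
    have R_sum: "R y = (\<Sum>v\<in>UNIV. y v * R (unit v))" for y
      unfolding R_def
      by (subst (1 2 3 4 5 6) expand[of y]) (simp add: tri_sum(3) sum.distrib sum_distrib_left algebra_simps)
    have R_all: "R y = - (?e (c 0) * ?e \<beta> * y i)" for y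
    proof -
      have "R (unit v) = - (?e (c 0) * ?e \<beta> * unit i v)" for v
        using R_unit[of v] by (simp add: eq_neg_iff_add_eq_0 add.commute)
      then have "R y = (\<Sum>v\<in>UNIV. unit i v * (- (?e (c 0) * ?e \<beta> * y v)))"
        unfolding R_sum[of y] by (simp add: mult_ac)
      then show ?thesis by (simp only: sum_unit)
    qed
    \<comment> \<open>Evaluating at \<open>x\<close> itself separates the chart equation from the
      Pfaffians: the contractions vanish on \<open>x\<close>, while its coordinate \<open>i\<close>
      is 1.\<close>
    have "R x = 0" by (simp add: R_def D.tri_n_x)
    then have c_0: "?e (c 0) = 0" using R_all[of x] \<beta>_ne x_i by simp
    then have "R y = 0" for y using R_all[of y] by simp
    moreover have "distinct [i, j1, j2, j3, j4]" "{j1, j2, j3, j4} \<inter> {b1, b2, b3, b4} = {}"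
      using set_j dist_j by auto
    ultimately have "D.relation j1 j2 j3 j4 (?e (c 1)) (?e (c 2)) (?e (c 3)) (?e (c 4)) (?e (c 5)) (?e (c 6))"
      unfolding D.relation_def R_def by blast
    note D.relation_eq_0[OF this]
    moreover have "k0 = 0 \<or> k0 = 1 \<or> k0 = 2 \<or> k0 = 3 \<or> k0 = 4 \<or> k0 = 5 \<or> k0 = 6"
      using k0(1) by auto
    ultimately show False using c_ne c_0 by auto
  qed
  then show ?thesis
    unfolding affine_smooth_at_def
    by (intro exI[of _ 7] exI[of _ "(!) gs"]) (use gs_I I_T in \<open>auto simp: T_def J_def\<close>)
qed

section \<open>Closedness of the set of trivectors with a degenerate point\<close>

text \<open>Krull's argument: an ideal maximal among those containing \<open>J\<close> and missing
  every power of \<open>b\<close> is prime.\<close>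

lemma exists_prime_avoiding_powers:
  fixes J :: "'a::comm_ring_1 set"
  assumes J: "is_id J" and b: "\<And>n. b ^ n \<notin> J"
  obtains P where "prime_id P" "J \<subseteq> P" "b \<notin> P"
proof -
  let ?A = "{I. is_id I \<and> J \<subseteq> I \<and> (\<forall>n. b ^ n \<notin> I)}"
  have "\<exists>M\<in>?A. \<forall>I\<in>?A. M \<subseteq> I \<longrightarrow> I = M"
  proof (rule subset_Zorn_nonempty)
    show "?A \<noteq> {}" using J b by blast
    fix C assume C: "C \<noteq> {}" "subset.chain ?A C"
    then have C_A: "C \<subseteq> ?A" and C_chain: "\<And>I I'. I \<in> C \<Longrightarrow> I' \<in> C \<Longrightarrow> I \<subseteq> I' \<or> I' \<subseteq> I"
      by (auto simp: subset.chain_def)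
    have C_id: "is_id I" if "I \<in> C" for I using that C_A by auto
    have "is_id (\<Union>C)"
      unfolding is_id_def
    proof (intro conjI ballI allI)
      obtain I where "I \<in> C" using C(1) by auto
      then show "0 \<in> \<Union>C" using is_idD(1)[OF C_id] by blast
      fix x y assume "y \<in> \<Union>C"
      then obtain I where I: "I \<in> C" "y \<in> I" by blast
      then show "x * y \<in> \<Union>C" using is_idD(3)[OF C_id[OF I(1)] I(2)] by blast
      assume "x \<in> \<Union>C"
      then obtain I' where I': "I' \<in> C" "x \<in> I'" by blast
      from C_chain[OF I(1) I'(1)] show "x + y \<in> \<Union>C"
      proof
        assume "I \<subseteq> I'"
        then show ?thesis using is_idD(2)[OF C_id[OF I'(1)] I'(2), of y] I I' by blast
      next
        assume "I' \<subseteq> I"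
        then show ?thesis using is_idD(2)[OF C_id[OF I(1)] _ I(2), of x] I I' by blast
      qed
    qed
    moreover have "J \<subseteq> \<Union>C" using C(1) C_A by auto
    moreover have "\<forall>n. b ^ n \<notin> \<Union>C" using C_A by auto
    ultimately show "\<Union>C \<in> ?A" by simp
  qed
  then obtain M where M_A: "M \<in> ?A" and max: "\<forall>I\<in>?A. M \<subseteq> I \<longrightarrow> I = M" ..
  have M: "is_id M" "J \<subseteq> M" "b ^ n \<notin> M" for n using M_A by auto
  have maximal: "I = M" if "is_id I" "J \<subseteq> I" "\<And>n. b ^ n \<notin> I" "M \<subseteq> I" for I
    using max that by simp
  have power_in: "\<exists>n m r. b ^ n = m + r * x \<and> m \<in> M" if "x \<notin> M" for x
  proof (rule ccontr)
    assume *: "\<not> ?thesis"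
    let ?I = "{m + r * x |m r. m \<in> M}"
    have mem_I: "m + r * x \<in> ?I" if "m \<in> M" for m r using that by blast
    have "is_id ?I"
      unfolding is_id_def
    proof (intro conjI ballI allI)
      show "0 \<in> ?I" using mem_I[OF is_idD(1)[OF M(1)], of 0] by simp
      fix y z assume "z \<in> ?I"
      then obtain m r where z: "z = m + r * x" "m \<in> M" by blast
      have yz: "y * z = y * m + (y * r) * x" by (simp add: z algebra_simps)
      show "y * z \<in> ?I" unfolding yz by (rule mem_I[OF is_idD(3)[OF M(1) z(2)]])
      assume "y \<in> ?I"
      then obtain m' r' where y: "y = m' + r' * x" "m' \<in> M" by blast
      have yz: "y + z = (m' + m) + (r' + r) * x" by (simp add: y z algebra_simps)
      show "y + z \<in> ?I" unfolding yz by (rule mem_I[OF is_idD(2)[OF M(1) y(2) z(2)]])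
    qed
    moreover have M_I: "M \<subseteq> ?I"
    proof
      fix m assume "m \<in> M"
      then show "m \<in> ?I" using mem_I[of m 0] by simp
    qed
    moreover have "b ^ n \<notin> ?I" for n using * by blast
    ultimately have "?I = M" using M(2) by (intro maximal) auto
    moreover have "x \<in> ?I" using mem_I[OF is_idD(1)[OF M(1)], of 1] by simp
    ultimately show False using that by simp
  qed
  have "prime_id M"
    unfolding prime_id_def
  proof (intro conjI allI impI)
    show "1 \<notin> M" using M(3)[of 0] by simp
    fix x y assume xy: "x * y \<in> M"
    show "x \<in> M \<or> y \<in> M"
    proof (rule ccontr)
      assume "\<not> ?thesis"
      then obtain n m r n' m' r' where 1: "b ^ n = m + r * x" "m \<in> M" and 2: "b ^ n' = m' + r' * y" "m' \<in> M"
        using power_in by meson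
      have "b ^ (n + n') = m * b ^ n' + r * x * m' + r * r' * (x * y)"
        unfolding power_add 1 2 by (simp add: algebra_simps)
      also have "\<dots> \<in> M" by (intro is_idD(2)[OF M(1)] is_idD(3)[OF M(1)] is_idD(4)[OF M(1)] 1 2 xy)
      finally show False using M(3) by blast
    qed
  qed (use M(1) in \<open>auto simp: is_id_def\<close>)
  moreover have "b \<notin> M" using M(3)[of 1] by simp
  ultimately show thesis using that M(2) by blast
qed

text \<open>Otherwise a prime over \<open>F\<close> avoiding \<open>Var v\<close> would have a
  geometric point with nonzero coordinate \<open>v\<close>.\<close>

lemma projective_Nullstellensatz:
  fixes F :: "('v::finite, 'a::alg_closed_field) mpoly set"
  assumes "\<And>x. (\<And>f. f \<in> F \<Longrightarrow> ev (\<lambda>c. c) x f = 0) \<Longrightarrow> x v = 0"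
  obtains n where "Var v ^ n \<in> Idl\<^bsub>mpoly_ring\<^esub> F"
proof (rule ccontr)
  assume "\<not> thesis"
  then have notin: "Var v ^ n \<notin> Idl\<^bsub>mpoly_ring\<^esub> F" for n using that by blast
  obtain P where P: "prime_id P" "Idl\<^bsub>mpoly_ring\<^esub> F \<subseteq> P" "Var v \<notin> P"
    by (rule exists_prime_avoiding_powers[OF Idl_is_id notin])
  obtain x where x: "\<forall>f\<in>P. ev (\<lambda>c. c) x f = 0" "ev (\<lambda>c. c) x (Var v) \<noteq> 0"
  proof (rule Nullstellensatz[OF coeff_hom_id P(1,3)])
    fix x :: "'v \<Rightarrow> 'a"
    assume "\<And>f. f \<in> P \<Longrightarrow> ev (\<lambda>c. c) x f = 0" "ev (\<lambda>c. c) x (Var v) \<noteq> 0"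
    then show thesis by (intro that ballI)
  qed
  have "ev (\<lambda>c. c) x f = 0" if "f \<in> F" for f
    by (rule bspec[OF x(1) subsetD[OF P(2) subsetD[OF Idl_superset that]]])
  then have "x v = 0" by (rule assms[of x])
  then show False using x(2) unfolding coeff_hom.ev_Var[OF coeff_hom_id] by contradiction
qed

section \<open>Elimination: ideals that contain all monomials of a given degree\<close>

definition monoms_of_deg :: "nat \<Rightarrow> ('v::finite \<Rightarrow>\<^sub>0 nat) set" where
  "monoms_of_deg N = {m. sum (Poly_Mapping.lookup m) UNIV = N}"

lemma finite_monoms_of_deg: "finite (monoms_of_deg N :: ('v::finite \<Rightarrow>\<^sub>0 nat) set)"
proof (rule finite_imageD)
  have "Poly_Mapping.lookup m v \<le> N" if "m \<in> monoms_of_deg N" for m :: "'v \<Rightarrow>\<^sub>0 nat" and v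
    using that member_le_sum[of v UNIV "Poly_Mapping.lookup m"] by (simp add: monoms_of_deg_def)
  then have "Poly_Mapping.lookup ` (monoms_of_deg N :: ('v \<Rightarrow>\<^sub>0 nat) set) \<subseteq> Pi\<^sub>E UNIV (\<lambda>_. {..N})"
    by (intro image_subsetI PiE_I) simp_all
  moreover have "finite (Pi\<^sub>E (UNIV :: 'v set) (\<lambda>_. {..N}))" by (rule finite_PiE) auto
  ultimately show "finite (Poly_Mapping.lookup ` (monoms_of_deg N :: ('v \<Rightarrow>\<^sub>0 nat) set))"
    by (rule finite_subset)
  show "inj_on Poly_Mapping.lookup (monoms_of_deg N :: ('v \<Rightarrow>\<^sub>0 nat) set)"
    by (rule inj_onI, rule poly_mapping_eqI) simp
qed

text \<open>If all exponents were below the \<open>n v\<close>, the total degree would be smaller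
  than their sum.\<close>

lemma monoms_in_ideal:
  fixes J :: "('v::finite, 'a::comm_ring_1) mpoly set"
  assumes J: "is_id J" and n: "\<And>v. Var v ^ n v \<in> J"
    and m: "m \<in> monoms_of_deg (sum n UNIV)"
  shows "Poly_Mapping.single m 1 \<in> J"
proof -
  have "\<exists>v. n v \<le> Poly_Mapping.lookup m v"
  proof (rule ccontr)
    assume "\<not> ?thesis"
    then have "sum (Poly_Mapping.lookup m) UNIV < sum n UNIV"
      by (intro sum_strict_mono) (auto simp: not_le)
    then show False using m by (simp add: monoms_of_deg_def)
  qed
  then obtain v where v: "n v \<le> Poly_Mapping.lookup m v" by blast
  have m_eq: "(m - Poly_Mapping.single v (n v)) + Poly_Mapping.single v (n v) = m"
    by (rule poly_mapping_eqI) (use v in \<open>auto simp: lookup_add lookup_minus lookup_single when_def\<close>)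
  have eq: "Poly_Mapping.single (m - Poly_Mapping.single v (n v)) 1 * Var v ^ n v = Poly_Mapping.single m (1 :: 'a)"
    by (simp only: Var_power mult_single m_eq mult_1)
  have "Poly_Mapping.single (m - Poly_Mapping.single v (n v)) 1 * Var v ^ n v \<in> J"
    by (rule is_idD(3)[OF J n])
  then show ?thesis by (simp only: eq)
qed

lemma Idl_range_repr:
  fixes f :: "'c::finite \<Rightarrow> 'a::comm_ring_1"
  assumes "h \<in> Idl\<^bsub>ring_of_type_algebra\<^esub> (range f)"
  obtains G where "h = (\<Sum>c\<in>UNIV. G c * f c)"
proof -
  let ?J = "{\<Sum>c\<in>UNIV. G c * f c |G. True}"
  have "is_id ?J"
    unfolding is_id_def
  proof (intro conjI ballI allI)
    show "0 \<in> ?J" by (auto intro!: exI[of _ "\<lambda>_. 0"])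
    fix x y assume "y \<in> ?J"
    then obtain G where G: "y = (\<Sum>c\<in>UNIV. G c * f c)" by blast
    have "x * y = (\<Sum>c\<in>UNIV. (x * G c) * f c)" by (simp add: G sum_distrib_left mult.assoc)
    then show "x * y \<in> ?J" by (intro CollectI exI[of _ "\<lambda>c. x * G c"] conjI TrueI)
    assume "x \<in> ?J"
    then obtain H where H: "x = (\<Sum>c\<in>UNIV. H c * f c)" by blast
    have "x + y = (\<Sum>c\<in>UNIV. (H c + G c) * f c)" by (simp add: G H sum.distrib algebra_simps)
    then show "x + y \<in> ?J" by (intro CollectI exI[of _ "\<lambda>c. H c + G c"] conjI TrueI)
  qed
  moreover have "f c \<in> ?J" for c
  proof -
    have "f c = (\<Sum>d\<in>UNIV. unit c d * f d)" by (simp add: sum_unit)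
    then show ?thesis by (intro CollectI exI[of _ "unit c"] conjI TrueI)
  qed
  then have "range f \<subseteq> ?J" by (rule image_subsetI)
  ultimately have "Idl\<^bsub>ring_of_type_algebra\<^esub> (range f) \<subseteq> ?J" by (rule Idl_least)
  from subsetD[OF this assms] obtain G where "h = (\<Sum>c\<in>UNIV. G c * f c)" by auto
  then show thesis by (rule that)
qed

text \<open>Closure rules are enough here: such functions are only combined by sums and products and
  restricted to lines and curves.\<close>

inductive polyfun :: "(('t \<Rightarrow> 'a::comm_ring_1) \<Rightarrow> 'a) \<Rightarrow> bool" where
  const: "polyfun (\<lambda>_. c)"
| coord: "polyfun (\<lambda>u. u t)"
| add: "polyfun f \<Longrightarrow> polyfun g \<Longrightarrow> polyfun (\<lambda>u. f u + g u)"
| mult: "polyfun f \<Longrightarrow> polyfun g \<Longrightarrow> polyfun (\<lambda>u. f u * g u)"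

lemma polyfun_diff:
  assumes "polyfun f" "polyfun g"
  shows "polyfun (\<lambda>u. f u - g u)"
  using polyfun.add[OF assms(1) polyfun.mult[OF polyfun.const[of "-1"] assms(2)]] by simp

lemma polyfun_sum: "(\<And>i. i \<in> I \<Longrightarrow> polyfun (f i)) \<Longrightarrow> polyfun (\<lambda>u. \<Sum>i\<in>I. f i u)"
  by (induction I rule: infinite_finite_induct) (auto intro: polyfun.intros)

text \<open>Gaussian elimination without division. At \<open>u0\<close> the matrix is the identity,
  so every pivot is 1 there; \<delta> is the product of the pivots and plays the part of a
  determinant.\<close>

lemma generic_injective:
  fixes M :: "('t \<Rightarrow> 'a::field) \<Rightarrow> 'i \<Rightarrow> 'i \<Rightarrow> 'a"
  assumes "finite I" "\<And>i j. polyfun (\<lambda>u. M u i j)"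
    "\<And>i j. i \<in> I \<Longrightarrow> j \<in> I \<Longrightarrow> M u0 i j = (if i = j then 1 else 0)"
  shows "\<exists>\<delta>. polyfun \<delta> \<and> \<delta> u0 = 1 \<and>
    (\<forall>u y. \<delta> u \<noteq> 0 \<longrightarrow> (\<forall>i\<in>I. (\<Sum>j\<in>I. M u i j * y j) = 0) \<longrightarrow> (\<forall>j\<in>I. y j = 0))"
  using assms
proof (induction I arbitrary: M rule: finite_induct)
  case empty
  show ?case by (auto intro!: exI[of _ "\<lambda>_. 1"] polyfun.const)
next
  case (insert k I)
  define M' where "M' u i j = M u k k * M u i j - M u i k * M u k j" for u i j
  have "polyfun (\<lambda>u. M' u i j)" for i j
    unfolding M'_def by (intro polyfun_diff polyfun.mult insert.prems(1))
  moreover have "M' u0 i j = (if i = j then 1 else 0)" if "i \<in> I" "j \<in> I" for i j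
  proof -
    have "k \<noteq> i" "k \<noteq> j" using that insert.hyps by auto
    then show ?thesis using that by (simp add: M'_def insert.prems(2))
  qed
  ultimately have "\<exists>\<delta>. polyfun \<delta> \<and> \<delta> u0 = 1 \<and>
    (\<forall>u y. \<delta> u \<noteq> 0 \<longrightarrow> (\<forall>i\<in>I. (\<Sum>j\<in>I. M' u i j * y j) = 0) \<longrightarrow> (\<forall>j\<in>I. y j = 0))"
    by (rule insert.IH)
  then obtain \<delta> where \<delta>: "polyfun \<delta>" "\<delta> u0 = 1" and \<delta>_inj:
    "\<forall>u y. \<delta> u \<noteq> 0 \<longrightarrow> (\<forall>i\<in>I. (\<Sum>j\<in>I. M' u i j * y j) = 0) \<longrightarrow> (\<forall>j\<in>I. y j = 0)"
    by (elim exE conjE)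
  show ?case
  proof (intro exI[of _ "\<lambda>u. M u k k * \<delta> u"] conjI allI impI)
    show "polyfun (\<lambda>u. M u k k * \<delta> u)" by (intro polyfun.mult insert.prems(1) \<delta>)
    show "M u0 k k * \<delta> u0 = 1" by (simp add: insert.prems(2) \<delta>)
    fix u y assume ne: "M u k k * \<delta> u \<noteq> 0"
      and *: "\<forall>i\<in>insert k I. (\<Sum>j\<in>insert k I. M u i j * y j) = 0"
    have row: "(\<Sum>j\<in>I. M u i j * y j) = - (M u i k * y k)" if "i \<in> insert k I" for i
      using *[rule_format, OF that] insert.hyps by (simp add: eq_neg_iff_add_eq_0 add.commute)
    have I_0: "y j = 0" if "j \<in> I" for j
    proof (rule \<delta>_inj[rule_format, OF _ _ that])
      show "\<delta> u \<noteq> 0" using ne by auto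
      fix i assume "i \<in> I"
      have "(\<Sum>j\<in>I. M' u i j * y j) = M u k k * (\<Sum>j\<in>I. M u i j * y j) - M u i k * (\<Sum>j\<in>I. M u k j * y j)"
        by (simp add: M'_def sum_distrib_left sum_subtractf algebra_simps)
      also have "\<dots> = 0" using row[of i] row[of k] \<open>i \<in> I\<close> by simp
      finally show "(\<Sum>j\<in>I. M' u i j * y j) = 0" .
    qed
    then have "M u k k * y k = 0" using row[of k] by simp
    then show "\<forall>j\<in>insert k I. y j = 0" using ne I_0 by auto
  qed
qed

definition polyfam :: "(('t \<Rightarrow> 'a::comm_ring_1) \<Rightarrow> ('v, 'a) mpoly) \<Rightarrow> bool" where
  "polyfam h \<longleftrightarrow> (\<forall>m. polyfun (\<lambda>u. Poly_Mapping.lookup (h u) m))"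

lemma polyfam_add: "polyfam f \<Longrightarrow> polyfam g \<Longrightarrow> polyfam (\<lambda>u. f u + g u)"
  by (simp add: polyfam_def lookup_add polyfun.add)

lemma polyfam_diff: "polyfam f \<Longrightarrow> polyfam g \<Longrightarrow> polyfam (\<lambda>u. f u - g u)"
  by (simp add: polyfam_def lookup_minus polyfun_diff)

lemma polyfam_sum: "(\<And>i. i \<in> I \<Longrightarrow> polyfam (f i)) \<Longrightarrow> polyfam (\<lambda>u. \<Sum>i\<in>I. f i u)"
  by (simp add: polyfam_def lookup_sum polyfun_sum)

lemma polyfam_const: "polyfam (\<lambda>_. p)"
  by (simp add: polyfam_def polyfun.const)

lemma lookup_single_mult:
  fixes g :: "('v, 'a::comm_ring_1) mpoly"
  shows "Poly_Mapping.lookup (Poly_Mapping.single m0 c * g) (m0 + n) = c * Poly_Mapping.lookup g n"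
proof (induction g rule: mpoly_induct)
  case (single m d)
  show ?case by (simp add: mult_single lookup_single when_def)
qed (simp add: lookup_add algebra_simps)

lemma lookup_single_mult_0:
  fixes g :: "('v, 'a::comm_ring_1) mpoly"
  assumes "\<And>n. m \<noteq> m0 + n"
  shows "Poly_Mapping.lookup (Poly_Mapping.single m0 c * g) m = 0"
proof (induction g rule: mpoly_induct)
  case (single m' d)
  show ?case using assms[of m'] by (simp add: mult_single lookup_single when_def)
qed (simp add: lookup_add algebra_simps)

lemma polyfam_mult_fixed:
  fixes p :: "('v, 'a::comm_ring_1) mpoly"
  assumes "polyfam h"
  shows "polyfam (\<lambda>u. p * h u)"
proof (induction p rule: mpoly_induct)
  case (single m0 c)
  show ?case
    unfolding polyfam_def
  proof
    fix m show "polyfun (\<lambda>u. Poly_Mapping.lookup (Poly_Mapping.single m0 c * h u) m)"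
    proof (cases "\<exists>n. m = m0 + n")
      case True
      then obtain n where "m = m0 + n" ..
      then show ?thesis using assms by (simp add: lookup_single_mult polyfam_def polyfun.intros)
    next
      case False
      then show ?thesis by (simp add: lookup_single_mult_0 polyfun.const)
    qed
  qed
qed (simp add: distrib_right polyfam_add)

lemma polyfam_scale:
  assumes "polyfun c" "polyfam h"
  shows "polyfam (\<lambda>u. Const (c u) * h u)"
proof -
  have "Poly_Mapping.lookup (Const a * p) m = a * Poly_Mapping.lookup p m" for a :: 'b and p :: "('c, 'b) mpoly" and m
    using lookup_single_mult[of 0 a p m] by (simp add: Const_def)
  then show ?thesis using assms by (simp add: polyfam_def polyfun.mult)
qed

lemma polyfam_Phi_mult:
  assumes "polyfam h"
  shows "polyfam (\<lambda>u. Phi u a b * h u)"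
  unfolding Phi_def sum_distrib_right mult.assoc
  by (intro polyfam_sum polyfam_scale polyfam_mult_fixed assms polyfun.coord)

lemma polyfam_pf6: "polyfam (\<lambda>u. pf6 (Phi u) a b c d e f)"
proof -
  have 4: "polyfam (\<lambda>u. pf4 (Phi u) a b c d)" for a b c d
  proof -
    have "polyfam (\<lambda>u. Phi u p q * (Phi u r s * 1))" for p q r s
      by (intro polyfam_Phi_mult polyfam_const)
    then have "polyfam (\<lambda>u. Phi u p q * Phi u r s)" for p q r s by simp
    then show ?thesis unfolding pf4_def by (intro polyfam_add polyfam_diff)
  qed
  show ?thesis unfolding pf6_def by (intro polyfam_add polyfam_diff polyfam_Phi_mult 4)
qed

definition degenerate :: "('n::finite \<times> 'n \<times> 'n \<Rightarrow> 'a::field) \<Rightarrow> bool" where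
  "degenerate u \<longleftrightarrow> (\<exists>x. (\<exists>v. x v \<noteq> 0) \<and> (\<forall>a b c d e f. pf6 (contract u x) a b c d e f = 0))"

lemma contract_scale: "contract u (\<lambda>v. t * x v) p q = t * contract u x p q"
  by (simp add: contract_def sum_distrib_left mult_ac)

lemma pf6_contract_scale:
  "pf6 (contract u (\<lambda>v. t * x v)) a b c d e f = t ^ 3 * pf6 (contract u x) a b c d e f"
  unfolding pf6_def pf4_def contract_scale by (simp add: power3_eq_cube algebra_simps)

text \<open>On the line through \<open>x\<close>, \<open>H\<close> becomes a polynomial in
  \<open>t\<close> whose coefficient at degree \<open>N\<close> is the stated sum. This handles
  cofactors that are not homogeneous.\<close>

lemma homogeneous_part_vanishes:
  fixes H :: "('v::finite, 'a::alg_closed_field) mpoly"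
  assumes "\<And>t. ev (\<lambda>c. c) (\<lambda>v. t * x v) H = 0"
  shows "(\<Sum>m\<in>monoms_of_deg N. Poly_Mapping.lookup H m * monom_ev x m) = 0"
proof -
  let ?deg = "\<lambda>m :: 'v \<Rightarrow>\<^sub>0 nat. sum (Poly_Mapping.lookup m) UNIV"
  define p where "p = (\<Sum>m\<in>Poly_Mapping.keys H. monom (Poly_Mapping.lookup H m * monom_ev x m) (?deg m))"
  have deg: "sum (Poly_Mapping.lookup m) (Poly_Mapping.keys m) = ?deg m" for m :: "'v \<Rightarrow>\<^sub>0 nat"
    by (rule sum.mono_neutral_left) (auto simp: in_keys_iff)
  have "poly p t = ev (\<lambda>c. c) (\<lambda>v. t * x v) H" for t
    by (simp add: p_def ev_def poly_sum poly_monom monom_ev_scale deg mult_ac)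
  then have "p = 0" using assms poly_eq_0_cofinite[of "{}" p] by simp
  then have "0 = coeff p N" by simp
  also have "\<dots> = (\<Sum>m\<in>Poly_Mapping.keys H. if ?deg m = N then Poly_Mapping.lookup H m * monom_ev x m else 0)"
    by (simp add: p_def coeff_sum coeff_monom)
  also have "\<dots> = (\<Sum>m\<in>Poly_Mapping.keys H \<inter> monoms_of_deg N. Poly_Mapping.lookup H m * monom_ev x m)"
    by (simp add: sum.inter_restrict monoms_of_deg_def)
  also have "\<dots> = (\<Sum>m\<in>monoms_of_deg N. Poly_Mapping.lookup H m * monom_ev x m)"
    by (rule sum.mono_neutral_left) (auto simp: finite_monoms_of_deg in_keys_iff)
  finally show ?thesis by simp
qed

text \<open>For \<open>u\<close> without a degenerate point, each monomial of a large degree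
  \<open>N\<close> is a combination of the Pfaffians. Keeping the cofactors and varying the
  trivector gives a matrix of degree \<open>N\<close> coefficients, polynomial in the trivector and
  equal to the identity at \<open>u\<close>. A degenerate point of another trivector yields a
  nonzero kernel vector, namely the values of the monomials.\<close>

lemma degenerate_closed:
  fixes u :: "'n::finite \<times> 'n \<times> 'n \<Rightarrow> 'a::alg_closed_field"
  assumes "\<not> degenerate u"
  obtains \<delta> where "polyfun \<delta>" "\<delta> u \<noteq> 0" "\<And>u'. degenerate u' \<Longrightarrow> \<delta> u' = 0"
proof -
  define f where "f u = (\<lambda>(a, b, c, d, e, g). pf6 (Phi u) a b c d e g)" for u :: "'n \<times> 'n \<times> 'n \<Rightarrow> 'a"
  have ev_f: "ev (\<lambda>c. c) x (f u (a, b, c, d, e, g)) = pf6 (contract u x) a b c d e g" for u x a b c d e g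
    by (simp add: f_def coeff_hom.hom_pf6[OF coeff_hom.coeff_hom_ev[OF coeff_hom_id]] ev_Phi[OF coeff_hom_id])
  let ?J = "Idl\<^bsub>mpoly_ring\<^esub> (range (f u))"
  have "\<exists>n. Var v ^ n \<in> ?J" for v
  proof -
    have "x v = 0" if "\<And>h. h \<in> range (f u) \<Longrightarrow> ev (\<lambda>c. c) x h = 0" for x
    proof -
      have "pf6 (contract u x) a b c d e g = 0" for a b c d e g
        using that[of "f u (a, b, c, d, e, g)"] by (simp add: ev_f)
      then show ?thesis using assms unfolding degenerate_def by blast
    qed
    then show ?thesis using projective_Nullstellensatz[of "range (f u)" v] by blast
  qed
  then have "\<forall>v. \<exists>n. Var v ^ n \<in> ?J" by blast
  from choice[OF this] obtain n where n: "Var v ^ n v \<in> ?J" for v by blast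
  define N where "N = sum n UNIV"
  have "\<exists>G. Poly_Mapping.single m 1 = (\<Sum>c\<in>UNIV. G c * f u c)" if "m \<in> monoms_of_deg N" for m
    by (rule Idl_range_repr[OF monoms_in_ideal[OF Idl_is_id n that[unfolded N_def]]]) (rule exI)
  then have "\<forall>m\<in>monoms_of_deg N. \<exists>G. Poly_Mapping.single m 1 = (\<Sum>c\<in>UNIV. G c * f u c)" by (rule ballI)
  from bchoice[OF this] obtain G where
    "\<forall>m\<in>monoms_of_deg N. Poly_Mapping.single m 1 = (\<Sum>c\<in>UNIV. G m c * f u c)" ..
  then have G: "Poly_Mapping.single m 1 = (\<Sum>c\<in>UNIV. G m c * f u c)" if "m \<in> monoms_of_deg N" for m
    using that by (rule bspec)
  define H where "H u' m = (\<Sum>c\<in>UNIV. G m c * f u' c)" for u' m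
  have "polyfam (\<lambda>u'. f u' c)" for c by (cases c) (simp add: f_def polyfam_pf6)
  then have "polyfam (\<lambda>u'. H u' m)" for m
    unfolding H_def by (intro polyfam_sum polyfam_mult_fixed)
  then have M_poly: "polyfun (\<lambda>u'. Poly_Mapping.lookup (H u' m) m')" for m m'
    by (simp add: polyfam_def)
  have M_u: "Poly_Mapping.lookup (H u m) m' = (if m = m' then 1 else 0)" if "m \<in> monoms_of_deg N" for m m'
    unfolding H_def G[OF that, symmetric] by (simp add: lookup_single when_def)
  have "\<exists>\<delta>. polyfun \<delta> \<and> \<delta> u = 1 \<and> (\<forall>u' y. \<delta> u' \<noteq> 0 \<longrightarrow> (\<forall>m\<in>monoms_of_deg N.
        (\<Sum>m'\<in>monoms_of_deg N. Poly_Mapping.lookup (H u' m) m' * y m') = 0) \<longrightarrow>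
      (\<forall>m\<in>monoms_of_deg N. y m = 0))"
    by (rule generic_injective[OF finite_monoms_of_deg M_poly M_u])
  then obtain \<delta> where \<delta>: "polyfun \<delta>" "\<delta> u = 1" and \<delta>_inj: "\<forall>u' y. \<delta> u' \<noteq> 0 \<longrightarrow> (\<forall>m\<in>monoms_of_deg N.
        (\<Sum>m'\<in>monoms_of_deg N. Poly_Mapping.lookup (H u' m) m' * y m') = 0) \<longrightarrow>
      (\<forall>m\<in>monoms_of_deg N. y m = 0)"
    by (elim exE conjE)
  show thesis
  proof (rule that[OF \<delta>(1)])
    fix u' :: "'n \<times> 'n \<times> 'n \<Rightarrow> 'a" assume "degenerate u'"
    then obtain x v where x: "x v \<noteq> 0" "\<And>a b c d e g. pf6 (contract u' x) a b c d e g = 0"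
      unfolding degenerate_def by blast
    have "ev (\<lambda>c. c) (\<lambda>v. t * x v) (f u' c) = 0" for t c
    proof (cases c)
      case (fields a b d e g h)
      then show ?thesis using x(2) by (simp add: fields ev_f pf6_contract_scale)
    qed
    then have "ev (\<lambda>c. c) (\<lambda>v. t * x v) (H u' m) = 0" for t m by (simp add: H_def coeff_hom.ev_sum[OF coeff_hom_id] coeff_hom.ev_mult[OF coeff_hom_id])
    then have ker: "(\<Sum>m'\<in>monoms_of_deg N. Poly_Mapping.lookup (H u' m) m' * monom_ev x m') = 0" for m
      by (rule homogeneous_part_vanishes)
    show "\<delta> u' = 0"
    proof (rule ccontr)
      assume "\<delta> u' \<noteq> 0"
      moreover have "Poly_Mapping.single v N \<in> monoms_of_deg N"
        by (simp add: monoms_of_deg_def lookup_single when_def)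
      ultimately have "monom_ev x (Poly_Mapping.single v N) = 0"
        using \<delta>_inj[rule_format, of u' "monom_ev x"] ker by (simp del: monom_ev_single)
      then show False using x(1) by simp
    qed
  qed (simp add: \<delta>)
qed

section \<open>Deformations of a degenerate trivector fill an open set\<close>

text \<open>Expansion along lines through \<open>u0\<close>. The coefficients are polynomial in the
  direction, and the degree bound is uniform so that \<open>curves_dense\<close> can sum over a
  fixed range.\<close>

lemma polyfun_expansion:
  fixes f :: "('t \<Rightarrow> 'a::comm_ring_1) \<Rightarrow> 'a"
  assumes "polyfun f"
  shows "\<exists>p D. (\<forall>y s. f (\<lambda>t. u0 t + s * y t) = poly (p y) s) \<and> (\<forall>d. polyfun (\<lambda>y. coeff (p y) d)) \<and>
    (\<forall>y. degree (p y) \<le> (D :: nat))"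
  using assms
proof induction
  case (const c)
  show ?case
    by (rule exI[of _ "\<lambda>_. [:c:]"], rule exI[of _ 0]) (auto intro: polyfun.const)
next
  case (coord t)
  have "polyfun (\<lambda>y. coeff [:u0 t, y t:] d)" for d
  proof (cases d)
    case (Suc e)
    then show ?thesis by (cases e) (auto intro: polyfun.intros)
  qed (auto intro: polyfun.intros)
  then show ?case
    by (intro exI[of _ "\<lambda>y. [:u0 t, y t:]"] exI[of _ 1]) (auto simp: algebra_simps)
next
  case (add f g)
  from add.IH(1) obtain p D where p: "\<forall>y s. f (\<lambda>t. u0 t + s * y t) = poly (p y) s"
    "\<forall>d. polyfun (\<lambda>y. coeff (p y) d)" "\<forall>y. degree (p y) \<le> D"
    by (elim exE conjE)
  from add.IH(2) obtain q E where q: "\<forall>y s. g (\<lambda>t. u0 t + s * y t) = poly (q y) s"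
    "\<forall>d. polyfun (\<lambda>y. coeff (q y) d)" "\<forall>y. degree (q y) \<le> E"
    by (elim exE conjE)
  have "degree (p y + q y) \<le> max D E" for y
    using p(3)[rule_format, of y] q(3)[rule_format, of y] by (intro degree_add_le) auto
  then show ?case
    by (intro exI[of _ "\<lambda>y. p y + q y"] exI[of _ "max D E"]) (simp add: p q polyfun.add)
next
  case (mult f g)
  from mult.IH(1) obtain p D where p: "\<forall>y s. f (\<lambda>t. u0 t + s * y t) = poly (p y) s"
    "\<forall>d. polyfun (\<lambda>y. coeff (p y) d)" "\<forall>y. degree (p y) \<le> D"
    by (elim exE conjE)
  from mult.IH(2) obtain q E where q: "\<forall>y s. g (\<lambda>t. u0 t + s * y t) = poly (q y) s"
    "\<forall>d. polyfun (\<lambda>y. coeff (q y) d)" "\<forall>y. degree (q y) \<le> E"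
    by (elim exE conjE)
  have "degree (p y * q y) \<le> D + E" for y
    using p(3)[rule_format, of y] q(3)[rule_format, of y] degree_mult_le[of "p y" "q y"] by linarith
  then show ?case
    by (intro exI[of _ "\<lambda>y. p y * q y"] exI[of _ "D + E"])
       (simp add: p q coeff_mult polyfun_sum polyfun.mult)
qed

lemma polyfun_curve:
  fixes f :: "('t \<Rightarrow> 'a::comm_ring_1) \<Rightarrow> 'a"
  assumes "polyfun f"
  shows "\<exists>g. \<forall>s. f (\<lambda>t. poly (Y t) s) = poly g s"
  using assms
proof induction
  case (const c)
  show ?case by (intro exI[of _ "[:c:]"]) simp
next
  case (add f g)
  then obtain p q where "\<forall>s. f (\<lambda>t. poly (Y t) s) = poly p s" "\<forall>s. g (\<lambda>t. poly (Y t) s) = poly q s"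
    by (elim exE)
  then show ?case by (intro exI[of _ "p + q"]) simp
next
  case (mult f g)
  then obtain p q where "\<forall>s. f (\<lambda>t. poly (Y t) s) = poly p s" "\<forall>s. g (\<lambda>t. poly (Y t) s) = poly q s"
    by (elim exE)
  then show ?case by (intro exI[of _ "p * q"]) simp
next
  case (coord t)
  show ?case by (rule exI[of _ "Y t"]) simp
qed

text \<open>The leading term of the expansion of \<open>\<delta>\<close> at \<open>u0\<close> would vanish in every direction \<open>w\<close>.\<close>

lemma curves_dense:
  fixes \<delta> :: "('t \<Rightarrow> 'a::alg_closed_field) \<Rightarrow> 'a"
  assumes \<delta>: "polyfun \<delta>"
    and W: "\<And>v. v \<in> W \<Longrightarrow> (\<lambda>t. v t - u0 t) \<in> W"
    and curve: "\<And>w. w \<in> W \<Longrightarrow> \<exists>Y S. (\<lambda>t. poly (Y t) 0) = w \<and> finite S \<and>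
      (\<forall>s. s \<notin> S \<longrightarrow> (\<lambda>t. poly (Y t) s) \<in> W \<and> \<delta> (\<lambda>t. u0 t + s * poly (Y t) s) = 0)"
    and v: "v \<in> W"
  shows "\<delta> v = 0"
proof -
  from polyfun_expansion[OF \<delta>, of u0] obtain p D where p: "\<forall>y s. \<delta> (\<lambda>t. u0 t + s * y t) = poly (p y) s"
    "\<forall>d. polyfun (\<lambda>y. coeff (p y) d)" "\<forall>y. degree (p y) \<le> D"
    by (elim exE conjE)
  have "coeff (p w) d = 0" if "w \<in> W" for d w
    using that
  proof (induction d arbitrary: w rule: less_induct)
    case (less d)
    from curve[OF less.prems] obtain Y S where Y: "(\<lambda>t. poly (Y t) 0) = w" "finite S"
      and Y_S: "\<forall>s. s \<notin> S \<longrightarrow> (\<lambda>t. poly (Y t) s) \<in> W \<and> \<delta> (\<lambda>t. u0 t + s * poly (Y t) s) = 0"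
      by (elim exE conjE)
    define y where "y s = (\<lambda>t. poly (Y t) s)" for s
    have "\<forall>e. \<exists>g. \<forall>s. coeff (p (y s)) (d + e) = poly g s"
      unfolding y_def by (intro allI polyfun_curve p(2)[rule_format])
    from choice[OF this] obtain g where g: "\<forall>e s. coeff (p (y s)) (d + e) = poly (g e) s" ..
    \<comment> \<open>The expansion along the curve divided by its factor \<open>s ^ d\<close>,
      available since the lower coefficients vanish by induction; its value at 0 is the coefficient
      sought.\<close>
    define h where "h = (\<Sum>e\<le>D. g e * monom 1 e)"
    have "poly h s = 0" if s: "s \<notin> insert 0 S" for s
    proof -
      have low: "coeff (p (y s)) e = 0" if "e < d" for e
        using less.IH[OF that] Y_S s by (simp add: y_def)
      have "0 = poly (p (y s)) s" using Y_S s p(1)[rule_format, of s "y s", symmetric] by (simp add: y_def)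
      also have "\<dots> = (\<Sum>e\<le>d + D. coeff (p (y s)) e * s ^ e)"
        unfolding poly_altdef
        by (rule sum.mono_neutral_left) (use p(3)[rule_format, of "y s"] in \<open>auto simp: coeff_eq_0\<close>)
      also have "\<dots> = (\<Sum>e\<in>{d..d + D}. coeff (p (y s)) e * s ^ e)"
        by (rule sum.mono_neutral_right) (auto simp: low)
      also have "\<dots> = (\<Sum>e\<le>D. coeff (p (y s)) (d + e) * s ^ (d + e))"
        using sum.shift_bounds_cl_nat_ivl[of "\<lambda>e. coeff (p (y s)) e * s ^ e" 0 d D]
        by (simp add: add.commute atMost_atLeast0)
      also have "\<dots> = s ^ d * poly h s"
        by (simp add: h_def poly_sum poly_monom g sum_distrib_left power_add mult_ac)
      finally show ?thesis using s by simp
    qed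
    then have "h = 0" using poly_eq_0_cofinite[of "insert 0 S" h] Y(2) by blast
    then have "poly h 0 = 0" by simp
    moreover have "poly h 0 = poly (g 0) 0"
    proof -
      have "poly h 0 = (\<Sum>e\<le>D. if e = 0 then poly (g 0) 0 else 0)"
        unfolding h_def poly_sum by (rule sum.cong) (auto simp: poly_monom power_0_left)
      then show ?thesis by simp
    qed
    moreover have "poly (g 0) 0 = coeff (p w) d" using g[rule_format, of 0 0] Y(1) by (simp add: y_def)
    ultimately show ?case by simp
  qed
  \<comment> \<open>With every coefficient zero in the direction from \<open>u0\<close> to
    \<open>v\<close>, the function vanishes along that line, which reaches \<open>v\<close> at
    parameter 1.\<close>
  then have "p (\<lambda>t. v t - u0 t) = 0" using W[OF v] by (intro poly_eqI) simp
  then show ?thesis using p(1)[rule_format, of 1 "\<lambda>t. v t - u0 t"] by simp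
qed

section \<open>Every trivector in nine variables has a degenerate point\<close>

definition wedge :: "'n \<Rightarrow> 'n \<Rightarrow> 'n \<Rightarrow> 'n \<times> 'n \<times> 'n \<Rightarrow> 'a::comm_ring_1" where
  "wedge a b c = (\<lambda>(p, q, r). unit a p * (unit b q * unit c r - unit b r * unit c q)
     - unit b p * (unit a q * unit c r - unit a r * unit c q)
     + unit c p * (unit a q * unit b r - unit a r * unit b q))"

lemma wedge_trivectors: "wedge a b c \<in> trivectors"
  by (rule trivectorsI) (simp_all add: wedge_def algebra_simps)

lemma tri_wedge:
  "tri (wedge a b c) x y z = x a * (y b * z c - y c * z b) - x b * (y a * z c - y c * z a)
     + x c * (y a * z b - y b * z a)"
proof -
  have mono: "(\<Sum>p\<in>UNIV. \<Sum>q\<in>UNIV. \<Sum>r\<in>UNIV. x p * y q * z r * (unit a p * (unit b q * unit c r))) = x a * y b * z c"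
    for a b c :: 'b
  proof -
    have "(\<Sum>p\<in>UNIV. \<Sum>q\<in>UNIV. \<Sum>r\<in>UNIV. x p * y q * z r * (unit a p * (unit b q * unit c r))) =
        (\<Sum>p\<in>UNIV. unit a p * (\<Sum>q\<in>UNIV. unit b q * (\<Sum>r\<in>UNIV. unit c r * (x p * y q * z r))))"
      by (simp add: sum_distrib_left mult_ac)
    then show ?thesis by (simp add: sum_unit)
  qed
  have "x p * y q * z r * wedge a b c (p, q, r) =
      x p * y q * z r * (unit a p * (unit b q * unit c r)) - x p * y q * z r * (unit a p * (unit c q * unit b r))
      - x p * y q * z r * (unit b p * (unit a q * unit c r)) + x p * y q * z r * (unit b p * (unit c q * unit a r))
      + x p * y q * z r * (unit c p * (unit a q * unit b r)) - x p * y q * z r * (unit c p * (unit b q * unit a r))" for p q r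
    by (simp add: wedge_def algebra_simps)
  then have "tri (wedge a b c) x y z = x a * y b * z c - x a * y c * z b - x b * y a * z c + x b * y c * z a
      + x c * y a * z b - x c * y b * z a"
    unfolding tri_def by (simp only: sum.distrib sum_subtractf mono)
  then show ?thesis by (simp add: algebra_simps)
qed

lemma trivectors_comb:
  assumes u: "u \<in> trivectors" and v: "v \<in> trivectors"
  shows "(\<lambda>t. c * u t + d * v t) \<in> trivectors"
proof (rule trivectorsI)
  show "c * u (q, p, r) + d * v (q, p, r) = - (c * u (p, q, r) + d * v (p, q, r))" for p q r
    unfolding trivectorsD(4)[OF u, of q p r] trivectorsD(4)[OF v, of q p r] by simp
  show "c * u (p, r, q) + d * v (p, r, q) = - (c * u (p, q, r) + d * v (p, q, r))" for p q r
    unfolding trivectorsD(5)[OF u, of p r q] trivectorsD(5)[OF v, of p r q] by simp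
qed (simp_all add: trivectorsD(1-3)[OF u] trivectorsD(1-3)[OF v])

lemma trivectors_add: "u \<in> trivectors \<Longrightarrow> v \<in> trivectors \<Longrightarrow> (\<lambda>t. u t + v t) \<in> trivectors"
  and trivectors_diff: "u \<in> trivectors \<Longrightarrow> v \<in> trivectors \<Longrightarrow> (\<lambda>t. u t - v t) \<in> trivectors"
  and trivectors_scale: "u \<in> trivectors \<Longrightarrow> (\<lambda>t. c * u t) \<in> trivectors"
  using trivectors_comb[of u v 1 1] trivectors_comb[of u v 1 "-1"] trivectors_comb[of u u c 0] by simp_all

lemma tri_expand_first: "tri u x y z = (\<Sum>p\<in>UNIV. x p * tri u (unit p) y z)"
proof -
  have "x = (\<lambda>d. \<Sum>p\<in>UNIV. x p * unit p d)"
  proof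
    fix d show "x d = (\<Sum>p\<in>UNIV. x p * unit p d)"
      using sum_unit[of d x] by (simp add: unit_def mult.commute eq_commute[of d])
  qed
  then have "tri u x y z = tri u (\<lambda>d. \<Sum>p\<in>UNIV. x p * unit p d) y z" by (rule arg_cong)
  then show ?thesis unfolding tri_sum(1) .
qed

text \<open>A form depending on four coordinates only has rank at most four. The pivot is the
  Pfaffian on these coordinates, adjoined as extra indices \<open>Inr\<close>.\<close>

lemma pf6_pullback_eq_0:
  fixes u :: "'n::finite \<times> 'n \<times> 'n \<Rightarrow> 'a::field" and V :: "'m \<Rightarrow> 'n \<Rightarrow> 'a"
  assumes u: "u \<in> trivectors"
    and dist: "distinct [b1, b2, b3, b4]"
    and supp: "\<And>p z. p \<notin> {b1, b2, b3, b4} \<Longrightarrow> tri u (unit p) z x = 0"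
    and ne: "pf4 (\<lambda>p q. tri u (unit p) (unit q) x) b1 b2 b3 b4 \<noteq> 0"
  shows "pf6 (\<lambda>p q. tri u (V p) (V q) x) c1 c2 c3 c4 c5 c6 = 0"
proof -
  define W where "W = case_sum V (unit :: 'n \<Rightarrow> 'n \<Rightarrow> 'a)"
  define A where "A = (\<lambda>\<alpha> \<beta>. tri u (W \<alpha>) (W \<beta>) x)"
  have alt: "alt_mat A"
    unfolding alt_mat_def A_def using tri_alt(1)[OF u] tri_swap(1)[OF u] by blast
  have first: "tri u y z x = y b1 * tri u (unit b1) z x + y b2 * tri u (unit b2) z x
      + y b3 * tri u (unit b3) z x + y b4 * tri u (unit b4) z x" for y z
  proof -
    have "tri u y z x = (\<Sum>p\<in>{b1, b2, b3, b4}. y p * tri u (unit p) z x)"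
      unfolding tri_expand_first[of u y] by (rule sum.mono_neutral_right) (auto simp: supp)
    then show ?thesis using dist by (simp add: algebra_simps)
  qed
  let ?b = "\<lambda>b. Inr b :: 'm + 'n"
  have row: "A \<alpha> \<beta> = W \<alpha> b1 * A (?b b1) \<beta> + W \<alpha> b2 * A (?b b2) \<beta> + W \<alpha> b3 * A (?b b3) \<beta> + W \<alpha> b4 * A (?b b4) \<beta>" for \<alpha> \<beta>
    unfolding A_def using first[of "W \<alpha>" "W \<beta>"] by (simp add: W_def)
  have col: "A \<beta> \<alpha> = W \<alpha> b1 * A \<beta> (?b b1) + W \<alpha> b2 * A \<beta> (?b b2) + W \<alpha> b3 * A \<beta> (?b b3) + W \<alpha> b4 * A \<beta> (?b b4)" for \<alpha> \<beta>
    using row[of \<alpha> \<beta>] by (simp add: alt_mat_swap[OF alt, of \<beta>] algebra_simps)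
  have base: "pf6 A (?b b1) (?b b2) (?b b3) (?b b4) \<alpha> \<beta> = 0" for \<alpha> \<beta>
  proof -
    note rep = pf6_last_repeat[OF alt]
    have "pf6 A (?b b1) (?b b2) (?b b3) (?b b4) \<alpha> \<beta> =
      W \<beta> b1 * pf6 A (?b b1) (?b b2) (?b b3) (?b b4) \<alpha> (?b b1) + W \<beta> b2 * pf6 A (?b b1) (?b b2) (?b b3) (?b b4) \<alpha> (?b b2)
      + W \<beta> b3 * pf6 A (?b b1) (?b b2) (?b b3) (?b b4) \<alpha> (?b b3) + W \<beta> b4 * pf6 A (?b b1) (?b b2) (?b b3) (?b b4) \<alpha> (?b b4)"
      unfolding pf6_last col[of "?b b1" \<beta>] col[of "?b b2" \<beta>] col[of "?b b3" \<beta>] col[of "?b b4" \<beta>] col[of \<alpha> \<beta>]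
      by (simp add: algebra_simps)
    then show ?thesis by (simp add: rep)
  qed
  have "is_id {0 :: 'a}" by (simp add: is_id_def)
  then have "pf6 A (Inl c1) (Inl c2) (Inl c3) (Inl c4) (Inl c5) (Inl c6) \<in> {0}"
  proof (rule pf6_generated[OF alt])
    have "pf4 A (?b b1) (?b b2) (?b b3) (?b b4) \<noteq> 0"
      using ne by (simp add: A_def W_def pf4_def)
    then show "f \<in> {0}" if "pf4 A (?b b1) (?b b2) (?b b3) (?b b4) * f \<in> {0}" for f
      using that by simp
  qed (simp add: base)
  then show ?thesis by (simp add: A_def W_def pf6_def pf4_def)
qed

text \<open>Naming the nine elements turns computations with \<open>u0\<close> into case
  distinctions for the simplifier; \<open>degenerate_9\<close> supplies an enumeration.\<close>

locale nine_indices =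
  fixes e1 e2 e3 e4 e5 e6 e7 e8 e9 :: "'n::finite"
  assumes dist: "distinct [e1, e2, e3, e4, e5, e6, e7, e8, e9]"
    and cover: "p \<in> {e1, e2, e3, e4, e5, e6, e7, e8, e9}"
begin

lemma rev_dist: "distinct [e9, e8, e7, e6, e5, e4, e3, e2, e1]"
  using dist by auto

lemmas neq = dist[simplified] rev_dist[simplified]

text \<open>For \<open>u0\<close> the point dual to \<open>e1\<close> is degenerate: its contraction is the symplectic form \<open>67 + 89\<close>, with kernel
  \<open>e1, \<dots>, e5\<close>. The last four terms map the six bivectors in \<open>e2, \<dots>, e5\<close> to six independent vectors, so that
  a first-order motion \<open>dir w\<close> of the point and the kernel absorbs the conormal part of any \<open>w\<close>.\<close>

definition u0 :: "'n \<times> 'n \<times> 'n \<Rightarrow> 'a::comm_ring_1" where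
  "u0 t = wedge e1 e6 e7 t + wedge e1 e8 e9 t + wedge e2 e3 e4 t + wedge e2 e5 e6 t
     + wedge e3 e5 e7 t + wedge e4 e5 e8 t"

lemma u0_trivectors: "(u0 :: 'n \<times> 'n \<times> 'n \<Rightarrow> 'a::comm_ring_1) \<in> trivectors"
proof -
  have "(\<lambda>t. wedge e1 e6 e7 t + wedge e1 e8 e9 t + wedge e2 e3 e4 t + wedge e2 e5 e6 t
     + wedge e3 e5 e7 t + wedge e4 e5 e8 t :: 'a) \<in> trivectors"
    by (intro trivectors_add wedge_trivectors)
  then show ?thesis by (simp add: u0_def[abs_def])
qed

lemma tri_u0:
  "tri u0 x y z = tri (wedge e1 e6 e7) x y z + tri (wedge e1 e8 e9) x y z + tri (wedge e2 e3 e4) x y z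
     + tri (wedge e2 e5 e6) x y z + tri (wedge e3 e5 e7) x y z + tri (wedge e4 e5 e8) x y z"
  by (simp add: u0_def[abs_def] tri_fun_add)

lemma u_ne: "unit a b = (0 :: 'a::comm_ring_1)" if "distinct [b, a]" for a b :: 'n
  using that by (simp add: unit_other)

text \<open>Chosen so that \<open>u0\<close> on \<open>dir_a w\<close>, e_i, e_j equals
  \<open>w\<close> on e1, e_i, e_j for the six pairs from e2, ..., e5: each of the six coordinates
  used is read off by one pair through the last four terms of \<open>u0\<close>.\<close>

definition dir_a :: "('n \<times> 'n \<times> 'n \<Rightarrow> 'a::comm_ring_1) \<Rightarrow> 'n \<Rightarrow> 'a" where
  "dir_a w = (\<lambda>d. w (e1, e3, e4) * unit e2 d - w (e1, e2, e4) * unit e3 d + w (e1, e2, e3) * unit e4 d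
     + w (e1, e2, e5) * unit e6 d + w (e1, e3, e5) * unit e7 d + w (e1, e4, e5) * unit e8 d)"

text \<open>Corrects the kernel vector \<open>i\<close> so that the values with e6, ..., e9 match as
  well; the formula inverts the symplectic form 67 + 89.\<close>

definition dir_b :: "('n \<times> 'n \<times> 'n \<Rightarrow> 'a::comm_ring_1) \<Rightarrow> 'n \<Rightarrow> 'n \<Rightarrow> 'a" where
  "dir_b w i = (let z = (\<lambda>q. w (e1, i, q) - tri u0 (dir_a w) (unit i) (unit q)) in
     (\<lambda>d. z e7 * unit e6 d - z e6 * unit e7 d + z e9 * unit e8 d - z e8 * unit e9 d))"

definition dir :: "('n \<times> 'n \<times> 'n \<Rightarrow> 'a::comm_ring_1) \<Rightarrow> 'n \<Rightarrow> 'n \<Rightarrow> 'a" where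
  "dir w i = (if i = e1 then dir_a w else if i \<in> {e2, e3, e4, e5} then dir_b w i else (\<lambda>_. 0))"

text \<open>The infinitesimal action of the endomorphism \<open>dir w\<close> on
  \<open>u0\<close>.\<close>

definition tangent :: "('n \<times> 'n \<times> 'n \<Rightarrow> 'a::comm_ring_1) \<Rightarrow> 'n \<times> 'n \<times> 'n \<Rightarrow> 'a" where
  "tangent w = (\<lambda>(p, q, r). tri u0 (dir w p) (unit q) (unit r) + tri u0 (unit p) (dir w q) (unit r)
     + tri u0 (unit p) (unit q) (dir w r))"

lemma tangent_trivectors: "tangent w \<in> trivectors"
proof (rule trivectorsI)
  note alt = tri_alt[OF u0_trivectors] and sw = tri_swap[OF u0_trivectors]
  show "tangent w (a, a, c) = 0" for a c
    using sw(1)[of "dir w a" "unit a" "unit c"] by (simp add: tangent_def alt)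
  show "tangent w (a, b, b) = 0" for a b
    using sw(2)[of "unit a" "dir w b" "unit b"] by (simp add: tangent_def alt)
  show "tangent w (a, b, a) = 0" for a b
    using sw(1)[of "dir w a" "unit b" "unit a"] sw(2)[of "unit b" "dir w a" "unit a"] sw(1)[of "unit b" "unit a" "dir w a"]
    by (simp add: tangent_def alt)
  show "tangent w (b, a, c) = - tangent w (a, b, c)" for a b c
    by (simp add: tangent_def sw(1)[of "dir w b"] sw(1)[of "unit b" "dir w a"] sw(1)[of "unit b" "unit a"])
  show "tangent w (a, c, b) = - tangent w (a, b, c)" for a b c
    by (simp add: tangent_def sw(2)[of _ "dir w c" "unit b"] sw(2)[of _ "unit c" "dir w b"] sw(2)[of _ "unit c" "unit b"])
qed

text \<open>Thus \<open>w - tangent w\<close> vanishes on e1 and any of e2, ..., e5, which keeps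
  these vectors in the kernel of the contraction at e1.\<close>

lemma tangent_eq:
  fixes w :: "'n \<times> 'n \<times> 'n \<Rightarrow> 'a::comm_ring_1"
  assumes w: "w \<in> trivectors" and i: "i \<in> {e2, e3, e4, e5}"
  shows "tangent w (e1, i, q) = w (e1, i, q)"
proof -
  note w0 = trivectorsD(1-3)[OF w]
  have third: "tri u0 (unit e1) (unit i) y = (0 :: 'a)" for y
    using i by (elim insertE emptyE) (simp_all add: tri_u0 tri_wedge u_ne neq)
  have T: "tangent w (e1, i, q) = tri u0 (dir_a w) (unit i) (unit q) + tri u0 (unit e1) (dir_b w i) (unit q)"
    using i neq by (auto simp: tangent_def third dir_def)
  have b_N: "tri u0 (unit e1) (dir_b w i) (unit q) = 0" if "q \<in> {e1, e2, e3, e4, e5}"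
    using that by (elim insertE emptyE) (simp_all add: tri_u0 tri_wedge u_ne neq dir_b_def Let_def)
  have b_R: "tri u0 (unit e1) (dir_b w i) (unit q) = w (e1, i, q) - tri u0 (dir_a w) (unit i) (unit q)" if "q \<in> {e6, e7, e8, e9}"
    using that
    by (elim insertE emptyE)
       (simp_all add: tri_u0[of "unit e1"] tri_wedge[of _ _ _ "unit e1"] u_ne neq dir_b_def Let_def)
  have a_N: "tri u0 (dir_a w) (unit i) (unit q) = w (e1, i, q)" if "q \<in> {e1, e2, e3, e4, e5}"
  proof -
    have sw: "w (e1, e3, e2) = - w (e1, e2, e3)" "w (e1, e4, e2) = - w (e1, e2, e4)" "w (e1, e5, e2) = - w (e1, e2, e5)"
      "w (e1, e4, e3) = - w (e1, e3, e4)" "w (e1, e5, e3) = - w (e1, e3, e5)" "w (e1, e5, e4) = - w (e1, e4, e5)"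
      by (rule trivectorsD(5)[OF w])+
    show ?thesis
      using i that
      by (elim insertE emptyE) (simp_all add: tri_u0 tri_wedge u_ne neq dir_a_def w0 sw)
  qed
  show ?thesis
    using cover[of q] b_N b_R a_N unfolding T by auto
qed

definition shift :: "('n \<times> 'n \<times> 'n \<Rightarrow> 'a::comm_ring_1) \<Rightarrow> 'a \<Rightarrow> 'n \<Rightarrow> 'n \<Rightarrow> 'a" where
  "shift w s p = (\<lambda>d. unit p d + s * dir w p d)"

text \<open>For every \<open>s\<close> the contraction at e1 has support on e6, ..., e9. The part
  \<open>tangent w\<close> removed here is restored to first order by moving the frame in
  \<open>curve\<close>, whose velocity at 0 is therefore \<open>w\<close>.\<close>

definition base :: "('n \<times> 'n \<times> 'n \<Rightarrow> 'a::comm_ring_1) \<Rightarrow> 'a \<Rightarrow> 'n \<times> 'n \<times> 'n \<Rightarrow> 'a" where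
  "base w s = (\<lambda>t. u0 t + s * (w t - tangent w t))"

definition curve :: "('n \<times> 'n \<times> 'n \<Rightarrow> 'a::comm_ring_1) \<Rightarrow> 'a \<Rightarrow> 'n \<times> 'n \<times> 'n \<Rightarrow> 'a" where
  "curve w s = (\<lambda>(p, q, r). tri (base w s) (shift w s p) (shift w s q) (shift w s r))"

text \<open>The expansion of the displacement of \<open>curve\<close> from \<open>u0\<close>,
  divided by \<open>s\<close>: four coefficients, as \<open>curve\<close> has degree at most four in
  \<open>s\<close>, one from \<open>base\<close> and three from the frame.\<close>

definition velocity :: "('n \<times> 'n \<times> 'n \<Rightarrow> 'a::comm_ring_1) \<Rightarrow> 'n \<times> 'n \<times> 'n \<Rightarrow> 'a poly" where
  "velocity w = (\<lambda>(p, q, r). let \<sigma> = (\<lambda>t. w t - tangent w t); U = unit p; V = unit q; W = unit r;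
       A = dir w p; B = dir w q; C = dir w r in
     [:w (p, q, r),
       tri u0 A B W + tri u0 A V C + tri u0 U B C + tri \<sigma> A V W + tri \<sigma> U B W + tri \<sigma> U V C,
       tri u0 A B C + tri \<sigma> A B W + tri \<sigma> A V C + tri \<sigma> U B C,
       tri \<sigma> A B C:])"

lemma curve_eq:
  fixes w :: "'n \<times> 'n \<times> 'n \<Rightarrow> 'a::comm_ring_1"
  shows "curve w s t = u0 t + s * poly (velocity w t) s"
proof (cases t)
  case (fields p q r)
  define \<sigma> where "\<sigma> = (\<lambda>t. w t - tangent w t)"
  have "tri \<sigma> (unit p) (unit q) (unit r) = w (p, q, r) - tangent w (p, q, r)"
    by (simp only: tri_units \<sigma>_def)
  then have w_eq: "w (p, q, r) = tri \<sigma> (unit p) (unit q) (unit r) + (tri u0 (dir w p) (unit q) (unit r)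
      + tri u0 (unit p) (dir w q) (unit r) + tri u0 (unit p) (unit q) (dir w r))"
    by (simp add: tangent_def)
  have base: "base w s = (\<lambda>t. u0 t + s * \<sigma> t)" by (simp add: base_def \<sigma>_def)
  show ?thesis
    unfolding fields curve_def base shift_def velocity_def Let_def prod.case \<sigma>_def[symmetric]
      tri_fun_add tri_fun_scale tri_add tri_scale
    by (simp add: w_eq tri_units algebra_simps)
qed

lemma base_trivectors: "w \<in> trivectors \<Longrightarrow> base w s \<in> trivectors"
  unfolding base_def by (intro trivectors_add trivectors_scale trivectors_diff u0_trivectors tangent_trivectors)

lemma curve_trivectors:
  assumes "w \<in> trivectors"
  shows "curve w s \<in> trivectors"
  by (rule trivectorsI) (unfold curve_def prod.case,
      (rule tri_alt[OF base_trivectors[OF assms]] tri_swap[OF base_trivectors[OF assms]])+)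

lemma base_support:
  fixes w :: "'n \<times> 'n \<times> 'n \<Rightarrow> 'a::comm_ring_1"
  assumes w: "w \<in> trivectors" and p: "p \<notin> {e6, e7, e8, e9}"
  shows "tri (base w s) (unit p) z (unit e1) = 0"
proof -
  have b: "base w s \<in> trivectors" by (rule base_trivectors[OF w])
  have "base w s (e1, p, q) = 0" for q
  proof (cases "p = e1")
    case False
    then have i: "p \<in> {e2, e3, e4, e5}" using cover[of p] p by auto
    have "u0 (e1, p, q) = (0 :: 'a)"
      using i unfolding tri_units[symmetric]
      by (elim insertE emptyE) (simp_all add: tri_u0 tri_wedge u_ne neq)
    then show ?thesis by (simp add: base_def tangent_eq[OF w i])
  qed (simp add: trivectorsD(1)[OF b])
  then have "base w s (p, q, e1) = 0" for q
    using trivectorsD(4)[OF b, of p e1 q] trivectorsD(5)[OF b, of p q e1] by simp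
  then show ?thesis
    by (simp add: tri_contract contract_def sum_unit mult.commute[of _ "unit e1 _"] )
qed

text \<open>The preimage of \<open>e1\<close> under \<open>1 + s A\<close>, by the geometric series for the nilpotent \<open>A = dir w\<close>.\<close>

definition point :: "('n \<times> 'n \<times> 'n \<Rightarrow> 'a::comm_ring_1) \<Rightarrow> 'a \<Rightarrow> 'n \<Rightarrow> 'a" where
  "point w s = (\<lambda>d. unit e1 d - s * dir_a w d + s ^ 2 * (\<Sum>p\<in>UNIV. dir_a w p * dir w p d))"

text \<open>Nilpotency: e1 goes into the span of e2, ..., e9, the vectors e2, ..., e5 go into that
  of e6, ..., e9, and these go to 0. The third power is zero, so the series for \<open>point\<close>
  stops at \<open>s ^ 2\<close>.\<close>

lemma dir_support:
  "dir w p e1 = 0" "p \<noteq> e1 \<Longrightarrow> d \<notin> {e6, e7, e8, e9} \<Longrightarrow> dir w p d = 0" "p \<in> {e6, e7, e8, e9} \<Longrightarrow> dir w p d = 0"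
  by (auto simp: dir_def dir_a_def dir_b_def Let_def unit_def neq)

lemma shift_point:
  fixes w :: "'n \<times> 'n \<times> 'n \<Rightarrow> 'a::comm_ring_1"
  shows "(\<Sum>c\<in>UNIV. point w s c * shift w s c d) = unit e1 d"
proof -
  let ?A2 = "\<lambda>d. \<Sum>p\<in>UNIV. dir_a w p * dir w p d"
  have lin: "(\<Sum>c\<in>UNIV. y c * shift w s c d) = y d + s * (\<Sum>c\<in>UNIV. y c * dir w c d)" for y :: "'n \<Rightarrow> 'a"
  proof -
    have "y c * shift w s c d = unit d c * y c + s * (y c * dir w c d)" for c
      by (simp add: shift_def unit_def algebra_simps)
    then show ?thesis by (simp add: sum.distrib sum_unit flip: sum_distrib_left)
  qed
  have A2: "(\<Sum>c\<in>UNIV. ?A2 c * dir w c d) = 0"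
  proof (rule sum.neutral, rule ballI)
    fix c
    show "?A2 c * dir w c d = 0"
    proof (cases "c \<in> {e6, e7, e8, e9}")
      case True
      then show ?thesis by (simp add: dir_support(3))
    next
      case False
      have "dir_a w p * dir w p c = 0" for p
        using dir_support(1)[of w e1] dir_support(2)[of p c w] False by (cases "p = e1") (auto simp: dir_def)
      then show ?thesis by simp
    qed
  qed
  have "point w s c * dir w c d = unit e1 c * dir w c d - s * (dir_a w c * dir w c d) + s ^ 2 * (?A2 c * dir w c d)" for c
    by (simp add: point_def algebra_simps)
  then have "(\<Sum>c\<in>UNIV. point w s c * dir w c d) = dir w e1 d - s * ?A2 d + s ^ 2 * (\<Sum>c\<in>UNIV. ?A2 c * dir w c d)"
    by (simp only: sum.distrib sum_subtractf sum_unit sum_distrib_left[symmetric])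
  then have sum_dir: "(\<Sum>c\<in>UNIV. point w s c * dir w c d) = dir_a w d - s * ?A2 d"
    unfolding A2 by (simp add: dir_def)
  have point: "point w s d = unit e1 d - s * dir_a w d + s ^ 2 * ?A2 d" by (simp add: point_def)
  show ?thesis
    unfolding lin sum_dir point by (simp add: algebra_simps power2_eq_square)
qed

lemma point_e1: "point w s e1 = 1"
proof -
  have "dir_a w e1 = 0" by (simp add: dir_a_def u_ne neq)
  then show ?thesis by (simp add: point_def dir_support(1))
qed

text \<open>By \<open>shift_point\<close>, the contraction of the curve at \<open>point\<close> is
  the pullback along the moved frame of the contraction of \<open>base\<close> at e1, a form in four
  coordinates.\<close>

lemma curve_degenerate:
  fixes w :: "'n \<times> 'n \<times> 'n \<Rightarrow> 'a::field"
  assumes w: "w \<in> trivectors"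
    and ne: "pf4 (\<lambda>p q. base w s (p, q, e1)) e6 e7 e8 e9 \<noteq> 0"
  shows "degenerate (curve w s)"
proof -
  have "contract (curve w s) (point w s) p q = tri (base w s) (shift w s p) (shift w s q) (unit e1)" for p q
  proof -
    have "tri (base w s) (shift w s p) (shift w s q) (unit e1) =
        tri (base w s) (shift w s p) (shift w s q) (\<lambda>d. \<Sum>c\<in>UNIV. point w s c * shift w s c d)"
      by (simp only: shift_point)
    then show ?thesis
      unfolding tri_sum(3) by (simp add: contract_def curve_def mult.commute)
  qed
  then have eq: "contract (curve w s) (point w s) = (\<lambda>p q. tri (base w s) (shift w s p) (shift w s q) (unit e1))"
    by blast
  have "pf6 (contract (curve w s) (point w s)) c1 c2 c3 c4 c5 c6 = 0" for c1 c2 c3 c4 c5 c6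
    unfolding eq
  proof (rule pf6_pullback_eq_0[OF base_trivectors[OF w], where ?b1.0 = e6 and ?b2.0 = e7 and ?b3.0 = e8 and ?b4.0 = e9])
    show "distinct [e6, e7, e8, e9]" using dist by simp
    show "pf4 (\<lambda>p q. tri (base w s) (unit p) (unit q) (unit e1)) e6 e7 e8 e9 \<noteq> 0"
      unfolding tri_units by (rule ne)
  qed (rule base_support[OF w])
  moreover have "point w s e1 \<noteq> 0" by (simp add: point_e1)
  ultimately show ?thesis unfolding degenerate_def by blast
qed

text \<open>As a polynomial in \<open>s\<close> the Pfaffian has value 1 at 0, coming from the form
  67 + 89.\<close>

lemma finite_bad:
  fixes w :: "'n \<times> 'n \<times> 'n \<Rightarrow> 'a::field"
  shows "finite {s. pf4 (\<lambda>p q. base w s (p, q, e1)) e6 e7 e8 e9 = 0}"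
proof -
  define Q where "Q p q = [:u0 (p, q, e1), w (p, q, e1) - tangent w (p, q, e1):]" for p q
  have "poly (Q p q) s = base w s (p, q, e1)" for p q s by (simp add: Q_def base_def)
  then have Q: "poly (pf4 Q e6 e7 e8 e9) s = pf4 (\<lambda>p q. base w s (p, q, e1)) e6 e7 e8 e9" for s
    by (simp only: pf4_def poly_diff poly_add poly_mult)
  have "u0 (e6, e7, e1) = (1 :: 'a)" "u0 (e8, e9, e1) = (1 :: 'a)" "u0 (e6, e8, e1) = (0 :: 'a)"
    "u0 (e6, e9, e1) = (0 :: 'a)"
    unfolding tri_units[symmetric] by (simp_all add: tri_u0 tri_wedge u_ne neq)
  then have "poly (pf4 Q e6 e7 e8 e9) 0 = 1" by (simp add: pf4_def Q_def)
  then have "pf4 Q e6 e7 e8 e9 \<noteq> 0" by auto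
  then show ?thesis using poly_roots_finite unfolding Q[symmetric] by blast
qed

lemma all_degenerate:
  fixes u :: "'n \<times> 'n \<times> 'n \<Rightarrow> 'a::alg_closed_field"
  assumes u: "u \<in> trivectors"
  shows "degenerate u"
proof (rule ccontr)
  assume "\<not> degenerate u"
  then obtain \<delta> where \<delta>: "polyfun \<delta>" "\<delta> u \<noteq> 0" and zero: "\<forall>u'. degenerate u' \<longrightarrow> \<delta> u' = 0"
    by (rule degenerate_closed) blast
  have "\<delta> u = 0"
  proof (rule curves_dense[OF \<delta>(1), where W = trivectors and ?u0.0 = u0])
    show "(\<lambda>t. v t - u0 t) \<in> trivectors" if "v \<in> trivectors" for v :: "'n \<times> 'n \<times> 'n \<Rightarrow> 'a"
      by (intro trivectors_diff that u0_trivectors)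
    fix w :: "'n \<times> 'n \<times> 'n \<Rightarrow> 'a" assume w: "w \<in> trivectors"
    \<comment> \<open>Zero is excluded because \<open>velocity\<close> is recovered from the curve
      by dividing by \<open>s\<close>.\<close>
    let ?S = "insert 0 {s. pf4 (\<lambda>p q. base w s (p, q, e1)) e6 e7 e8 e9 = 0}"
    have "(\<lambda>t. poly (velocity w t) 0) = w" by (auto simp: velocity_def Let_def)
    moreover have "finite ?S" by (simp add: finite_bad)
    moreover have "(\<lambda>t. poly (velocity w t) s) \<in> trivectors \<and> \<delta> (\<lambda>t. u0 t + s * poly (velocity w t) s) = 0"
      if s: "s \<notin> ?S" for s
    proof
      have "(\<lambda>t. inverse s * (curve w s t - u0 t)) \<in> trivectors"
        by (intro trivectors_scale trivectors_diff curve_trivectors[OF w] u0_trivectors)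
      then show "(\<lambda>t. poly (velocity w t) s) \<in> trivectors" using s by (simp add: curve_eq mult.assoc[symmetric])
      have "degenerate (curve w s)" using s by (intro curve_degenerate w) simp
      then have "\<delta> (curve w s) = 0" using zero by blast
      then show "\<delta> (\<lambda>t. u0 t + s * poly (velocity w t) s) = 0" by (simp flip: curve_eq)
    qed
    ultimately show "\<exists>Y S. (\<lambda>t. poly (Y t) 0) = w \<and> finite S \<and>
      (\<forall>s. s \<notin> S \<longrightarrow> (\<lambda>t. poly (Y t) s) \<in> trivectors \<and> \<delta> (\<lambda>t. u0 t + s * poly (Y t) s) = 0)"
      by (intro exI[of _ "velocity w"] exI[of _ ?S]) blast
  qed (rule u)
  then show False using \<delta>(2) by contradiction
qed

end

section \<open>Nonemptiness of X and the conclusion\<close>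

lemma degenerate_9:
  fixes u :: "9 \<times> 9 \<times> 9 \<Rightarrow> 'a::alg_closed_field"
  assumes "u \<in> trivectors"
  shows "degenerate u"
proof -
  obtain es where es: "set es = (UNIV :: 9 set)" "distinct es"
    using finite_distinct_list[of "UNIV :: 9 set"] by auto
  then have "length es = 9" using distinct_card[of es] by simp
  then obtain e1 e2 e3 e4 e5 e6 e7 e8 e9 where "es = [e1, e2, e3, e4, e5, e6, e7, e8, e9]"
    by (auto simp: eval_nat_numeral length_Suc_conv)
  then interpret nine_indices e1 e2 e3 e4 e5 e6 e7 e8 e9
    using es by unfold_locales auto
  show ?thesis by (rule all_degenerate[OF assms])
qed

lemma X_nonempty:
  fixes u :: "9 \<times> 9 \<times> 9 \<Rightarrow> 'k::field"
  assumes u: "u \<in> trivectors"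
  shows "\<exists>i. chart_points (X_equations u) i \<noteq> {}"
proof -
  let ?uK = "\<lambda>t. to_ac (u t)"
  have "degenerate ?uK" by (rule degenerate_9[OF comp_trivectors[OF coeff_hom_to_ac u]])
  then obtain x i where x: "x i \<noteq> 0" "\<And>a b c d e f. pf6 (contract ?uK x) a b c d e f = 0"
    unfolding degenerate_def by blast
  interpret coeff_hom "to_ac :: 'k \<Rightarrow> 'k alg_closure" by (rule coeff_hom_to_ac)
  \<comment> \<open>Scaling places the geometric point on the hyperplane of the chart; the scheme
    point is the kernel of evaluation there.\<close>
  define y where "y = (\<lambda>v. inverse (x i) * x v)"
  define P where "P = {f. ev (to_ac :: 'k \<Rightarrow> 'k alg_closure) y f = 0}"
  have "prime_id P" by (auto simp: prime_id_def P_def)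
  moreover have "chart_ideal (X_equations u) i \<subseteq> P"
    unfolding chart_ideal_def
  proof (rule Idl_least)
    show "is_id P" by (rule prime_id_is_id) fact
    have "Var i - 1 \<in> P" using x(1) by (simp add: P_def y_def)
    moreover have "X_equations u \<subseteq> P"
    proof
      fix f assume "f \<in> X_equations u"
      then obtain as where "f = pfaffian (Phi u) as" "length as = 6" by (auto simp: X_equations_def)
      then obtain a b c d e g where f: "f = pf6 (Phi u) a b c d e g"
        by (auto simp: eval_nat_numeral length_Suc_conv pfaffian_6[symmetric] simp del: pfaffian.simps)
      have scale: "pf6 (contract ?uK y) a b c d e g = inverse (x i) ^ 3 * pf6 (contract ?uK x) a b c d e g"
        unfolding y_def by (rule pf6_contract_scale)
      show "f \<in> P"
        by (simp add: P_def f scale coeff_hom.hom_pf6[OF coeff_hom_ev] ev_Phi[OF coeff_hom_to_ac] x(2))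
    qed
    ultimately show "insert (Var i - 1) (X_equations u) \<subseteq> P" by blast
  qed
  ultimately show ?thesis using prime_id_primeideal[of P] by (auto simp: chart_points_def)
qed

theorem lemma3p1:
  fixes u :: "9 \<times> 9 \<times> 9 \<Rightarrow> 'k::field"
  assumes "u \<in> trivectors"
    and "stable_trivector u"
  shows "proj_smooth_of_dim (X_equations u) 2 \<and> (\<forall>i. rank_locus u 2 i = {})"
proof -
  have st: "no_destab (\<lambda>t. to_ac (u t))" by (rule stable_no_destab[OF assms])
  have "rank_locus u 2 i = {}" for i by (rule rank_locus_2_empty[OF assms(1) st]) simp
  moreover have "proj_smooth_of_dim (X_equations u) 2"
    unfolding proj_smooth_of_dim_def using X_nonempty[OF assms(1)] X_smooth_at[OF assms(1) st] by blast
  ultimately show ?thesis by blast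
qed

end
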